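(* Let $\Omega\subset\mathbb{R}^N$ $(N\ge 2)$ be a bounded domain, $a,b\ge 0$, $0<s<1<2<2_s^*<2^*$, $\lambda>0$, $\mu\in\mathbb{R}$ and $\gamma\in(0,1)$, and let $\xi$ be the cut-off function given in the context. Any (weak) solution $u\in Z$ of the problem $$a(-\Delta)^su-b\Delta u=\lambda\frac{u}{|u|^{\gamma+1}}+\mu|u|^{2_s^*-2}u\,\xi(\|u\|)\ \text{ in }\Omega,\qquad u=0\ \text{ in }\mathbb{R}^N\setminus\Omega,$$ is in $L^\infty(\Omega)$.
   Context: Here $2_s^*=\frac{2N}{N-2s}$, $2^*=\frac{2N}{N-2}$, and $(-\Delta)^s u(x)=\mathrm{P.V.}\int_{\mathbb{R}^N}\frac{u(x)-u(y)}{|x-y|^{N+2s}}\,dy$. Let $Q=\mathbb{R}^{2N}\setminus\big((\mathbb{R}^N\setminus\Omega)\times(\mathbb{R}^N\setminus\Omega)\big)$, $[u]_{s,2}=\Big(\iint_Q\frac{|u(x)-u(y)|^2}{|x-y|^{N+2s}}dx\,dy\Big)^{1/2}$ and $\|u\|_{1,2}=\Big(\int_\Omega|\nabla u|^2dx\Big)^{1/2}$. Functions on $\Omega$ are extended by zero to $\mathbb{R}^N$. Let $X$ and $Y$ be the closures of $C_c^\infty(\Omega)$ in $H^s(\Omega)$ and $H^1(\Omega)$, with norms $\|u\|_X=\|u\|_{L^2(\Omega)}+[u]_{s,2}$ and $\|u\|_Y=\|u\|_{L^2(\Omega)}+\|u\|_{1,2}$. Let $Z$ be the space of functions $u$ (in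 $X$ if $a>0$, in $Y$ if $b>0$) with $a[u]_{s,2}^2+b\|u\|_{1,2}^2<\infty$, with norm $\|u\|=(a[u]_{s,2}^2+b\|u\|_{1,2}^2)^{1/2}$. Cut-off: for a fixed $l>0$, $\xi(t)=1$ if $|t|\le l$, $\xi$ is decreasing for $l\le t\le 2l$, and $\xi(t)=0$ if $|t|\ge 2l$. A function $u\in Z$ is a weak solution of the cut-off problem if for every $\varphi\in Z$ $$a\iint_Q\frac{(u(x)-u(y))(\varphi(x)-\varphi(y))}{|x-y|^{N+2s}}dx\,dy+b\int_\Omega\nabla u\cdot\nabla\varphi\,dx=\int_\Omega\lambda|u|^{-\gamma-1}u\,\varphi\,dx+\int_\Omega\mu\,\xi(\|u\|)|u|^{2_s^*-2}u\,\varphi\,dx.$$ *)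

theory Defs
  imports "HOL-Probability.Essential_Supremum"
begin

text \<open>
  The Euclidean space \<open>'a\<close> plays the role of the $N$-dimensional real space, with
  $N = $ \<open>DIM('a)\<close>.  A function on \<open>\<Omega>\<close> is represented by its extension by zero to the whole
  space.
\<close>

definition bounded_domain :: "'a::euclidean_space set \<Rightarrow> bool" where
  "bounded_domain \<Omega> \<longleftrightarrow> open \<Omega> \<and> connected \<Omega> \<and> bounded \<Omega> \<and> \<Omega> \<noteq> {}"

definition fun_on :: "'a::euclidean_space set \<Rightarrow> ('a \<Rightarrow> real) set" where
  "fun_on \<Omega> = {u \<in> borel_measurable lebesgue. \<forall>x. x \<notin> \<Omega> \<longrightarrow> u x = 0}"

definition frac_crit_exp :: "nat \<Rightarrow> real \<Rightarrow> real" where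
  "frac_crit_exp N s = 2 * real N / (real N - 2 * s)"

text \<open>The local critical exponent is infinite in dimension two (and below).\<close>

definition crit_exp :: "nat \<Rightarrow> ereal" where
  "crit_exp N = (if N \<le> 2 then \<infinity> else ereal (2 * real N / (real N - 2)))"

definition enn_sqrt :: "ennreal \<Rightarrow> ennreal" where
  "enn_sqrt t = (if t = \<infinity> then \<infinity> else ennreal (sqrt (enn2real t)))"


subsection \<open>Test functions\<close>

fun Ck_fun :: "nat \<Rightarrow> ('a::euclidean_space \<Rightarrow> real) \<Rightarrow> bool" where
  "Ck_fun 0 f \<longleftrightarrow> continuous_on UNIV f"
| "Ck_fun (Suc k) f \<longleftrightarrow> (\<forall>x. f differentiable (at x)) \<and>
     (\<forall>i\<in>Basis. Ck_fun k (\<lambda>x. frechet_derivative f (at x) i))"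

definition test_fun :: "'a::euclidean_space set \<Rightarrow> ('a \<Rightarrow> real) set" where
  "test_fun \<Omega> = {f. (\<forall>k. Ck_fun k f) \<and> compact (closure {x. f x \<noteq> 0}) \<and>
                    closure {x. f x \<noteq> 0} \<subseteq> \<Omega>}"


subsection \<open>The seminorms\<close>

definition Q_set :: "'a set \<Rightarrow> ('a \<times> 'a) set" where
  "Q_set \<Omega> = UNIV - (UNIV - \<Omega>) \<times> (UNIV - \<Omega>)"

definition frac_seminorm :: "'a::euclidean_space set \<Rightarrow> real \<Rightarrow> ('a \<Rightarrow> real) \<Rightarrow> ennreal" where
  "frac_seminorm \<Omega> s u = enn_sqrt (\<integral>\<^sup>+z\<in>Q_set \<Omega>.
     ennreal (\<bar>u (fst z) - u (snd z)\<bar>\<^sup>2 / norm (fst z - snd z) powr (real DIM('a) + 2 * s)) \<partial>lebesgue)"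

definition has_weak_gradient ::
    "'a::euclidean_space set \<Rightarrow> ('a \<Rightarrow> real) \<Rightarrow> ('a \<Rightarrow> 'a) \<Rightarrow> bool" where
  "has_weak_gradient \<Omega> u G \<longleftrightarrow>
     (\<forall>K. compact K \<and> K \<subseteq> \<Omega> \<longrightarrow> set_integrable lebesgue K u \<and> set_integrable lebesgue K G) \<and>
     (\<forall>f\<in>test_fun \<Omega>. \<forall>i\<in>Basis.
        (LINT x:\<Omega>|lebesgue. u x * frechet_derivative f (at x) i) =
        - (LINT x:\<Omega>|lebesgue. (G x \<bullet> i) * f x))"

text \<open>
  A weak gradient is determined almost everywhere on \<open>\<Omega>\<close>, so the choice made here does not
  affect any of the integrals below.  It is meaningful only if a weak gradient exists.
\<close>

definition weak_grad :: "'a::euclidean_space set \<Rightarrow> ('a \<Rightarrow> real) \<Rightarrow> 'a \<Rightarrow> 'a" where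
  "weak_grad \<Omega> u = (SOME G. has_weak_gradient \<Omega> u G)"

definition grad_seminorm :: "'a::euclidean_space set \<Rightarrow> ('a \<Rightarrow> real) \<Rightarrow> ennreal" where
  "grad_seminorm \<Omega> u =
     (if \<exists>G. has_weak_gradient \<Omega> u G
      then enn_sqrt (\<integral>\<^sup>+x\<in>\<Omega>. ennreal ((norm (weak_grad \<Omega> u x))\<^sup>2) \<partial>lebesgue)
      else \<infinity>)"

definition L2_seminorm :: "'a::euclidean_space set \<Rightarrow> ('a \<Rightarrow> real) \<Rightarrow> ennreal" where
  "L2_seminorm \<Omega> u = enn_sqrt (\<integral>\<^sup>+x\<in>\<Omega>. ennreal (\<bar>u x\<bar>\<^sup>2) \<partial>lebesgue)"


subsection \<open>The function spaces\<close>

definition X_norm :: "'a::euclidean_space set \<Rightarrow> real \<Rightarrow> ('a \<Rightarrow> real) \<Rightarrow> ennreal" where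
  "X_norm \<Omega> s u = L2_seminorm \<Omega> u + frac_seminorm \<Omega> s u"

definition Y_norm :: "'a::euclidean_space set \<Rightarrow> ('a \<Rightarrow> real) \<Rightarrow> ennreal" where
  "Y_norm \<Omega> u = L2_seminorm \<Omega> u + grad_seminorm \<Omega> u"

definition test_closure ::
    "'a::euclidean_space set \<Rightarrow> (('a \<Rightarrow> real) \<Rightarrow> ennreal) \<Rightarrow> ('a \<Rightarrow> real) set" where
  "test_closure \<Omega> nrm = {u \<in> fun_on \<Omega>. nrm u < \<infinity> \<and>
     (\<exists>f :: nat \<Rightarrow> 'a \<Rightarrow> real. (\<forall>n. f n \<in> test_fun \<Omega>) \<and>
        (\<lambda>n. nrm (\<lambda>x. u x - f n x)) \<longlonglongrightarrow> 0)}"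

text \<open>
  The fractional and the ordinary first-order Sobolev space on \<open>\<Omega>\<close> carry the norms
  \<open>X_norm\<close> and \<open>Y_norm\<close>, and the closures are taken in these norms.
\<close>

definition X_space :: "'a::euclidean_space set \<Rightarrow> real \<Rightarrow> ('a \<Rightarrow> real) set" where
  "X_space \<Omega> s = test_closure \<Omega> (X_norm \<Omega> s)"

definition Y_space :: "'a::euclidean_space set \<Rightarrow> ('a \<Rightarrow> real) set" where
  "Y_space \<Omega> = test_closure \<Omega> (Y_norm \<Omega>)"

text \<open>
  In \<open>ennreal\<close> we have \<open>0 * \<infinity> = 0\<close>, so a term with vanishing coefficient imposes no condition.
\<close>

definition Z_energy ::
    "'a::euclidean_space set \<Rightarrow> real \<Rightarrow> real \<Rightarrow> real \<Rightarrow> ('a \<Rightarrow> real) \<Rightarrow> ennreal" where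
  "Z_energy \<Omega> s a b u =
     ennreal a * (frac_seminorm \<Omega> s u)\<^sup>2 + ennreal b * (grad_seminorm \<Omega> u)\<^sup>2"

definition Z_space :: "'a::euclidean_space set \<Rightarrow> real \<Rightarrow> real \<Rightarrow> real \<Rightarrow> ('a \<Rightarrow> real) set" where
  "Z_space \<Omega> s a b = {u \<in> fun_on \<Omega>.
     (a > 0 \<longrightarrow> u \<in> X_space \<Omega> s) \<and> (b > 0 \<longrightarrow> u \<in> Y_space \<Omega>) \<and> Z_energy \<Omega> s a b u < \<infinity>}"

definition Z_norm ::
    "'a::euclidean_space set \<Rightarrow> real \<Rightarrow> real \<Rightarrow> real \<Rightarrow> ('a \<Rightarrow> real) \<Rightarrow> real" where
  "Z_norm \<Omega> s a b u = sqrt (enn2real (Z_energy \<Omega> s a b u))"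


subsection \<open>The cut-off problem\<close>

text \<open>\<open>decreasing\<close> is understood in the wide sense (non-increasing).\<close>

definition cutoff :: "real \<Rightarrow> (real \<Rightarrow> real) \<Rightarrow> bool" where
  "cutoff l \<xi> \<longleftrightarrow> (\<forall>t. \<bar>t\<bar> \<le> l \<longrightarrow> \<xi> t = 1) \<and> antimono_on {l..2 * l} \<xi> \<and>
                (\<forall>t. \<bar>t\<bar> \<ge> 2 * l \<longrightarrow> \<xi> t = 0)"

text \<open>
  The left-hand integrals exist for all \<open>u\<close> and \<open>\<phi>\<close> in \<open>Z_space\<close> whenever their coefficient is
  positive (Cauchy-Schwarz).  Since \<open>lebesgue_integral\<close> is total, the existence of the right-hand
  integrals has to be required explicitly.  At the zeros of \<open>u\<close>, the singular integrand has the
  value \<open>0\<close> (as \<open>0 powr r = 0\<close>).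
\<close>

definition weak_solution ::
    "'a::euclidean_space set \<Rightarrow> real \<Rightarrow> real \<Rightarrow> real \<Rightarrow> real \<Rightarrow> real \<Rightarrow> real \<Rightarrow> (real \<Rightarrow> real) \<Rightarrow>
     ('a \<Rightarrow> real) \<Rightarrow> bool" where
  "weak_solution \<Omega> s a b lam \<mu> \<gamma> \<xi> u \<longleftrightarrow> u \<in> Z_space \<Omega> s a b \<and>
     (\<forall>\<phi>\<in>Z_space \<Omega> s a b.
        set_integrable lebesgue \<Omega> (\<lambda>x. lam * \<bar>u x\<bar> powr (- \<gamma> - 1) * u x * \<phi> x) \<and>
        set_integrable lebesgue \<Omega> (\<lambda>x. \<mu> * \<xi> (Z_norm \<Omega> s a b u) *
          \<bar>u x\<bar> powr (frac_crit_exp DIM('a) s - 2) * u x * \<phi> x) \<and>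
        a * (LINT z:Q_set \<Omega>|lebesgue.
               (u (fst z) - u (snd z)) * (\<phi> (fst z) - \<phi> (snd z)) /
               norm (fst z - snd z) powr (real DIM('a) + 2 * s))
        + b * (LINT x:\<Omega>|lebesgue. weak_grad \<Omega> u x \<bullet> weak_grad \<Omega> \<phi> x)
        = (LINT x:\<Omega>|lebesgue. lam * \<bar>u x\<bar> powr (- \<gamma> - 1) * u x * \<phi> x)
        + (LINT x:\<Omega>|lebesgue. \<mu> * \<xi> (Z_norm \<Omega> s a b u) *
             \<bar>u x\<bar> powr (frac_crit_exp DIM('a) s - 2) * u x * \<phi> x))"

text \<open>\<open>esssup\<close> is infinite for non-measurable functions, so membership includes measurability.\<close>

definition L_infty :: "'a::euclidean_space set \<Rightarrow> ('a \<Rightarrow> real) set" where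
  "L_infty \<Omega> = {u. esssup (lebesgue_on \<Omega>) (\<lambda>x. ereal \<bar>u x\<bar>) < \<infinity>}"

end

theory Submission
  imports Defs
begin

text \<open>
  The proof is a De Giorgi iteration at the exponent \<open>p = frac_crit_exp DIM('a) s\<close>, the critical Sobolev
  exponent of the fractional space.

  If \<open>a > 0\<close> or \<open>b > 0\<close>, then the energy controls the \<open>p\<close>-th power integral on the whole of \<open>Z_space\<close>
  (\<open>Z_space_sobolev\<close>).  For the fractional part this is the fractional Sobolev inequality, which is derived from
  a pointwise estimate (\<open>frac_sobolev_pointwise\<close>).  For the gradient part it follows from the
  fractional case, because \<open>gagliardo s f\<close> is bounded by the integral of the squared gradient
  for test functions on a bounded set (\<open>gagliardo_le_grad\<close>).

  The test function is a smooth version of the positive part of \<open>u - h\<close> or of \<open>- u - h\<close>, with a level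
  \<open>h \<ge> 1\<close>.  It is a smooth function \<open>g\<close> of \<open>u\<close> with \<open>g 0 = 0\<close> and slopes in \<open>[0, 1]\<close>.  Such a composition stays in
  \<open>Z_space\<close>: it maps test functions to test functions, and it is continuous for both norms
  (\<open>truncation_X_space\<close>, \<open>truncation_Y_space\<close>).  For the gradient part this rests on the uniqueness of the weak
  gradient (\<open>weak_gradient_unique\<close>) and on the chain rule.  Because of the slopes, the bilinear form at
  \<open>u\<close> and \<open>g u\<close> dominates the energy of \<open>g u\<close>.

  On the support of \<open>g u\<close> one has \<open>\<bar>u\<bar> \<ge> 1\<close>, so there the singular term is harmless, and the right-hand side of
  the equation is at most a constant times \<open>\<bar>u\<bar> powr (p - 1)\<close>.  Hence for \<open>w = u\<close> and for \<open>w = - u\<close>, and for all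
  levels \<open>1 \<le> h < k\<close>, the \<open>p\<close>-th power integral of the excess of \<open>w\<close> over \<open>k\<close> is at most the power \<open>p / 2 > 1\<close> of a
  multiple of the integral of \<open>w powr (p - 1) * (w - h)\<close> over the set where \<open>w > h\<close>.  The growth is critical, but
  the excess integral tends to \<open>0\<close> as the level grows, and from a sufficiently high level \<open>m\<close> on the
  superlinear recursion drives it to \<open>0\<close> at level \<open>2 * m\<close> (\<open>de_giorgi_bounded\<close>).

  If \<open>a = b = 0\<close>, the equation is algebraic, and it determines \<open>\<bar>u\<bar>\<close> wherever \<open>u\<close> is not \<open>0\<close>.
\<close>

section \<open>A smooth ramp\<close>

text \<open>
  The functions \<open>p (1 / t) * exp (- 1 / t)\<close> for \<open>t > 0\<close>, extended by \<open>0\<close>.  They vanish to infinite order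
  at \<open>0\<close>, and this family is closed under differentiation (\<open>bump_deriv\<close> is the map induced on the
  polynomials), which gives smoothness at once.
\<close>

definition poly_bump :: "real poly \<Rightarrow> real \<Rightarrow> real" where
  "poly_bump p t = (if t > 0 then poly p (1 / t) * exp (- (1 / t)) else 0)"

text \<open>
  With \<open>x = 1 / t\<close>, the derivative of \<open>p x * exp (- x)\<close> with respect to \<open>t\<close> is \<open>x^2 * (p x - p' x) * exp (- x)\<close>.
\<close>

definition bump_deriv :: "real poly \<Rightarrow> real poly" where
  "bump_deriv p = monom 1 2 * (p - pderiv p)"

lemma poly_bump_tendsto_0: "((\<lambda>x. poly p x * exp (- x)) \<longlongrightarrow> (0::real)) at_top"
proof -
  have "((\<lambda>x. \<Sum>i\<le>degree p. coeff p i * (x ^ i / exp x)) \<longlongrightarrow> (\<Sum>i\<le>degree p. coeff p i * 0)) at_top"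
    by (intro tendsto_intros tendsto_power_div_exp_0)
  then show ?thesis
    by (simp add: poly_altdef sum_distrib_right exp_minus divide_inverse mult.assoc)
qed

lemma DERIV_poly_bump:
  "(poly_bump p has_real_derivative poly_bump (bump_deriv p) t) (at t)"
proof -
  consider "t > 0" | "t < 0" | "t = 0" by linarith
  then show ?thesis
  proof cases
    case 1
    have "((\<lambda>t. poly p (1 / t) * exp (- (1 / t))) has_real_derivative poly_bump (bump_deriv p) t) (at t)"
      using 1 unfolding poly_bump_def bump_deriv_def
      by (auto intro!: derivative_eq_intros poly_DERIV[THEN DERIV_chain2]
          simp: poly_monom field_simps power2_eq_square)
    then show ?thesis
    proof (rule has_field_derivative_transform_within_open[where S="{0<..}"])
      show "\<And>x. x \<in> {0<..} \<Longrightarrow> poly p (1 / x) * exp (- (1 / x)) = poly_bump p x"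
        by (simp add: poly_bump_def)
    qed (use 1 in auto)
  next
    case 2
    have "((\<lambda>t. 0) has_real_derivative poly_bump (bump_deriv p) t) (at t)"
      using 2 by (simp add: poly_bump_def)
    then show ?thesis
      by (rule has_field_derivative_transform_within_open[where S="{..<0}"])
        (use 2 in \<open>auto simp: poly_bump_def\<close>)
  next
    case 3
    have R: "((\<lambda>h. poly_bump p h / h) \<longlongrightarrow> 0) (at_right 0)"
    proof -
      have "((\<lambda>x. poly (pCons 0 p) x * exp (- x)) \<longlongrightarrow> (0::real)) at_top"
        by (rule poly_bump_tendsto_0)
      then have "((\<lambda>h. poly (pCons 0 p) (inverse h) * exp (- inverse h)) \<longlongrightarrow> (0::real)) (at_right 0)"
        by (rule filterlim_compose[OF _ filterlim_inverse_at_top_right])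
      then show ?thesis
        by (rule Lim_transform_eventually)
          (auto simp: eventually_at_filter poly_bump_def divide_inverse)
    qed
    have L: "((\<lambda>h. poly_bump p h / h) \<longlongrightarrow> 0) (at_left 0)"
      by (rule tendsto_eventually) (auto simp: eventually_at_filter poly_bump_def)
    have "((\<lambda>h. poly_bump p h / h) \<longlongrightarrow> 0) (at 0)"
      using L R by (simp add: filterlim_split_at)
    then show ?thesis using 3 by (simp add: DERIV_def poly_bump_def)
  qed
qed

text \<open>
  Infinite differentiability on the real line, by way of the sequence \<open>D\<close> of all derivatives.
\<close>

definition smooth :: "(real \<Rightarrow> real) \<Rightarrow> bool" where
  "smooth g \<longleftrightarrow> (\<exists>D. D 0 = g \<and> (\<forall>n t. (D n has_real_derivative D (Suc n) t) (at t)))"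

lemma smooth_poly_bump: "smooth (poly_bump p)"
  unfolding smooth_def
proof (intro exI conjI allI)
  show "(\<lambda>n. poly_bump ((bump_deriv ^^ n) p)) 0 = poly_bump p" by simp
qed (simp add: DERIV_poly_bump)

lemma smooth_affine_comp:
  assumes "smooth g"
  shows "smooth (\<lambda>t. g (c * t + d))"
proof -
  obtain D where D: "D 0 = g" "\<And>n t. (D n has_real_derivative D (Suc n) t) (at t)"
    using assms unfolding smooth_def by auto
  have "((\<lambda>t. c ^ n * D n (c * t + d)) has_real_derivative c ^ Suc n * D (Suc n) (c * t + d)) (at t)" for n t
    by (auto intro!: derivative_eq_intros D(2)[THEN DERIV_chain2])
  then show ?thesis
    unfolding smooth_def using D(1)
    by (intro exI[of _ "\<lambda>n t. c ^ n * D n (c * t + d)"]) auto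
qed

lemma smooth_cmult:
  assumes "smooth g"
  shows "smooth (\<lambda>t. c * g t)"
proof -
  obtain D where D: "D 0 = g" "\<And>n t. (D n has_real_derivative D (Suc n) t) (at t)"
    using assms unfolding smooth_def by auto
  have "((\<lambda>t. c * D n t) has_real_derivative c * D (Suc n) t) (at t)" for n t
    by (intro DERIV_cmult D(2))
  then show ?thesis
    unfolding smooth_def using D(1)
    by (intro exI[of _ "\<lambda>n t. c * D n t"]) auto
qed

lemma smooth_mult_id:
  assumes "smooth g"
  shows "smooth (\<lambda>t. t * g t)"
proof -
  obtain D where D: "D 0 = g" "\<And>n t. (D n has_real_derivative D (Suc n) t) (at t)"
    using assms unfolding smooth_def by auto
  have "((\<lambda>t. t * D n t + real n * D (n - 1) t) has_real_derivative
        (t * D (Suc n) t + real (Suc n) * D (Suc n - 1) t)) (at t)" for n t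
  proof (cases n)
    case 0
    then show ?thesis by (auto intro!: derivative_eq_intros D(2))
  next
    case (Suc m)
    then show ?thesis
      using D(2)[of m t] D(2)[of "Suc m" t]
      by (auto intro!: derivative_eq_intros simp: algebra_simps)
  qed
  then show ?thesis
    unfolding smooth_def using D(1)
    by (intro exI[of _ "\<lambda>n t. t * D n t + real n * D (n - 1) t"]) auto
qed

text \<open>
  The smooth ramp \<open>t * exp (- 1 / t)\<close> (\<open>0\<close> for \<open>t \<le> 0\<close>).  It lies between \<open>t - 1\<close> and the positive part
  of \<open>t\<close>, and its slope lies in \<open>[0, 1]\<close>, because \<open>1 + x \<le> exp x\<close>.
\<close>

definition smooth_ramp :: "real \<Rightarrow> real" where
  "smooth_ramp t = t * poly_bump 1 t"

definition smooth_ramp_deriv :: "real \<Rightarrow> real" where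
  "smooth_ramp_deriv t = poly_bump 1 t + t * poly_bump (bump_deriv 1) t"

lemma smooth_smooth_ramp: "smooth smooth_ramp"
  unfolding smooth_ramp_def[abs_def] by (intro smooth_mult_id smooth_poly_bump)

lemma DERIV_smooth_ramp: "(smooth_ramp has_real_derivative smooth_ramp_deriv t) (at t)"
  unfolding smooth_ramp_def[abs_def] smooth_ramp_deriv_def
  by (auto intro!: derivative_eq_intros DERIV_poly_bump)

lemma smooth_ramp_deriv_bounds: "0 \<le> smooth_ramp_deriv t" "smooth_ramp_deriv t \<le> 1"
proof -
  have eq: "smooth_ramp_deriv t = (if t > 0 then (1 + 1 / t) * exp (- (1 / t)) else 0)"
    by (auto simp: smooth_ramp_deriv_def poly_bump_def bump_deriv_def poly_monom power2_eq_square algebra_simps)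
  show "0 \<le> smooth_ramp_deriv t" unfolding eq by auto
  have "(1 + x) * exp (- x) \<le> 1" for x :: real
    using exp_ge_add_one_self[of x] by (simp add: exp_minus field_simps)
  then show "smooth_ramp_deriv t \<le> 1" unfolding eq by auto
qed

lemma smooth_ramp_bounds:
  "t - 1 \<le> smooth_ramp t" "smooth_ramp t \<le> max 0 t" "0 \<le> smooth_ramp t"
  "t \<le> 0 \<Longrightarrow> smooth_ramp t = 0"
proof -
  have *: "exp (- x) \<ge> 1 - x" for x :: real
    using exp_ge_add_one_self[of "- x"] by simp
  show "t - 1 \<le> smooth_ramp t"
  proof (cases "t > 0")
    case True
    then have "t * (1 - 1 / t) \<le> t * exp (- (1 / t))"
      by (intro mult_left_mono *) auto
    then show ?thesis using True by (simp add: smooth_ramp_def poly_bump_def algebra_simps)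
  qed (simp add: smooth_ramp_def poly_bump_def)
qed (auto simp: smooth_ramp_def poly_bump_def mult_le_cancel_left1 max_def)

section \<open>Smooth functions of several variables\<close>

lemma Ck_fun_Suc_imp:
  "Ck_fun (Suc k) f \<Longrightarrow> Ck_fun k f"
proof (induction k arbitrary: f)
  case 0
  then show ?case
    using differentiable_imp_continuous_within[of f _ UNIV]
    by (simp add: continuous_on_eq_continuous_within)
next
  case (Suc k)
  have d: "\<forall>x. f differentiable (at x)"
    and "\<forall>i\<in>Basis. Ck_fun (Suc k) (\<lambda>x. frechet_derivative f (at x) i)"
    using Suc.prems unfolding Ck_fun.simps(2)[of "Suc k"] by blast+
  then have "\<forall>i\<in>Basis. Ck_fun k (\<lambda>x. frechet_derivative f (at x) i)"
    using Suc.IH by blast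
  then show ?case using d unfolding Ck_fun.simps(2)[of k] by blast
qed

lemma frechet_derivative_eqI:
  "(f has_derivative f') (at x) \<Longrightarrow> frechet_derivative f (at x) = f'"
  by (rule frechet_derivative_at[symmetric])

lemma Ck_fun_const: "Ck_fun k (\<lambda>x. c)"
  by (induction k arbitrary: c) (auto simp: frechet_derivative_const)

lemma Ck_fun_add: "Ck_fun k f \<Longrightarrow> Ck_fun k g \<Longrightarrow> Ck_fun k (\<lambda>x. f x + g x)"
proof (induction k arbitrary: f g)
  case 0
  then show ?case by (auto intro!: continuous_intros)
next
  case (Suc k)
  have "frechet_derivative (\<lambda>x. f x + g x) (at x) =
      (\<lambda>h. frechet_derivative f (at x) h + frechet_derivative g (at x) h)" for x
    using Suc.prems by (intro frechet_derivative_eqI has_derivative_add)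
      (auto simp: frechet_derivative_works[symmetric])
  then show ?case using Suc by (simp add: differentiable_add)
qed

lemma Ck_fun_mult: "Ck_fun k f \<Longrightarrow> Ck_fun k g \<Longrightarrow> Ck_fun k (\<lambda>x. f x * g x)"
proof (induction k arbitrary: f g)
  case 0
  then show ?case by (auto intro!: continuous_intros)
next
  case (Suc k)
  have "frechet_derivative (\<lambda>x. f x * g x) (at x) =
      (\<lambda>h. f x * frechet_derivative g (at x) h + frechet_derivative f (at x) h * g x)" for x
    using Suc.prems by (intro frechet_derivative_eqI has_derivative_mult)
      (auto simp: frechet_derivative_works[symmetric])
  then show ?case using Suc Ck_fun_Suc_imp[OF Suc.prems(1)] Ck_fun_Suc_imp[OF Suc.prems(2)]
    by (simp add: differentiable_mult Ck_fun_add)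
qed

lemma Ck_fun_prod:
  assumes "finite I" "\<And>i. i \<in> I \<Longrightarrow> Ck_fun k (f i)"
  shows "Ck_fun k (\<lambda>x. \<Prod>i\<in>I. f i x)"
  using assms by (induction I rule: finite_induct) (simp_all add: Ck_fun_const Ck_fun_mult)

lemma Ck_fun_smooth_comp:
  assumes "smooth g" "Ck_fun k f"
  shows "Ck_fun k (\<lambda>x. g (f x))"
proof -
  obtain D where D: "D 0 = g" "\<And>n t. (D n has_real_derivative D (Suc n) t) (at t)"
    using assms(1) unfolding smooth_def by auto
  have "Ck_fun k (\<lambda>x. D n (f x))" for n
    using assms(2)
  proof (induction k arbitrary: n)
    case 0
    have "continuous_on UNIV (D n)"
      using D(2) by (auto simp: continuous_on_eq_continuous_at intro!: DERIV_isCont)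
    then show ?case using 0 continuous_on_compose2[of UNIV "D n" UNIV f] by simp
  next
    case (Suc k)
    have der: "((\<lambda>x. D n (f x)) has_derivative
        (\<lambda>h. D (Suc n) (f x) * frechet_derivative f (at x) h)) (at x)" for x
    proof -
      have f': "(f has_derivative frechet_derivative f (at x)) (at x)"
        using Suc.prems frechet_derivative_works by auto
      show ?thesis
        using has_derivative_compose[OF f' D(2)[of n "f x", unfolded has_field_derivative_def]] by simp
    qed
    have eq: "frechet_derivative (\<lambda>x. D n (f x)) (at x) = (\<lambda>h. D (Suc n) (f x) * frechet_derivative f (at x) h)" for x
      by (rule frechet_derivative_eqI[OF der])
    have "\<forall>x. (\<lambda>x. D n (f x)) differentiable (at x)"
      by (intro allI differentiableI[OF der])
    then show ?case
      using Suc.IH[OF Ck_fun_Suc_imp[OF Suc.prems], of "Suc n"] Suc.prems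
      by (simp add: eq Ck_fun_mult)
  qed
  from this[of 0] show ?thesis using D(1) by simp
qed

lemma Ck_fun_inner: "Ck_fun k (\<lambda>x. x \<bullet> (i::'a::euclidean_space))"
proof (cases k)
  case 0
  then show ?thesis by (auto intro!: continuous_intros)
next
  case (Suc m)
  have der: "((\<lambda>x. x \<bullet> i) has_derivative (\<lambda>h. h \<bullet> i)) (at x)" for x :: 'a
    by (auto intro!: derivative_eq_intros)
  show ?thesis unfolding Suc
    by (simp add: frechet_derivative_eqI[OF der] Ck_fun_const differentiableI[OF der])
qed

lemma test_funI:
  assumes "\<And>k. Ck_fun k f" "compact K" "K \<subseteq> \<Omega>" "\<And>x. x \<notin> K \<Longrightarrow> f x = 0"
  shows "f \<in> test_fun \<Omega>"
proof -
  have "closure {x. f x \<noteq> 0} \<subseteq> K"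
    using assms by (intro closure_minimal compact_imp_closed) auto
  moreover have "compact (closure {x. f x \<noteq> 0})"
    using calculation assms(2) by (meson bounded_subset closed_closure compact_eq_bounded_closed)
  ultimately show ?thesis using assms unfolding test_fun_def by auto
qed

lemma test_fun_support:
  assumes "f \<in> test_fun \<Omega>"
  shows "\<exists>K. compact K \<and> K \<subseteq> \<Omega> \<and> (\<forall>x. x \<notin> K \<longrightarrow> f x = 0)"
proof (intro exI conjI)
  show "compact (closure {x. f x \<noteq> 0})" "closure {x. f x \<noteq> 0} \<subseteq> \<Omega>"
    using assms by (auto simp: test_fun_def)
  show "\<forall>x. x \<notin> closure {x. f x \<noteq> 0} \<longrightarrow> f x = 0"
    using closure_subset[of "{x. f x \<noteq> 0}"] by auto
qed

lemma test_fun_Ck: "f \<in> test_fun \<Omega> \<Longrightarrow> Ck_fun k f"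
  by (simp add: test_fun_def)

lemma test_fun_smooth_comp:
  assumes f: "f \<in> test_fun \<Omega>" and g: "smooth g" "g 0 = 0"
  shows "(\<lambda>x. g (f x)) \<in> test_fun \<Omega>"
proof -
  obtain K where K: "compact K" "K \<subseteq> \<Omega>" "\<forall>x. x \<notin> K \<longrightarrow> f x = 0"
    using test_fun_support[OF f] by blast
  show ?thesis
  proof (rule test_funI[OF _ K(1,2)])
    show "Ck_fun k (\<lambda>x. g (f x))" for k
      by (rule Ck_fun_smooth_comp[OF g(1) test_fun_Ck[OF f]])
    show "g (f x) = 0" if "x \<notin> K" for x
      using K(3) g(2) that by simp
  qed
qed

lemma test_fun_mult:
  assumes f: "f \<in> test_fun \<Omega>" and g: "g \<in> test_fun \<Omega>"
  shows "(\<lambda>x. f x * g x) \<in> test_fun \<Omega>"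
proof -
  obtain K where K: "compact K" "K \<subseteq> \<Omega>" "\<forall>x. x \<notin> K \<longrightarrow> f x = 0"
    using test_fun_support[OF f] by blast
  show ?thesis
  proof (rule test_funI[OF _ K(1,2)])
    show "Ck_fun k (\<lambda>x. f x * g x)" for k
      by (rule Ck_fun_mult[OF test_fun_Ck[OF f] test_fun_Ck[OF g]])
    show "f x * g x = 0" if "x \<notin> K" for x
      using K(3) that by simp
  qed
qed

section \<open>Convergence lemmas for nonnegative integrals\<close>

lemma ennreal_tendsto_0_le:
  fixes f g :: "nat \<Rightarrow> ennreal"
  assumes "g \<longlonglongrightarrow> 0" "\<And>n. f n \<le> g n"
  shows "f \<longlonglongrightarrow> 0"
  by (rule tendsto_sandwich[OF always_eventually always_eventually tendsto_const assms(1)])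
    (use assms(2) in auto)

lemma power2_add_le: "(x + y)\<^sup>2 \<le> 2 * x\<^sup>2 + 2 * (y::real)\<^sup>2"
  using sum_squares_bound[of x y] by (simp add: power2_sum)

text \<open>
  Dominated convergence to \<open>0\<close> where the majorant is only fixed up to a part that tends to \<open>0\<close> in \<open>L1\<close>.
  The reason is \<open>F n \<le> e n + min (F n) g\<close>.
\<close>

lemma nn_integral_tendsto_zero_dominated:
  fixes F e :: "nat \<Rightarrow> 'b \<Rightarrow> ennreal"
  assumes [measurable]: "\<And>n. F n \<in> borel_measurable M" "\<And>n. e n \<in> borel_measurable M" "g \<in> borel_measurable M"
    and lim: "AE x in M. (\<lambda>n. F n x) \<longlonglongrightarrow> 0"
    and le: "\<And>n x. F n x \<le> e n x + g x"
    and e0: "(\<lambda>n. \<integral>\<^sup>+x. e n x \<partial>M) \<longlonglongrightarrow> 0"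
    and g: "(\<integral>\<^sup>+x. g x \<partial>M) < \<infinity>"
  shows "(\<lambda>n. \<integral>\<^sup>+x. F n x \<partial>M) \<longlonglongrightarrow> 0"
proof (rule ennreal_tendsto_0_le)
  have "(\<lambda>n. \<integral>\<^sup>+x. min (F n x) (g x) \<partial>M) \<longlonglongrightarrow> (\<integral>\<^sup>+x. 0 \<partial>M)"
  proof (rule nn_integral_dominated_convergence[where w=g])
    show "AE x in M. (\<lambda>n. min (F n x) (g x)) \<longlonglongrightarrow> 0"
      using lim
    proof eventually_elim
      case (elim x)
      have "(\<lambda>n. min (F n x) (g x)) \<longlonglongrightarrow> min 0 (g x)"
        by (intro tendsto_min elim tendsto_const)
      then show ?case by simp
    qed
  qed (use g in auto)
  from tendsto_add[OF e0 this]
  show "(\<lambda>n. (\<integral>\<^sup>+x. e n x \<partial>M) + (\<integral>\<^sup>+x. min (F n x) (g x) \<partial>M)) \<longlonglongrightarrow> 0"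
    by simp
  show "(\<integral>\<^sup>+x. F n x \<partial>M) \<le> (\<integral>\<^sup>+x. e n x \<partial>M) + (\<integral>\<^sup>+x. min (F n x) (g x) \<partial>M)" for n
  proof -
    have "F n x \<le> e n x + min (F n x) (g x)" for x
    proof (cases "F n x \<le> g x")
      case True
      then show ?thesis by (simp add: min_def add_increasing)
    next
      case False
      then show ?thesis using le[of n x] by (simp add: min_def)
    qed
    then have "(\<integral>\<^sup>+x. F n x \<partial>M) \<le> (\<integral>\<^sup>+x. e n x + min (F n x) (g x) \<partial>M)"
      by (intro nn_integral_mono)
    also have "\<dots> = (\<integral>\<^sup>+x. e n x \<partial>M) + (\<integral>\<^sup>+x. min (F n x) (g x) \<partial>M)"
      by (intro nn_integral_add) simp_all
    finally show ?thesis .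
  qed
qed

text \<open>
  Fatou's lemma in the form that passes bounds of integrals to an almost everywhere limit.
\<close>

lemma nn_integral_le_limit:
  fixes f :: "nat \<Rightarrow> 'b \<Rightarrow> ennreal"
  assumes [measurable]: "\<And>n. f n \<in> borel_measurable M"
    and lim: "AE x in M. (\<lambda>n. f n x) \<longlonglongrightarrow> g x"
    and le: "\<And>n. (\<integral>\<^sup>+x. f n x \<partial>M) \<le> B n" and B: "B \<longlonglongrightarrow> b"
  shows "(\<integral>\<^sup>+x. g x \<partial>M) \<le> b"
proof -
  have "(\<integral>\<^sup>+x. g x \<partial>M) = (\<integral>\<^sup>+x. liminf (\<lambda>n. f n x) \<partial>M)"
    by (intro nn_integral_cong_AE) (use lim in \<open>auto elim!: eventually_mono simp: lim_imp_Liminf\<close>)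
  also have "\<dots> \<le> liminf (\<lambda>n. \<integral>\<^sup>+x. f n x \<partial>M)"
    by (intro nn_integral_liminf) simp
  also have "\<dots> \<le> liminf B"
    by (intro Liminf_mono always_eventually allI le)
  also have "\<dots> = b" using B by (simp add: lim_imp_Liminf)
  finally show ?thesis .
qed

lemma AE_subseq_of_L2_tendsto_0:
  fixes f :: "nat \<Rightarrow> 'b \<Rightarrow> real"
  assumes [measurable]: "\<And>n. f n \<in> borel_measurable M"
    and fin: "\<And>n. (\<integral>\<^sup>+x. ennreal ((f n x)\<^sup>2) \<partial>M) < \<infinity>"
    and lim: "(\<lambda>n. \<integral>\<^sup>+x. ennreal ((f n x)\<^sup>2) \<partial>M) \<longlonglongrightarrow> 0"
  shows "\<exists>r. strict_mono r \<and> (AE x in M. (\<lambda>n. f (r n) x) \<longlonglongrightarrow> 0)"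
proof -
  have int: "integrable M (\<lambda>x. (f n x)\<^sup>2)" for n
    using fin[of n] by (intro integrableI_bounded) (simp_all add: power2_eq_square)
  have "(\<lambda>n. ennreal (\<integral>x. norm ((f n x)\<^sup>2) \<partial>M)) \<longlonglongrightarrow> ennreal 0"
    using lim by (simp add: nn_integral_eq_integral[OF int])
  then have "(\<lambda>n. (\<integral>x. norm ((f n x)\<^sup>2) \<partial>M)) \<longlonglongrightarrow> 0"
    by (subst (asm) tendsto_ennreal_iff) auto
  from tendsto_L1_AE_subseq[OF int this] obtain r where r: "strict_mono r"
    "AE x in M. (\<lambda>n. (f (r n) x)\<^sup>2) \<longlonglongrightarrow> 0" by blast
  from r(2) have "AE x in M. (\<lambda>n. f (r n) x) \<longlonglongrightarrow> 0"
  proof eventually_elim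
    case (elim x)
    from tendsto_real_sqrt[OF elim] have "(\<lambda>n. \<bar>f (r n) x\<bar>) \<longlonglongrightarrow> 0" by simp
    then show ?case by (simp add: tendsto_rabs_zero_iff)
  qed
  with r(1) show ?thesis by blast
qed

lemma tendsto_ennreal_0_real:
  fixes f :: "nat \<Rightarrow> ennreal"
  assumes "f \<longlonglongrightarrow> 0" shows "(\<lambda>n. enn2real (f n)) \<longlonglongrightarrow> 0"
  using tendsto_enn2real[of f 0 sequentially] assms by simp

lemma L2_tendsto_integral_mult:
  fixes h :: "nat \<Rightarrow> 'b \<Rightarrow> real"
  assumes [measurable]: "\<And>n. h n \<in> borel_measurable M" "g \<in> borel_measurable M" "z \<in> borel_measurable M"
    and lim: "(\<lambda>n. \<integral>\<^sup>+x. ennreal ((h n x - g x)\<^sup>2) \<partial>M) \<longlonglongrightarrow> 0"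
    and z: "(\<integral>\<^sup>+x. ennreal ((z x)\<^sup>2) \<partial>M) < \<infinity>"
    and int: "\<And>n. integrable M (\<lambda>x. h n x * z x)" "integrable M (\<lambda>x. g x * z x)"
  shows "(\<lambda>n. \<integral>x. h n x * z x \<partial>M) \<longlonglongrightarrow> (\<integral>x. g x * z x \<partial>M)"
proof -
  have "(\<lambda>n. (\<integral>\<^sup>+x. ennreal ((h n x - g x)\<^sup>2) \<partial>M) * (\<integral>\<^sup>+x. ennreal ((z x)\<^sup>2) \<partial>M)) \<longlonglongrightarrow> 0 * (\<integral>\<^sup>+x. ennreal ((z x)\<^sup>2) \<partial>M)"
    using z by (intro tendsto_mult_ennreal lim tendsto_const) auto
  then have L: "(\<lambda>n. (\<integral>\<^sup>+x. ennreal ((h n x - g x)\<^sup>2) \<partial>M) * (\<integral>\<^sup>+x. ennreal ((z x)\<^sup>2) \<partial>M)) \<longlonglongrightarrow> 0" by simp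
  have bound: "ennreal (((\<integral>x. h n x * z x \<partial>M) - (\<integral>x. g x * z x \<partial>M))\<^sup>2)
      \<le> (\<integral>\<^sup>+x. ennreal ((h n x - g x)\<^sup>2) \<partial>M) * (\<integral>\<^sup>+x. ennreal ((z x)\<^sup>2) \<partial>M)" for n
  proof -
    have "ennreal (norm (\<integral>x. h n x * z x - g x * z x \<partial>M)) \<le> (\<integral>\<^sup>+x. norm (h n x * z x - g x * z x) \<partial>M)"
      by (intro integral_norm_bound_ennreal) (use int in auto)
    also have "\<dots> = (\<integral>\<^sup>+x. ennreal \<bar>h n x - g x\<bar> * ennreal \<bar>z x\<bar> \<partial>M)"
      by (intro nn_integral_cong) (simp add: ennreal_mult[symmetric] abs_mult[symmetric] algebra_simps)
    finally have 1: "ennreal \<bar>(\<integral>x. h n x * z x \<partial>M) - (\<integral>x. g x * z x \<partial>M)\<bar> \<le> \<dots>"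
      using int by simp
    have "ennreal (((\<integral>x. h n x * z x \<partial>M) - (\<integral>x. g x * z x \<partial>M))\<^sup>2) =
        (ennreal \<bar>(\<integral>x. h n x * z x \<partial>M) - (\<integral>x. g x * z x \<partial>M)\<bar>)\<^sup>2"
      by (simp add: ennreal_power)
    also have "\<dots> \<le> (\<integral>\<^sup>+x. ennreal \<bar>h n x - g x\<bar> * ennreal \<bar>z x\<bar> \<partial>M)\<^sup>2"
      by (rule power_mono[OF 1]) simp
    also have "\<dots> \<le> (\<integral>\<^sup>+x. (ennreal \<bar>h n x - g x\<bar>)\<^sup>2 \<partial>M) * (\<integral>\<^sup>+x. (ennreal \<bar>z x\<bar>)\<^sup>2 \<partial>M)"
      by (rule Cauchy_Schwarz_nn_integral) simp_all
    finally show ?thesis by (simp add: ennreal_power)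
  qed
  have "(\<lambda>n. ennreal (((\<integral>x. h n x * z x \<partial>M) - (\<integral>x. g x * z x \<partial>M))\<^sup>2)) \<longlonglongrightarrow> ennreal 0"
    using ennreal_tendsto_0_le[OF L bound] by simp
  then have "(\<lambda>n. ((\<integral>x. h n x * z x \<partial>M) - (\<integral>x. g x * z x \<partial>M))\<^sup>2) \<longlonglongrightarrow> 0"
    by (subst (asm) tendsto_ennreal_iff) auto
  from tendsto_real_sqrt[OF this]
  have "(\<lambda>n. (\<integral>x. h n x * z x \<partial>M) - (\<integral>x. g x * z x \<partial>M)) \<longlonglongrightarrow> 0"
    by (simp add: tendsto_rabs_zero_iff)
  then show ?thesis by (simp add: LIM_zero_iff)
qed

lemma enn_sqrt_power2: "(enn_sqrt t)\<^sup>2 = t"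
  by (cases t) (auto simp: enn_sqrt_def power2_eq_square ennreal_mult[symmetric])

lemma enn_sqrt_less_top_iff: "enn_sqrt t < \<infinity> \<longleftrightarrow> t < \<infinity>"
  by (cases t) (auto simp: enn_sqrt_def)

lemma enn_sqrt_tendsto_0_iff: "(\<lambda>n. enn_sqrt (t n)) \<longlonglongrightarrow> 0 \<longleftrightarrow> (t \<longlonglongrightarrow> 0)"
proof
  assume "(\<lambda>n. enn_sqrt (t n)) \<longlonglongrightarrow> 0"
  then have "(\<lambda>n. enn_sqrt (t n) * enn_sqrt (t n)) \<longlonglongrightarrow> 0 * 0"
    by (intro tendsto_mult_ennreal) auto
  then show "t \<longlonglongrightarrow> 0" by (simp add: power2_eq_square[symmetric] enn_sqrt_power2)
next
  assume t: "t \<longlonglongrightarrow> 0"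
  have "(\<lambda>n. ennreal (sqrt (enn2real (t n)))) \<longlonglongrightarrow> ennreal (sqrt 0)"
    by (intro tendsto_ennrealI tendsto_real_sqrt tendsto_ennreal_0_real t)
  moreover have "eventually (\<lambda>n. ennreal (sqrt (enn2real (t n))) = enn_sqrt (t n)) sequentially"
    using order_tendstoD(2)[OF t, of 1]
    by (auto elim!: eventually_mono simp: enn_sqrt_def)
  ultimately show "(\<lambda>n. enn_sqrt (t n)) \<longlonglongrightarrow> 0"
    using Lim_transform_eventually by fastforce
qed

lemma ennreal_add_tendsto_0_iff:
  fixes f g :: "nat \<Rightarrow> ennreal"
  shows "(\<lambda>n. f n + g n) \<longlonglongrightarrow> 0 \<longleftrightarrow> (f \<longlonglongrightarrow> 0) \<and> (g \<longlonglongrightarrow> 0)"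
proof (intro iffI conjI)
  assume *: "(\<lambda>n. f n + g n) \<longlonglongrightarrow> 0"
  show "f \<longlonglongrightarrow> 0"
    by (rule ennreal_tendsto_0_le[OF *]) (simp add: add_increasing2)
  show "g \<longlonglongrightarrow> 0"
    by (rule ennreal_tendsto_0_le[OF *]) (simp add: add_increasing)
next
  assume "(f \<longlonglongrightarrow> 0) \<and> (g \<longlonglongrightarrow> 0)"
  then show "(\<lambda>n. f n + g n) \<longlonglongrightarrow> 0" using tendsto_add[of f 0 sequentially g 0] by simp
qed

section \<open>Lebesgue measurability on the product space\<close>

lemma null_sets_vimage_fst:
  assumes "A \<in> null_sets (lborel :: 'a::euclidean_space measure)"
  shows "(fst -` A :: ('a \<times> 'b::euclidean_space) set) \<in> null_sets lborel"
proof -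
  have "A \<times> (UNIV :: 'b set) \<in> null_sets (lborel \<Otimes>\<^sub>M lborel)"
    using assms by (intro lborel.times_in_null_sets1) auto
  moreover have "A \<times> (UNIV :: 'b set) = fst -` A" by auto
  ultimately show ?thesis by (simp add: lborel_prod)
qed

lemma null_sets_vimage_snd:
  assumes "A \<in> null_sets (lborel :: 'b::euclidean_space measure)"
  shows "(snd -` A :: ('a::euclidean_space \<times> 'b) set) \<in> null_sets lborel"
proof -
  have "(UNIV :: 'a set) \<times> A \<in> null_sets (lborel \<Otimes>\<^sub>M lborel)"
    using assms by (intro lborel.times_in_null_sets2) auto
  moreover have "(UNIV :: 'a set) \<times> A = snd -` A" by auto
  ultimately show ?thesis by (simp add: lborel_prod)
qed

lemma measurable_fst_lebesgue [measurable]: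
  "fst \<in> (lebesgue :: ('a::euclidean_space \<times> 'b::euclidean_space) measure) \<rightarrow>\<^sub>M (lebesgue :: 'a measure)"
proof (rule completion.measurable_completion2)
  have *: "fst \<in> (lborel :: ('a \<times> 'b) measure) \<rightarrow>\<^sub>M (lborel :: 'a measure)"
    by (simp add: borel_prod[symmetric])
  show m: "fst \<in> (lebesgue :: ('a \<times> 'b) measure) \<rightarrow>\<^sub>M (lborel :: 'a measure)"
    by (rule measurable_completion[OF *])
  show "null_sets (lborel :: 'a measure) \<subseteq> null_sets (distr (lebesgue :: ('a \<times> 'b) measure) lborel fst)"
    by (auto simp: null_sets_distr_iff[OF m] null_sets_completionI null_sets_vimage_fst dest: null_setsD2[of _ lborel, unfolded sets_lborel])
qed

lemma measurable_snd_lebesgue [measurable]: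
  "snd \<in> (lebesgue :: ('a::euclidean_space \<times> 'b::euclidean_space) measure) \<rightarrow>\<^sub>M (lebesgue :: 'b measure)"
proof (rule completion.measurable_completion2)
  have *: "snd \<in> (lborel :: ('a \<times> 'b) measure) \<rightarrow>\<^sub>M (lborel :: 'b measure)"
    by (simp add: borel_prod[symmetric])
  show m: "snd \<in> (lebesgue :: ('a \<times> 'b) measure) \<rightarrow>\<^sub>M (lborel :: 'b measure)"
    by (rule measurable_completion[OF *])
  show "null_sets (lborel :: 'b measure) \<subseteq> null_sets (distr (lebesgue :: ('a \<times> 'b) measure) lborel snd)"
    by (auto simp: null_sets_distr_iff[OF m] null_sets_completionI null_sets_vimage_snd dest: null_setsD2[of _ lborel, unfolded sets_lborel])
qed

text \<open>
  The two marginals of a null set are null: a property that holds almost everywhere holds at both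
  components of almost every pair.  So the double integrals below do not depend on the representative.
\<close>

lemma AE_lebesgue_prod:
  assumes "AE x in (lebesgue :: 'a::euclidean_space measure). P x"
  shows "AE z in (lebesgue :: ('a \<times> 'a) measure). P (fst z) \<and> P (snd z)"
proof -
  have "AE x in (lborel :: 'a measure). P x"
    using assms by (simp add: AE_completion_iff)
  then obtain A where A: "A \<in> null_sets lborel" "{x. \<not> P x} \<subseteq> A"
    by (auto elim!: AE_E simp: null_sets_def)
  have "fst -` A \<union> snd -` A \<in> null_sets (lborel :: ('a \<times> 'a) measure)"
    by (intro null_sets.Un null_sets_vimage_fst null_sets_vimage_snd A(1))
  then have "AE z in (lborel :: ('a \<times> 'a) measure). P (fst z) \<and> P (snd z)"
    by (rule AE_I') (use A(2) in auto)
  then show ?thesis by (simp add: AE_completion_iff)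
qed

section \<open>The fractional space\<close>

text \<open>
  Squares of the seminorms, on the whole space: \<open>sq_integral\<close> is the squared \<open>L2\<close> norm and \<open>gagliardo\<close> is the
  squared fractional seminorm.  For functions that vanish outside \<open>\<Omega>\<close> the integrals over \<open>\<Omega>\<close> and over
  \<open>Q_set \<Omega>\<close> agree with those over the whole space.
\<close>

definition sq_integral :: "('a::euclidean_space \<Rightarrow> real) \<Rightarrow> ennreal" where
  "sq_integral v = (\<integral>\<^sup>+x. ennreal ((v x)\<^sup>2) \<partial>lebesgue)"

text \<open>
  The kernel of the fractional seminorm, as a function of the difference of the two points.  Its value at
  \<open>0\<close> is \<open>0\<close>, by the convention for division by \<open>0\<close>.
\<close>

definition frac_kernel :: "real \<Rightarrow> 'a::euclidean_space \<Rightarrow> real" where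
  "frac_kernel s h = 1 / norm h powr (real DIM('a) + 2 * s)"

definition gagliardo :: "real \<Rightarrow> ('a::euclidean_space \<Rightarrow> real) \<Rightarrow> ennreal" where
  "gagliardo s v =
     (\<integral>\<^sup>+z. ennreal ((v (fst z) - v (snd z))\<^sup>2 * frac_kernel s (fst z - snd z)) \<partial>lebesgue)"

lemma frac_kernel_nonneg [simp]: "0 \<le> frac_kernel s h"
  by (simp add: frac_kernel_def)

lemma frac_kernel_measurable [measurable]: "frac_kernel s \<in> borel_measurable borel"
  unfolding frac_kernel_def[abs_def] by measurable

lemma frac_kernel_diff_measurable [measurable]:
  "(\<lambda>z. frac_kernel s (fst z - snd z)) \<in> borel_measurable (lebesgue :: ('a::euclidean_space \<times> 'a) measure)"
proof -
  have "(\<lambda>z. frac_kernel s (fst z - snd z)) \<in> borel_measurable (borel :: ('a \<times> 'a) measure)"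
    by (simp add: borel_prod[symmetric])
  then show ?thesis by (intro measurable_completion) simp
qed

lemma fun_onD:
  "u \<in> fun_on \<Omega> \<Longrightarrow> u \<in> borel_measurable lebesgue"
  "u \<in> fun_on \<Omega> \<Longrightarrow> x \<notin> \<Omega> \<Longrightarrow> u x = 0"
  by (auto simp: fun_on_def)

lemma fun_on_diff: "u \<in> fun_on \<Omega> \<Longrightarrow> v \<in> fun_on \<Omega> \<Longrightarrow> (\<lambda>x. u x - v x) \<in> fun_on \<Omega>"
  by (auto simp: fun_on_def)

lemma test_fun_continuous: "f \<in> test_fun \<Omega> \<Longrightarrow> continuous_on UNIV f"
  using test_fun_Ck[of f \<Omega> 0] by simp

lemma continuous_lebesgue_measurable:
  fixes f :: "'a::euclidean_space \<Rightarrow> 'b::euclidean_space"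
  assumes "continuous_on UNIV f"
  shows "f \<in> borel_measurable lebesgue"
proof -
  have "f \<in> borel_measurable borel" using assms by (rule borel_measurable_continuous_onI)
  then show ?thesis by (intro measurable_completion) simp
qed

lemma test_fun_fun_on: "f \<in> test_fun \<Omega> \<Longrightarrow> f \<in> fun_on \<Omega>"
  using test_fun_support[of f \<Omega>] continuous_lebesgue_measurable[OF test_fun_continuous, of f \<Omega>]
  unfolding fun_on_def by blast

lemma L2_seminorm_eq:
  assumes "u \<in> fun_on \<Omega>"
  shows "L2_seminorm \<Omega> u = enn_sqrt (sq_integral u)"
  unfolding L2_seminorm_def sq_integral_def
  by (rule arg_cong[where f=enn_sqrt], rule nn_integral_cong)
    (use fun_onD(2)[OF assms] in \<open>auto simp: indicator_def\<close>)

lemma frac_seminorm_eq: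
  assumes "u \<in> fun_on \<Omega>"
  shows "frac_seminorm \<Omega> s u = enn_sqrt (gagliardo s u)"
  unfolding frac_seminorm_def gagliardo_def frac_kernel_def
  by (rule arg_cong[where f=enn_sqrt], rule nn_integral_cong)
    (use fun_onD(2)[OF assms] in \<open>auto simp: indicator_def Q_set_def\<close>)

lemma X_space_iff:
  "u \<in> X_space \<Omega> s \<longleftrightarrow> u \<in> fun_on \<Omega> \<and> sq_integral u < \<infinity> \<and> gagliardo s u < \<infinity> \<and>
    (\<exists>f. (\<forall>n. f n \<in> test_fun \<Omega>) \<and> (\<lambda>n. sq_integral (\<lambda>x. u x - f n x)) \<longlonglongrightarrow> 0 \<and>
       (\<lambda>n. gagliardo s (\<lambda>x. u x - f n x)) \<longlonglongrightarrow> 0)"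
proof (cases "u \<in> fun_on \<Omega>")
  case True
  have X: "X_norm \<Omega> s v = enn_sqrt (sq_integral v) + enn_sqrt (gagliardo s v)" if "v \<in> fun_on \<Omega>" for v
    using that by (simp add: X_norm_def L2_seminorm_eq frac_seminorm_eq)
  have "(\<lambda>n. X_norm \<Omega> s (\<lambda>x. u x - f n x)) \<longlonglongrightarrow> 0 \<longleftrightarrow>
      (\<lambda>n. sq_integral (\<lambda>x. u x - f n x)) \<longlonglongrightarrow> 0 \<and> (\<lambda>n. gagliardo s (\<lambda>x. u x - f n x)) \<longlonglongrightarrow> 0"
    if "\<forall>n. f n \<in> test_fun \<Omega>" for f
  proof -
    have "X_norm \<Omega> s (\<lambda>x. u x - f n x) =
       enn_sqrt (sq_integral (\<lambda>x. u x - f n x)) + enn_sqrt (gagliardo s (\<lambda>x. u x - f n x))" for n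
      by (rule X[OF fun_on_diff[OF True test_fun_fun_on]]) (use that in blast)
    then show ?thesis by (simp add: ennreal_add_tendsto_0_iff enn_sqrt_tendsto_0_iff)
  qed
  moreover have "X_norm \<Omega> s u < \<infinity> \<longleftrightarrow> sq_integral u < \<infinity> \<and> gagliardo s u < \<infinity>"
    using enn_sqrt_less_top_iff by (simp add: X[OF True])
  ultimately show ?thesis using True unfolding X_space_def test_closure_def by blast
next
  case False
  then show ?thesis by (simp add: X_space_def test_closure_def)
qed

lemma gagliardo_mono:
  assumes "\<And>x y. \<bar>v x - v y\<bar> \<le> \<bar>u x - u y\<bar>"
  shows "gagliardo s v \<le> gagliardo s u"
  unfolding gagliardo_def
proof (intro nn_integral_mono ennreal_leI mult_right_mono frac_kernel_nonneg)
  show "(v (fst z) - v (snd z))\<^sup>2 \<le> (u (fst z) - u (snd z))\<^sup>2" for z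
    using power_mono[OF assms[of "fst z" "snd z"], of 2] by simp
qed

lemma sq_integral_mono:
  assumes "\<And>x. \<bar>v x\<bar> \<le> \<bar>u x\<bar>"
  shows "sq_integral v \<le> sq_integral u"
  unfolding sq_integral_def
proof (intro nn_integral_mono ennreal_leI)
  show "(v x)\<^sup>2 \<le> (u x)\<^sup>2" for x
    using power_mono[OF assms[of x], of 2] by simp
qed

lemma L2_approx_AE_subseq:
  assumes u: "u \<in> fun_on \<Omega>" "sq_integral u < \<infinity>"
    and f: "\<And>n. f n \<in> fun_on \<Omega>" and lim: "(\<lambda>n. sq_integral (\<lambda>x. u x - f n x)) \<longlonglongrightarrow> 0"
  shows "\<exists>r. strict_mono r \<and> (AE x in lebesgue. (\<lambda>n. f (r n) x) \<longlonglongrightarrow> u x)"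
proof -
  have [measurable]: "u \<in> borel_measurable lebesgue" "\<And>n. f n \<in> borel_measurable lebesgue"
    using u f by (auto simp: fun_on_def)
  have "eventually (\<lambda>n. sq_integral (\<lambda>x. u x - f n x) < 1) sequentially"
    using order_tendstoD(2)[OF lim, of 1] by simp
  then obtain N where N: "\<And>n. n \<ge> N \<Longrightarrow> sq_integral (\<lambda>x. u x - f n x) < 1"
    unfolding eventually_sequentially by blast
  have "\<exists>r. strict_mono r \<and> (AE x in lebesgue. (\<lambda>n. u x - f (r n + N) x) \<longlonglongrightarrow> 0)"
  proof (rule AE_subseq_of_L2_tendsto_0)
    show "(\<lambda>n. \<integral>\<^sup>+ x. ennreal ((u x - f (n + N) x)\<^sup>2) \<partial>lebesgue) \<longlonglongrightarrow> 0"
      using LIMSEQ_ignore_initial_segment[OF lim, of N] by (simp add: sq_integral_def)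
    show "(\<integral>\<^sup>+ x. ennreal ((u x - f (n + N) x)\<^sup>2) \<partial>lebesgue) < \<infinity>" for n
      using less_trans[OF N[of "n + N"], of \<infinity>] by (simp add: sq_integral_def)
  qed measurable
  then obtain r where r: "strict_mono r" "AE x in lebesgue. (\<lambda>n. u x - f (r n + N) x) \<longlonglongrightarrow> 0" by blast
  have "AE x in lebesgue. (\<lambda>n. f (r n + N) x) \<longlonglongrightarrow> u x"
    using r(2)
  proof eventually_elim
    case (elim x)
    from tendsto_diff[OF tendsto_const[of "u x"] elim] show ?case by simp
  qed
  moreover have "strict_mono (\<lambda>n. r n + N)" using r(1) by (simp add: strict_mono_def)
  ultimately show ?thesis by blast
qed

section \<open>Truncation in the fractional space\<close>

text \<open>
  Smooth functions with slope in \<open>[0, 1]\<close> and value \<open>0\<close> at \<open>0\<close>.  Composition with them maps test functions to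
  test functions, and it maps the closures of the test functions to themselves.
\<close>

definition truncation :: "(real \<Rightarrow> real) \<Rightarrow> (real \<Rightarrow> real) \<Rightarrow> bool" where
  "truncation g g' \<longleftrightarrow> smooth g \<and> g 0 = 0 \<and> (\<forall>t. (g has_real_derivative g' t) (at t)) \<and>
     (\<forall>t. 0 \<le> g' t \<and> g' t \<le> 1)"

lemma truncationD:
  assumes "truncation g g'"
  shows "smooth g" "g 0 = 0" "(g has_real_derivative g' t) (at t)" "0 \<le> g' t" "g' t \<le> 1"
  using assms by (auto simp: truncation_def)

lemma truncation_increment:
  assumes "truncation g g'"
  obtains c where "0 \<le> c" "c \<le> 1" "g x - g y = c * (x - y)"
proof -
  have "\<exists>c. 0 \<le> c \<and> c \<le> 1 \<and> g x - g y = c * (x - y)"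
  proof (cases x y rule: linorder_cases)
    case less
    from MVT2[OF less truncationD(3)[OF assms]] obtain z where "g y - g x = (y - x) * g' z" by blast
    then show ?thesis using truncationD(4,5)[OF assms, of z] by (intro exI[of _ "g' z"]) (auto simp: algebra_simps)
  next
    case greater
    from MVT2[OF greater truncationD(3)[OF assms]] obtain z where "g x - g y = (x - y) * g' z" by blast
    then show ?thesis using truncationD(4,5)[OF assms, of z] by (intro exI[of _ "g' z"]) (auto simp: algebra_simps)
  qed (auto intro: exI[of _ 0])
  then show ?thesis using that by blast
qed

lemma truncation_lipschitz:
  assumes "truncation g g'"
  shows "\<bar>g x - g y\<bar> \<le> \<bar>x - y\<bar>"
proof -
  obtain c where "0 \<le> c" "c \<le> 1" "g x - g y = c * (x - y)" by (rule truncation_increment[OF assms])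
  then show ?thesis by (simp add: abs_mult mult_left_le_one_le)
qed

lemma truncation_abs_le: "truncation g g' \<Longrightarrow> \<bar>g x\<bar> \<le> \<bar>x\<bar>"
  using truncation_lipschitz[of g g' x 0] truncationD(2)[of g g'] by simp

lemma truncation_increment_square:
  assumes "truncation g g'"
  shows "(g x - g y)\<^sup>2 \<le> (x - y) * (g x - g y)" "(x - y) * (g x - g y) \<le> (x - y)\<^sup>2"
proof -
  obtain c where c: "0 \<le> c" "c \<le> 1" "g x - g y = c * (x - y)" by (rule truncation_increment[OF assms])
  have "c * c * (x - y)\<^sup>2 \<le> c * (x - y)\<^sup>2" "c * (x - y)\<^sup>2 \<le> 1 * (x - y)\<^sup>2"
    using c mult_left_le[of c c] by (intro mult_right_mono; simp)+
  then show "(g x - g y)\<^sup>2 \<le> (x - y) * (g x - g y)" "(x - y) * (g x - g y) \<le> (x - y)\<^sup>2"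
    by (simp_all add: c(3) power2_eq_square algebra_simps)
qed

lemma truncation_isCont: "truncation g g' \<Longrightarrow> isCont g t"
  using truncationD(3) DERIV_isCont by blast

lemma smooth_isCont_deriv:
  assumes "smooth g" "\<And>t. (g has_real_derivative g' t) (at t)"
  shows "isCont g' t"
proof -
  obtain D where D: "D 0 = g" "\<And>n t. (D n has_real_derivative D (Suc n) t) (at t)"
    using assms(1) unfolding smooth_def by auto
  have "g' = D 1"
    using DERIV_unique[OF assms(2)] D(2)[of 0] D(1) by fastforce
  then show ?thesis using DERIV_isCont[OF D(2)[of 1 t]] by simp
qed

lemma truncation_isCont_deriv: "truncation g g' \<Longrightarrow> isCont g' t"
  using smooth_isCont_deriv truncationD(1,3) by metis

lemma truncation_measurable:
  assumes "truncation g g'"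
  shows "g \<in> borel_measurable borel" "g' \<in> borel_measurable borel"
  using truncation_isCont[OF assms] truncation_isCont_deriv[OF assms]
  by (auto intro!: borel_measurable_continuous_onI simp: continuous_on_eq_continuous_at)

lemma truncation_fun_on:
  assumes "truncation g g'" "u \<in> fun_on \<Omega>"
  shows "(\<lambda>x. g (u x)) \<in> fun_on \<Omega>"
  using measurable_compose[OF fun_onD(1)[OF assms(2)] truncation_measurable(1)[OF assms(1)]]
    fun_onD(2)[OF assms(2)] truncationD(2)[OF assms(1)] by (auto simp: fun_on_def)

text \<open>
  If the test functions \<open>f n\<close> tend to \<open>u\<close> in the fractional norm, then a subsequence of \<open>g (f n)\<close> tends to
  \<open>g u\<close> in that norm: its increments converge almost everywhere, and those of \<open>g u - g (f n)\<close> are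
  dominated by those of \<open>u - f n\<close>, which tend to \<open>0\<close> in \<open>L2\<close>, and by those of \<open>u\<close>.
\<close>

lemma truncation_X_space:
  assumes g: "truncation g g'" and u: "u \<in> X_space \<Omega> s"
  shows "(\<lambda>x. g (u x)) \<in> X_space \<Omega> s"
proof -
  obtain f where f: "\<And>n. f n \<in> test_fun \<Omega>" "(\<lambda>n. sq_integral (\<lambda>x. u x - f n x)) \<longlonglongrightarrow> 0"
     "(\<lambda>n. gagliardo s (\<lambda>x. u x - f n x)) \<longlonglongrightarrow> 0" and
    u': "u \<in> fun_on \<Omega>" "sq_integral u < \<infinity>" "gagliardo s u < \<infinity>"
    using u unfolding X_space_iff by blast
  have fo: "f n \<in> fun_on \<Omega>" for n by (rule test_fun_fun_on[OF f(1)])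
  obtain r where r: "strict_mono r" "AE x in lebesgue. (\<lambda>n. f (r n) x) \<longlonglongrightarrow> u x"
    using L2_approx_AE_subseq[OF u'(1,2) fo f(2)] by blast
  note [measurable] = truncation_measurable[OF g] fun_onD(1)[OF u'(1)] fun_onD(1)[OF fo]
  define h where "h n x = g (f (r n) x)" for n x
  have h: "h n \<in> test_fun \<Omega>" for n
    unfolding h_def[abs_def] by (rule test_fun_smooth_comp[OF f(1) truncationD(1,2)[OF g]])
  have f2: "(\<lambda>n. sq_integral (\<lambda>x. u x - f (r n) x)) \<longlonglongrightarrow> 0"
    using LIMSEQ_subseq_LIMSEQ[OF f(2) r(1)] by (simp add: o_def)
  have f3: "(\<lambda>n. gagliardo s (\<lambda>x. u x - f (r n) x)) \<longlonglongrightarrow> 0"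
    using LIMSEQ_subseq_LIMSEQ[OF f(3) r(1)] by (simp add: o_def)
  have "sq_integral (\<lambda>x. g (u x) - h n x) \<le> sq_integral (\<lambda>x. u x - f (r n) x)" for n
    unfolding h_def by (intro sq_integral_mono truncation_lipschitz[OF g])
  then have 1: "(\<lambda>n. sq_integral (\<lambda>x. g (u x) - h n x)) \<longlonglongrightarrow> 0"
    by (rule ennreal_tendsto_0_le[OF f2])
  have 2: "(\<lambda>n. gagliardo s (\<lambda>x. g (u x) - h n x)) \<longlonglongrightarrow> 0"
    unfolding gagliardo_def
  proof (rule nn_integral_tendsto_zero_dominated)
    let ?e = "\<lambda>n z. 2 * ennreal (((u (fst z) - f (r n) (fst z)) - (u (snd z) - f (r n) (snd z)))\<^sup>2 * frac_kernel s (fst z - snd z))"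
    let ?g = "\<lambda>z. 8 * ennreal ((u (fst z) - u (snd z))\<^sup>2 * frac_kernel s (fst z - snd z))"
    show "(\<lambda>n. \<integral>\<^sup>+z. ?e n z \<partial>lebesgue) \<longlonglongrightarrow> 0"
    proof -
      have "(\<lambda>n. 2 * gagliardo s (\<lambda>x. u x - f (r n) x)) \<longlonglongrightarrow> 2 * 0"
        by (intro ennreal_tendsto_cmult f3) simp
      then show ?thesis unfolding gagliardo_def by (simp add: nn_integral_cmult)
    qed
    show "(\<integral>\<^sup>+z. ?g z \<partial>lebesgue) < \<infinity>"
      using u'(3) unfolding gagliardo_def by (simp add: nn_integral_cmult ennreal_mult_less_top)
    show "AE z in lebesgue. (\<lambda>n. ennreal (((g (u (fst z)) - h n (fst z)) - (g (u (snd z)) - h n (snd z)))\<^sup>2 * frac_kernel s (fst z - snd z))) \<longlonglongrightarrow> 0"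
      using AE_lebesgue_prod[OF r(2)]
    proof eventually_elim
      case (elim z)
      have c: "(\<lambda>n. g (u x) - h n x) \<longlonglongrightarrow> g (u x) - g (u x)" if "(\<lambda>n. f (r n) x) \<longlonglongrightarrow> u x" for x
        unfolding h_def by (intro tendsto_diff tendsto_const isCont_tendsto_compose[OF truncation_isCont[OF g]] that)
      have "(\<lambda>n. ennreal (((g (u (fst z)) - h n (fst z)) - (g (u (snd z)) - h n (snd z)))\<^sup>2 * frac_kernel s (fst z - snd z)))
          \<longlonglongrightarrow> ennreal (((g (u (fst z)) - g (u (fst z))) - (g (u (snd z)) - g (u (snd z))))\<^sup>2 * frac_kernel s (fst z - snd z))"
        by (intro tendsto_ennrealI tendsto_mult tendsto_power tendsto_diff[OF c c] elim[THEN conjunct1] elim[THEN conjunct2] tendsto_const)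
      then show ?case by simp
    qed
    show "ennreal (((g (u (fst z)) - h n (fst z)) - (g (u (snd z)) - h n (snd z)))\<^sup>2 * frac_kernel s (fst z - snd z)) \<le> ?e n z + ?g z" for n z
    proof -
      let ?a = "u (fst z)" and ?b = "u (snd z)" and ?c = "f (r n) (fst z)" and ?d = "f (r n) (snd z)"
      have "\<bar>(g ?a - g ?c) - (g ?b - g ?d)\<bar> \<le> \<bar>g ?a - g ?b\<bar> + \<bar>g ?c - g ?d\<bar>" by linarith
      also have "\<dots> \<le> \<bar>?a - ?b\<bar> + \<bar>?c - ?d\<bar>" by (intro add_mono truncation_lipschitz[OF g])
      also have "\<dots> \<le> \<bar>(?a - ?c) - (?b - ?d)\<bar> + 2 * \<bar>?a - ?b\<bar>"
        using abs_triangle_ineq4[of "?a - ?b" "(?a - ?c) - (?b - ?d)"] by (simp add: abs_minus_commute)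
      finally have "((g ?a - g ?c) - (g ?b - g ?d))\<^sup>2 \<le> (\<bar>(?a - ?c) - (?b - ?d)\<bar> + 2 * \<bar>?a - ?b\<bar>)\<^sup>2"
        by (metis abs_ge_zero power2_abs power_mono)
      also have "\<dots> \<le> 2 * ((?a - ?c) - (?b - ?d))\<^sup>2 + 8 * (?a - ?b)\<^sup>2"
        using power2_add_le[of "\<bar>(?a - ?c) - (?b - ?d)\<bar>" "2 * \<bar>?a - ?b\<bar>"] by (simp add: power_mult_distrib)
      finally have "((g ?a - g ?c) - (g ?b - g ?d))\<^sup>2 * frac_kernel s (fst z - snd z) \<le>
          (2 * ((?a - ?c) - (?b - ?d))\<^sup>2 + 8 * (?a - ?b)\<^sup>2) * frac_kernel s (fst z - snd z)"
        by (rule mult_right_mono) simp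
      then have "ennreal (((g ?a - g ?c) - (g ?b - g ?d))\<^sup>2 * frac_kernel s (fst z - snd z)) \<le>
         ennreal (2 * (((?a - ?c) - (?b - ?d))\<^sup>2 * frac_kernel s (fst z - snd z)) + 8 * ((?a - ?b)\<^sup>2 * frac_kernel s (fst z - snd z)))"
        by (intro ennreal_leI) (simp add: algebra_simps)
      also have "\<dots> = ?e n z + ?g z"
        by (subst ennreal_plus) (simp_all add: ennreal_mult)
      finally show ?thesis by (simp add: h_def)
    qed
  qed (simp_all add: h_def)
  have 3: "sq_integral (\<lambda>x. g (u x)) < \<infinity>"
    by (rule le_less_trans[OF sq_integral_mono[OF truncation_abs_le[OF g]] u'(2)])
  have 4: "gagliardo s (\<lambda>x. g (u x)) < \<infinity>"
    by (rule le_less_trans[OF gagliardo_mono[OF truncation_lipschitz[OF g]] u'(3)])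
  show ?thesis
    unfolding X_space_iff using truncation_fun_on[OF g u'(1)] 1 2 3 4 h by blast
qed

section \<open>The fractional Sobolev inequality\<close>

lemma frac_crit_exp_facts:
  assumes "0 < s" "2 * s < real N"
  shows "frac_crit_exp N s > 2" "2 * s / real N = 1 - 2 / frac_crit_exp N s"
    "frac_crit_exp N s * (2 * s / real N) = frac_crit_exp N s - 2"
proof -
  have N: "real N > 0" "real N - 2 * s > 0" using assms by linarith+
  show "frac_crit_exp N s > 2" using N assms by (simp add: frac_crit_exp_def field_simps)
  show "2 * s / real N = 1 - 2 / frac_crit_exp N s" using N assms by (simp add: frac_crit_exp_def field_simps)
  show "frac_crit_exp N s * (2 * s / real N) = frac_crit_exp N s - 2"
    using N assms by (simp add: frac_crit_exp_def field_simps)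
qed

lemma frac_kernel_ge:
  assumes "h \<noteq> 0" "norm h < r" "0 < s"
  shows "1 / r powr (real DIM('a) + 2 * s) \<le> frac_kernel s (h :: 'a::euclidean_space)"
  unfolding frac_kernel_def
proof (rule divide_left_mono)
  show "norm h powr (real DIM('a) + 2 * s) \<le> r powr (real DIM('a) + 2 * s)"
    using assms by (intro powr_mono2) auto
  have "0 < norm h" "0 < r" using assms by (auto intro: le_less_trans[of 0 "norm h"])
  then show "0 < r powr (real DIM('a) + 2 * s) * norm h powr (real DIM('a) + 2 * s)" by simp
qed simp

text \<open>
  The pointwise estimate behind the fractional Sobolev inequality: with \<open>S\<close> the integral of \<open>\<bar>v\<bar> powr p\<close> and
  \<open>d\<close> the inner Gagliardo integral at \<open>x\<close>, the value \<open>\<bar>v x\<bar> powr p\<close> is at most a constant times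
  \<open>S powr (1 - 2 / p) * d\<close>.  Put \<open>T = \<bar>v x\<bar>\<close>.  By Chebyshev, \<open>\<bar>v\<bar> \<ge> T / 2\<close> on a set of measure at most
  \<open>m = S * (2 / T) powr p\<close> only; so in a ball around \<open>x\<close> of measure \<open>2 * m\<close> the values of \<open>v\<close> differ
  from \<open>v x\<close> by at least \<open>T / 2\<close> on a part of measure at least \<open>m\<close>, which bounds \<open>d\<close> from below.
\<close>

lemma frac_sobolev_pointwise:
  fixes v :: "'a::euclidean_space \<Rightarrow> real" and s S d :: real
  defines "p \<equiv> frac_crit_exp DIM('a) s" and "c \<equiv> unit_ball_vol (real DIM('a))"
  assumes s: "0 < s" "2 * s < real DIM('a)"
    and v [measurable]: "v \<in> borel_measurable borel"
    and S: "(\<integral>\<^sup>+y. ennreal (\<bar>v y\<bar> powr p) \<partial>lborel) = ennreal S" "S > 0"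
    and d: "(\<integral>\<^sup>+y. ennreal ((v x - v y)\<^sup>2 * frac_kernel s (x - y)) \<partial>lborel) = ennreal d" "d \<ge> 0"
  shows "\<bar>v x\<bar> powr p \<le> (8 / c * (2 / c) powr (1 - 2 / p) * 2 powr (p - 2)) * S powr (1 - 2 / p) * d"
proof (cases "v x = 0")
  case True
  then show ?thesis using S(2) d(2) by (simp add: c_def)
next
  case False
  define T where "T = \<bar>v x\<bar>"
  have T: "T > 0" using False by (simp add: T_def)
  have c: "c > 0" by (simp add: c_def)
  have p: "p > 2" using frac_crit_exp_facts(1)[OF s] by (simp add: p_def)
  define N where "N = real DIM('a)"
  have N: "N > 0" by (simp add: N_def)
  define m where "m = S * (2 / T) powr p"
  have m: "m > 0" using S T by (simp add: m_def)
  \<comment> \<open>the radius for which the ball has measure \<open>2 * m\<close>\<close>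
  define r where "r = (2 * m / c) powr (1 / N)"
  have r: "r > 0" using m c by (simp add: r_def)
  have rN: "c * r ^ DIM('a) = 2 * m"
  proof -
    have "r ^ DIM('a) = r powr N" using r by (simp add: N_def powr_realpow)
    also have "\<dots> = 2 * m / c" using m c N by (simp add: r_def powr_powr)
    finally show ?thesis using c by simp
  qed
  define L where "L = {y. \<bar>v y\<bar> \<ge> T / 2}"
  have [measurable]: "L \<in> sets borel" unfolding L_def by measurable
  have L: "emeasure lborel L \<le> ennreal m"
  proof -
    have "emeasure lborel {y\<in>UNIV. 1 \<le> ennreal ((2 / T) powr p) * ennreal (\<bar>v y\<bar> powr p)}
        \<le> ennreal ((2 / T) powr p) * (\<integral>\<^sup>+y. ennreal (\<bar>v y\<bar> powr p) * indicator UNIV y \<partial>lborel)"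
      by (rule nn_integral_Markov_inequality) auto
    also have "\<dots> = ennreal m" using S by (simp add: m_def ennreal_mult[symmetric] mult.commute)
    finally have *: "emeasure lborel {y\<in>UNIV. 1 \<le> ennreal ((2 / T) powr p) * ennreal (\<bar>v y\<bar> powr p)} \<le> ennreal m" .
    have "L \<subseteq> {y\<in>UNIV. 1 \<le> ennreal ((2 / T) powr p) * ennreal (\<bar>v y\<bar> powr p)}"
    proof
      fix y assume "y \<in> L"
      then have "1 \<le> (2 / T) * \<bar>v y\<bar>" using T by (simp add: L_def field_simps)
      then have "1 powr p \<le> ((2 / T) * \<bar>v y\<bar>) powr p" using p by (intro powr_mono2) auto
      also have "\<dots> = (2 / T) powr p * \<bar>v y\<bar> powr p" using T by (intro powr_mult)
      finally show "y \<in> {y\<in>UNIV. 1 \<le> ennreal ((2 / T) powr p) * ennreal (\<bar>v y\<bar> powr p)}"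
        by (simp add: ennreal_mult[symmetric])
    qed
    then have "emeasure lborel L \<le> emeasure lborel {y\<in>UNIV. 1 \<le> ennreal ((2 / T) powr p) * ennreal (\<bar>v y\<bar> powr p)}"
      by (intro emeasure_mono) measurable
    with * show ?thesis by (rule order_trans[rotated])
  qed
  define B where "B = ball x r - L"
  have [measurable]: "B \<in> sets borel" unfolding B_def by measurable
  have B: "ennreal m \<le> emeasure lborel B"
  proof -
    have "ennreal (2 * m) = emeasure lborel (ball x r)"
      using r rN emeasure_ball[of r x] by (simp add: c_def)
    also have "\<dots> \<le> emeasure lborel (B \<union> L)"
      by (intro emeasure_mono) (auto simp: B_def)
    also have "\<dots> \<le> emeasure lborel B + emeasure lborel L"
      by (intro emeasure_subadditive) auto
    also have "\<dots> \<le> emeasure lborel B + ennreal m" by (intro add_left_mono L)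
    finally have "ennreal m + ennreal m \<le> ennreal m + emeasure lborel B"
      using m by (simp add: add.commute flip: ennreal_plus)
    then show ?thesis by (simp add: ennreal_add_left_cancel_le)
  qed
  let ?k = "(T / 2)\<^sup>2 * (1 / r powr (N + 2 * s))"
  have "ennreal (?k * m) = ennreal ?k * ennreal m" using m by (intro ennreal_mult) auto
  also have "\<dots> \<le> ennreal ?k * emeasure lborel B" by (intro mult_left_mono B) simp
  also have "\<dots> = (\<integral>\<^sup>+y. ennreal ?k * indicator B y \<partial>lborel)" by (simp add: nn_integral_cmult_indicator)
  also have "\<dots> \<le> (\<integral>\<^sup>+y. ennreal ((v x - v y)\<^sup>2 * frac_kernel s (x - y)) \<partial>lborel)"
  proof (rule nn_integral_mono)
    fix y
    show "ennreal ?k * indicator B y \<le> ennreal ((v x - v y)\<^sup>2 * frac_kernel s (x - y))"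
    proof (cases "y \<in> B")
      case True
      then have y: "dist x y < r" "\<bar>v y\<bar> < T / 2" by (auto simp: B_def L_def)
      then have "x \<noteq> y" using T by (auto simp: T_def)
      then have k: "1 / r powr (N + 2 * s) \<le> frac_kernel s (x - y)"
        using y(1) s unfolding N_def by (intro frac_kernel_ge) (auto simp: dist_norm)
      have "T / 2 \<le> \<bar>v x - v y\<bar>" using y(2) unfolding T_def by linarith
      then have "(T / 2)\<^sup>2 \<le> \<bar>v x - v y\<bar>\<^sup>2" using T by (intro power_mono) auto
      then have "?k \<le> (v x - v y)\<^sup>2 * frac_kernel s (x - y)"
        using k by (intro mult_mono) auto
      then show ?thesis using True by (simp add: ennreal_leI)
    qed simp
  qed
  finally have "?k * m \<le> d" using d by simp
  then have 1: "T\<^sup>2 * m \<le> 4 * d * r powr (N + 2 * s)"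
    using r by (simp add: field_simps power2_eq_square)
  have "r powr (N + 2 * s) = r powr N * r powr (2 * s)" by (rule powr_add)
  also have "r powr N = 2 * m / c" using m c N by (simp add: r_def powr_powr)
  finally have "4 * d * r powr (N + 2 * s) = m * (8 / c * d * r powr (2 * s))" by simp
  with 1 have "T\<^sup>2 * m \<le> m * (8 / c * d * r powr (2 * s))" by simp
  then have "m * T\<^sup>2 \<le> m * (8 / c * d * r powr (2 * s))" by (simp only: mult.commute[of _ m])
  then have 2: "T\<^sup>2 \<le> 8 / c * d * r powr (2 * s)" by (rule mult_left_le_imp_le[OF _ m])
  have q: "2 * s / N = 1 - 2 / p" "p * (1 - 2 / p) = p - 2"
    using frac_crit_exp_facts(2,3)[OF s] by (simp_all add: N_def p_def)
  have "r powr (2 * s) = (2 * m / c) powr (2 * s / N)" using m c by (simp add: r_def powr_powr)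
  also have "2 * m / c = (2 / c) * S * (2 / T) powr p" by (simp add: m_def)
  also have "\<dots> powr (2 * s / N) = (2 / c) powr (1 - 2 / p) * S powr (1 - 2 / p) * (2 / T) powr (p - 2)"
    using c S T by (simp only: powr_mult powr_powr q)
  also have "(2 / T) powr (p - 2) = 2 powr (p - 2) / T powr (p - 2)" using T by (simp add: powr_divide)
  finally have "8 / c * d * r powr (2 * s) =
      8 / c * d * ((2 / c) powr (1 - 2 / p) * S powr (1 - 2 / p) * (2 powr (p - 2) / T powr (p - 2)))"
    by simp
  also have "\<dots> = (8 / c * (2 / c) powr (1 - 2 / p) * 2 powr (p - 2)) * S powr (1 - 2 / p) * d / T powr (p - 2)"
    by (simp add: mult_ac)
  finally have "T\<^sup>2 \<le> (8 / c * (2 / c) powr (1 - 2 / p) * 2 powr (p - 2)) * S powr (1 - 2 / p) * d / T powr (p - 2)"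
    using 2 by (rule subst[where P="\<lambda>z. T\<^sup>2 \<le> z"])
  then have "T\<^sup>2 * T powr (p - 2) \<le> (8 / c * (2 / c) powr (1 - 2 / p) * 2 powr (p - 2)) * S powr (1 - 2 / p) * d"
    using T by (subst (asm) pos_le_divide_eq) auto
  moreover have "T\<^sup>2 * T powr (p - 2) = T powr p"
    using T powr_add[of T 2 "p - 2"] by simp
  ultimately show ?thesis unfolding T_def by simp
qed

lemma gagliardo_eq_lborel:
  assumes v [measurable]: "v \<in> borel_measurable borel"
  shows "gagliardo s v = (\<integral>\<^sup>+x. (\<integral>\<^sup>+y. ennreal ((v x - v y)\<^sup>2 * frac_kernel s (x - y)) \<partial>lborel) \<partial>lborel)"
proof -
  have "gagliardo s v = (\<integral>\<^sup>+z. ennreal ((v (fst z) - v (snd z))\<^sup>2 * frac_kernel s (fst z - snd z)) \<partial>(lborel \<Otimes>\<^sub>M lborel))"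
    unfolding gagliardo_def lborel_prod by (rule nn_integral_completion)
  also have "\<dots> = (\<integral>\<^sup>+x. (\<integral>\<^sup>+y. ennreal ((v x - v y)\<^sup>2 * frac_kernel s (x - y)) \<partial>lborel) \<partial>lborel)"
    by (subst lborel.nn_integral_fst[symmetric]) auto
  finally show ?thesis .
qed

text \<open>
  Integrating the pointwise estimate gives \<open>S \<le> C * S powr (1 - 2 / p) * e\<close>.  Dividing by the power of \<open>S\<close>
  needs \<open>S < \<infinity>\<close>.
\<close>

lemma frac_sobolev_bounded:
  fixes v :: "'a::euclidean_space \<Rightarrow> real" and s e :: real
  defines "p \<equiv> frac_crit_exp DIM('a) s" and "c \<equiv> unit_ball_vol (real DIM('a))"
  assumes s: "0 < s" "2 * s < real DIM('a)"
    and v [measurable]: "v \<in> borel_measurable borel"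
    and fin: "(\<integral>\<^sup>+y. ennreal (\<bar>v y\<bar> powr p) \<partial>lborel) < \<infinity>"
    and e: "gagliardo s v \<le> ennreal e" "e \<ge> 0"
  shows "(\<integral>\<^sup>+y. ennreal (\<bar>v y\<bar> powr p) \<partial>lborel)
    \<le> ennreal (((8 / c * (2 / c) powr (1 - 2 / p) * 2 powr (p - 2)) * e) powr (p / 2))"
proof -
  define C where "C = 8 / c * (2 / c) powr (1 - 2 / p) * 2 powr (p - 2)"
  have c: "c > 0" by (simp add: c_def)
  have C: "C > 0" using c by (simp add: C_def)
  have p: "p > 2" using frac_crit_exp_facts(1)[OF s] by (simp add: p_def)
  obtain S where S: "(\<integral>\<^sup>+y. ennreal (\<bar>v y\<bar> powr p) \<partial>lborel) = ennreal S" "S \<ge> 0"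
    using fin by (cases "(\<integral>\<^sup>+y. ennreal (\<bar>v y\<bar> powr p) \<partial>lborel)") auto
  show ?thesis
  proof (cases "S = 0")
    case True
    then show ?thesis using S by simp
  next
    case False
    then have S0: "S > 0" using S by simp
    let ?D = "\<lambda>x. \<integral>\<^sup>+y. ennreal ((v x - v y)\<^sup>2 * frac_kernel s (x - y)) \<partial>lborel"
    have pw: "ennreal (\<bar>v x\<bar> powr p) \<le> ennreal (C * S powr (1 - 2 / p)) * ?D x" for x
    proof (cases "?D x")
      case (real d)
      have "\<bar>v x\<bar> powr p \<le> C * S powr (1 - 2 / p) * d"
        using frac_sobolev_pointwise[OF s v S(1)[unfolded p_def] S0 real(2,1)] unfolding C_def p_def c_def .
      then show ?thesis using real C S0 by (simp add: ennreal_mult[symmetric] ennreal_leI)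
    next
      case top
      then show ?thesis using C S0 by (simp add: ennreal_mult_top)
    qed
    have "ennreal S \<le> (\<integral>\<^sup>+x. ennreal (C * S powr (1 - 2 / p)) * ?D x \<partial>lborel)"
      unfolding S(1)[symmetric] by (intro nn_integral_mono pw)
    also have "\<dots> = ennreal (C * S powr (1 - 2 / p)) * gagliardo s v"
      unfolding gagliardo_eq_lborel[OF v] by (rule nn_integral_cmult) measurable
    also have "\<dots> \<le> ennreal (C * S powr (1 - 2 / p)) * ennreal e" by (intro mult_left_mono e) simp
    finally have "S \<le> C * S powr (1 - 2 / p) * e" using C e S0 by (simp add: ennreal_mult[symmetric])
    moreover have "S = S powr (1 - 2 / p) * S powr (2 / p)" using S0 by (simp flip: powr_add)
    ultimately have "S powr (1 - 2 / p) * S powr (2 / p) \<le> S powr (1 - 2 / p) * (C * e)"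
      by (simp add: algebra_simps)
    then have "S powr (2 / p) \<le> C * e" using S0 by simp
    then have "(S powr (2 / p)) powr (p / 2) \<le> (C * e) powr (p / 2)" using p by (intro powr_mono2) auto
    then have "S \<le> (C * e) powr (p / 2)" using p S0 by (simp add: powr_powr)
    then show ?thesis unfolding S(1) C_def by (rule ennreal_leI)
  qed
qed

lemma gagliardo_cong_AE:
  assumes "AE x in lebesgue. u x = v x"
  shows "gagliardo s u = gagliardo s v"
  unfolding gagliardo_def
proof (rule nn_integral_cong_AE)
  show "AE z in lebesgue. ennreal ((u (fst z) - u (snd z))\<^sup>2 * frac_kernel s (fst z - snd z)) =
      ennreal ((v (fst z) - v (snd z))\<^sup>2 * frac_kernel s (fst z - snd z))"
    using AE_lebesgue_prod[OF assms] by (rule eventually_mono) simp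
qed

text \<open>
  The general case follows from the case of finite \<open>S\<close> by cutting \<open>v\<close> off at the heights \<open>- n\<close> and \<open>n\<close>, which does
  not increase the Gagliardo integral, and by Fatou's lemma.
\<close>

theorem frac_sobolev:
  fixes s :: real
  defines "p \<equiv> frac_crit_exp DIM('a::euclidean_space) s"
  assumes s: "0 < s" "2 * s < real DIM('a)"
  shows "\<exists>C>0. \<forall>(\<Omega> :: 'a set) v e. bounded \<Omega> \<longrightarrow> v \<in> fun_on \<Omega> \<longrightarrow> 0 \<le> e \<longrightarrow> gagliardo s v \<le> ennreal e \<longrightarrow>
     (\<integral>\<^sup>+x. ennreal (\<bar>v x\<bar> powr p) \<partial>lebesgue) \<le> ennreal ((C * e) powr (p / 2))"
proof -
  define c where "c = unit_ball_vol (real DIM('a))"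
  define C where "C = 8 / c * (2 / c) powr (1 - 2 / p) * 2 powr (p - 2)"
  have c: "c > 0" by (simp add: c_def)
  have C: "C > 0" using c by (simp add: C_def)
  have p: "p > 2" using frac_crit_exp_facts(1)[OF s] by (simp add: p_def)
  have "(\<integral>\<^sup>+x. ennreal (\<bar>v x\<bar> powr p) \<partial>lebesgue) \<le> ennreal ((C * e) powr (p / 2))"
    if \<Omega>: "bounded \<Omega>" and v: "v \<in> fun_on \<Omega>" and e: "0 \<le> e" "gagliardo s v \<le> ennreal e"
    for \<Omega> :: "'a set" and v e
  proof -
    obtain R where R: "\<Omega> \<subseteq> ball 0 R" using \<Omega> bounded_subset_ballD[of \<Omega> 0] by blast
    obtain w0 where w0: "w0 \<in> borel_measurable lborel" "AE x in lborel. v x = w0 x"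
      using completion_ex_borel_measurable_real[OF fun_onD(1)[OF v]] by blast
    define w where "w n x = (if x \<in> ball 0 R then max (- real n) (min (real n) (w0 x)) else 0)" for n x
    have [measurable]: "w n \<in> borel_measurable borel" for n
      using w0(1) unfolding w_def[abs_def] by simp
    have eq: "AE x in lebesgue. w n x = max (- real n) (min (real n) (v x))" for n
      using AE_completion[OF w0(2)]
    proof eventually_elim
      case (elim x)
      have "v x = 0" if "x \<notin> ball 0 R" using fun_onD(2)[OF v, of x] R that by blast
      then show ?case using elim by (simp add: w_def)
    qed
    have bound: "(\<integral>\<^sup>+x. ennreal (\<bar>w n x\<bar> powr p) \<partial>lborel) \<le> ennreal ((C * e) powr (p / 2))" for n
      unfolding C_def p_def c_def
    proof (rule frac_sobolev_bounded[OF s _ _ _ e(1)])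
      have "(\<integral>\<^sup>+x. ennreal (\<bar>w n x\<bar> powr p) \<partial>lborel) \<le> (\<integral>\<^sup>+x. ennreal (real n powr p) * indicator (ball 0 R) (x::'a) \<partial>lborel)"
      proof (rule nn_integral_mono)
        fix x
        have "\<bar>w n x\<bar> powr p \<le> real n powr p" if "x \<in> ball 0 R"
          using p that by (intro powr_mono2) (auto simp: w_def)
        then show "ennreal (\<bar>w n x\<bar> powr p) \<le> ennreal (real n powr p) * indicator (ball 0 R) x"
          by (cases "x \<in> ball 0 R") (simp_all add: w_def ennreal_leI)
      qed
      also have "\<dots> = ennreal (real n powr p) * emeasure lborel (ball (0::'a) R)"
        by (simp add: nn_integral_cmult_indicator)
      also have "\<dots> < \<infinity>"
        using emeasure_lborel_ball_finite[of "0::'a" R] by (simp add: ennreal_mult_less_top)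
      finally show "(\<integral>\<^sup>+x. ennreal (\<bar>w n x\<bar> powr frac_crit_exp DIM('a) s) \<partial>lborel) < \<infinity>"
        by (simp add: p_def)
      have "gagliardo s (w n) = gagliardo s (\<lambda>x. max (- real n) (min (real n) (v x)))"
        by (rule gagliardo_cong_AE[OF eq])
      also have "\<dots> \<le> gagliardo s v" by (rule gagliardo_mono) linarith
      finally show "gagliardo s (w n) \<le> ennreal e" using e(2) by simp
    qed measurable
    show ?thesis
    proof (rule nn_integral_le_limit[where B = "\<lambda>n. ennreal ((C * e) powr (p / 2))"])
      show "(\<lambda>x. ennreal (\<bar>w n x\<bar> powr p)) \<in> borel_measurable lebesgue" for n
        by (rule measurable_completion) simp
      show "(\<integral>\<^sup>+ x. ennreal (\<bar>w n x\<bar> powr p) \<partial>lebesgue) \<le> ennreal ((C * e) powr (p / 2))" for n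
        using bound[of n] by (simp add: nn_integral_completion)
      have "AE x in lebesgue. \<forall>n. w n x = max (- real n) (min (real n) (v x))"
        using eq by (simp add: AE_all_countable)
      then show "AE x in lebesgue. (\<lambda>n. ennreal (\<bar>w n x\<bar> powr p)) \<longlonglongrightarrow> ennreal (\<bar>v x\<bar> powr p)"
      proof eventually_elim
        case (elim x)
        obtain k :: nat where k: "\<bar>v x\<bar> \<le> real k" using real_arch_simple by blast
        have "ennreal (\<bar>w n x\<bar> powr p) = ennreal (\<bar>v x\<bar> powr p)" if "n \<ge> k" for n
        proof -
          have "\<bar>v x\<bar> \<le> real n" using k that by linarith
          then have "w n x = v x" using elim by auto
          then show ?thesis by simp
        qed
        then show ?case by (intro tendsto_eventually) (auto simp: eventually_sequentially)
      qed
    qed simp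
  qed
  with C show ?thesis by blast
qed

section \<open>Weak gradients\<close>

text \<open>
  The classical gradient, assembled from the partial derivatives.
\<close>

definition grad :: "('a::euclidean_space \<Rightarrow> real) \<Rightarrow> 'a \<Rightarrow> 'a" where
  "grad f x = (\<Sum>i\<in>Basis. frechet_derivative f (at x) i *\<^sub>R i)"

lemma grad_inner_Basis: "i \<in> Basis \<Longrightarrow> grad f x \<bullet> i = frechet_derivative f (at x) i"
  by (simp add: grad_def inner_sum_left inner_Basis if_distrib cong: if_cong)

lemma test_fun_differentiable: "f \<in> test_fun \<Omega> \<Longrightarrow> f differentiable (at x)"
  using test_fun_Ck[of f \<Omega> 1] by simp

lemma has_derivative_grad:
  assumes "f differentiable (at x)"
  shows "(f has_derivative (\<lambda>h. grad f x \<bullet> h)) (at x)"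
proof -
  have d: "(f has_derivative frechet_derivative f (at x)) (at x)"
    using assms by (simp add: frechet_derivative_works)
  have l: "linear (frechet_derivative f (at x))" using has_derivative_linear[OF d] .
  have "frechet_derivative f (at x) h = grad f x \<bullet> h" for h
  proof -
    have "frechet_derivative f (at x) h = frechet_derivative f (at x) (\<Sum>i\<in>Basis. (h \<bullet> i) *\<^sub>R i)"
      by (simp add: euclidean_representation)
    also have "\<dots> = (\<Sum>i\<in>Basis. (h \<bullet> i) * frechet_derivative f (at x) i)"
      by (simp add: linear_sum[OF l] linear_cmul[OF l])
    also have "\<dots> = grad f x \<bullet> h"
      by (simp add: grad_def inner_sum_left inner_commute[of h] mult.commute)
    finally show ?thesis .
  qed
  then show ?thesis using d by (metis (no_types, lifting) ext)
qed

lemma grad_eqI: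
  assumes "(f has_derivative (\<lambda>h. v \<bullet> h)) (at x)"
  shows "grad f x = v"
  by (rule euclidean_eqI) (simp add: grad_inner_Basis frechet_derivative_eqI[OF assms])

lemma test_fun_grad_continuous:
  assumes "f \<in> test_fun \<Omega>"
  shows "continuous_on UNIV (grad f)"
proof -
  have "continuous_on UNIV (\<lambda>x. frechet_derivative f (at x) i)" if "i \<in> Basis" for i
    using test_fun_Ck[OF assms, of 1] that by simp
  then show ?thesis unfolding grad_def[abs_def] by (intro continuous_intros) auto
qed

lemma grad_eq_0_outside:
  assumes "compact K" "\<forall>x. x \<notin> K \<longrightarrow> f x = 0" "x \<notin> K"
  shows "grad f x = 0"
proof (rule grad_eqI)
  have "((\<lambda>x. 0) has_derivative (\<lambda>h. 0 \<bullet> h)) (at x)" by simp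
  then show "(f has_derivative (\<lambda>h. 0 \<bullet> h)) (at x)"
    by (rule has_derivative_transform_within_open[of _ _ _ _ "- K"])
      (use assms in \<open>auto simp: compact_imp_closed open_Compl\<close>)
qed

lemma test_fun_bounded_grad:
  assumes f: "f \<in> test_fun \<Omega>"
  shows "\<exists>L\<ge>0. \<forall>x. norm (grad f x) \<le> L"
proof -
  obtain K where K: "compact K" "\<forall>x. x \<notin> K \<longrightarrow> f x = 0" using test_fun_support[OF f] by blast
  have "compact (grad f ` K)"
    using K(1) test_fun_grad_continuous[OF f] by (intro compact_continuous_image) (auto intro: continuous_on_subset)
  then obtain L where L: "\<And>x. x \<in> K \<Longrightarrow> norm (grad f x) \<le> L"
    using compact_imp_bounded bounded_iff by (metis imageI)
  have "norm (grad f x) \<le> max 0 L" for x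
    using L[of x] grad_eq_0_outside[OF K, of x] by (cases "x \<in> K") auto
  then show ?thesis by (intro exI[of _ "max 0 L"]) simp
qed

lemma test_fun_lipschitz:
  assumes f: "f \<in> test_fun \<Omega>" and L: "\<And>x. norm (grad f x) \<le> L"
  shows "\<bar>f x - f y\<bar> \<le> L * norm (x - y)"
proof -
  have "norm (f x - f y) \<le> L * norm (x - y)"
  proof (rule differentiable_bound[where S=UNIV and f'="\<lambda>x h. grad f x \<bullet> h"])
    show "(f has_derivative (\<lambda>h. grad f z \<bullet> h)) (at z within UNIV)" for z
      using has_derivative_grad[OF test_fun_differentiable[OF f]] by simp
    show "onorm (\<lambda>h. grad f z \<bullet> h) \<le> L" for z
    proof (rule onorm_le)
      show "norm (grad f z \<bullet> h) \<le> L * norm h" for h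
        using Cauchy_Schwarz_ineq2[of "grad f z" h] mult_right_mono[OF L[of z], of "norm h"] by simp
    qed
  qed auto
  then show ?thesis by simp
qed

lemma integrable_compact_support:
  fixes f :: "'a::euclidean_space \<Rightarrow> 'b::euclidean_space"
  assumes "continuous_on UNIV f" "compact K" "\<And>x. x \<notin> K \<Longrightarrow> f x = 0"
  shows "integrable lborel f"
proof -
  have "integrable lborel (\<lambda>x. indicator K x *\<^sub>R f x)"
    using assms by (intro borel_integrable_compact) (auto intro: continuous_on_subset)
  also have "(\<lambda>x. indicator K x *\<^sub>R f x) = f" using assms(3) by (auto simp: indicator_def)
  finally show ?thesis .
qed

lemma lborel_integral_translate:
  fixes f :: "'a::euclidean_space \<Rightarrow> real"
  assumes [measurable]: "f \<in> borel_measurable borel"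
  shows "(\<integral>x. f (c + x) \<partial>lborel) = (\<integral>x. f x \<partial>lborel)"
proof -
  have "(\<integral>x. f x \<partial>lborel) = (\<integral>x. f x \<partial>distr lborel borel ((+) c))" by (simp add: lborel_distr_plus)
  also have "\<dots> = (\<integral>x. f (c + x) \<partial>lborel)" by (rule integral_distr) auto
  finally show ?thesis by simp
qed

lemma nn_integral_translate:
  fixes f :: "'a::euclidean_space \<Rightarrow> ennreal"
  assumes [measurable]: "f \<in> borel_measurable borel"
  shows "(\<integral>\<^sup>+x. f (c + x) \<partial>lborel) = (\<integral>\<^sup>+x. f x \<partial>lborel)"
proof -
  have "(\<integral>\<^sup>+x. f x \<partial>lborel) = (\<integral>\<^sup>+x. f x \<partial>distr lborel borel ((+) c))" by (simp add: lborel_distr_plus)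
  also have "\<dots> = (\<integral>\<^sup>+x. f (c + x) \<partial>lborel)" by (rule nn_integral_distr) auto
  finally show ?thesis by simp
qed

text \<open>
  The difference quotients in direction \<open>i\<close> have integral \<open>0\<close> by translation invariance, and they
  converge boundedly to the derivative.
\<close>

lemma integral_partial_derivative_eq_0:
  assumes f: "f \<in> test_fun \<Omega>"
  shows "(\<integral>x. grad f x \<bullet> i \<partial>lborel) = 0"
proof -
  obtain K where K: "compact K" "\<forall>x. x \<notin> K \<longrightarrow> f x = 0" using test_fun_support[OF f] by blast
  obtain L where L: "0 \<le> L" "\<And>x. norm (grad f x) \<le> L" using test_fun_bounded_grad[OF f] by blast
  obtain R where R: "K \<subseteq> ball 0 R" using compact_imp_bounded[OF K(1)] bounded_subset_ballD[of K 0] by blast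
  have fm [measurable]: "f \<in> borel_measurable borel"
    by (rule borel_measurable_continuous_onI[OF test_fun_continuous[OF f]])
  have gm [measurable]: "grad f \<in> borel_measurable borel"
    by (rule borel_measurable_continuous_onI[OF test_fun_grad_continuous[OF f]])
  have fi: "integrable lborel f"
    by (rule integrable_compact_support[OF test_fun_continuous[OF f] K(1)]) (use K(2) in auto)
  define t where "t n = 1 / real (Suc n)" for n
  have t: "t n > 0" "t n \<le> 1" for n by (auto simp: t_def)
  define q where "q n x = (f (t n *\<^sub>R i + x) - f x) / t n" for n x
  have "(\<lambda>n. \<integral>x. q n x \<partial>lborel) \<longlonglongrightarrow> (\<integral>x. grad f x \<bullet> i \<partial>lborel)"
  proof (rule integral_dominated_convergence[where w="\<lambda>x. (L * norm i) * indicator (cball 0 (R + norm i)) x"])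
    show "q n \<in> borel_measurable lborel" for n unfolding q_def[abs_def] by measurable
    show "integrable lborel (\<lambda>x::'a. L * norm i * indicat_real (cball 0 (R + norm i)) x)"
      using emeasure_lborel_cball_finite[of "0::'a" "R + norm i"]
      by (intro integrable_mult_right integrable_real_indicator) auto
    show "AE x in lborel. (\<lambda>n. q n x) \<longlonglongrightarrow> grad f x \<bullet> i"
    proof (rule AE_I2)
      fix x
      have l: "((\<lambda>r. x + r *\<^sub>R i) has_derivative (\<lambda>r. r *\<^sub>R i)) (at 0)"
        by (auto intro!: derivative_eq_intros)
      have "((\<lambda>r. f (x + r *\<^sub>R i)) has_derivative (\<lambda>r. grad f x \<bullet> (r *\<^sub>R i))) (at 0)"
        using has_derivative_compose[OF l, of f "\<lambda>h. grad f x \<bullet> h"]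
          has_derivative_grad[OF test_fun_differentiable[OF f], of x] by simp
      then have "((\<lambda>r. f (x + r *\<^sub>R i)) has_field_derivative (grad f x \<bullet> i)) (at 0)"
        unfolding has_field_derivative_def by (rule has_derivative_eq_rhs) (simp add: fun_eq_iff)
      then have d: "((\<lambda>h. (f (x + h *\<^sub>R i) - f x) / h) \<longlongrightarrow> grad f x \<bullet> i) (at 0)"
        by (simp add: DERIV_def)
      have "filterlim t (at 0) sequentially"
        using LIMSEQ_Suc[OF lim_1_over_n[where 'a=real]] t(1)
        by (simp add: filterlim_at t_def[abs_def] less_imp_neq[THEN not_sym])
      from filterlim_compose[OF d this] show "(\<lambda>n. q n x) \<longlonglongrightarrow> grad f x \<bullet> i"
        by (simp add: q_def add.commute)
    qed
    show "AE x in lborel. norm (q n x) \<le> L * norm i * indicat_real (cball 0 (R + norm i)) x" for n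
    proof (rule AE_I2)
      fix x
      show "norm (q n x) \<le> L * norm i * indicat_real (cball 0 (R + norm i)) x"
      proof (cases "x \<in> cball 0 (R + norm i)")
        case True
        have "\<bar>f (t n *\<^sub>R i + x) - f x\<bar> \<le> L * norm (t n *\<^sub>R i + x - x)" by (rule test_fun_lipschitz[OF f L(2)])
        also have "\<dots> = (L * norm i) * t n" using t[of n] by simp
        finally show ?thesis using True t[of n] by (simp add: q_def pos_divide_le_eq)
      next
        case False
        have n: "norm x > R + norm i" using False by simp
        have "norm (t n *\<^sub>R i) \<le> norm i" using t[of n] by (simp add: mult_left_le_one_le)
        then have "norm (t n *\<^sub>R i + x) > R"
          using n norm_triangle_ineq4[of "t n *\<^sub>R i + x" "t n *\<^sub>R i"] by simp
        then have "t n *\<^sub>R i + x \<notin> K" "x \<notin> K" using R n norm_ge_zero[of i] by (auto simp del: norm_ge_zero)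
        then show ?thesis using K(2) L(1) by (simp add: q_def)
      qed
    qed
  qed measurable
  moreover have "(\<integral>x. q n x \<partial>lborel) = 0" for n
  proof -
    have fi': "integrable lborel (\<lambda>x. f (t n *\<^sub>R i + x))"
    proof (rule integrable_compact_support)
      show "continuous_on UNIV (\<lambda>x. f (t n *\<^sub>R i + x))"
        by (intro continuous_on_compose2[OF test_fun_continuous[OF f]] continuous_intros) auto
      show "compact ((+) (- (t n *\<^sub>R i)) ` K)" by (rule compact_translation[OF K(1)])
      show "f (t n *\<^sub>R i + x) = 0" if "x \<notin> (+) (- (t n *\<^sub>R i)) ` K" for x
      proof -
        have "t n *\<^sub>R i + x \<notin> K" using that image_eqI[of x "(+) (- (t n *\<^sub>R i))" "t n *\<^sub>R i + x" K] by auto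
        then show ?thesis using K(2) by blast
      qed
    qed
    show ?thesis
      using fi fi' lborel_integral_translate[OF fm, of "t n *\<^sub>R i"]
      by (simp add: q_def Bochner_Integration.integral_diff)
  qed
  ultimately show ?thesis by (simp add: LIMSEQ_const_iff)
qed

lemma grad_mult:
  assumes "f differentiable (at x)" "g differentiable (at x)"
  shows "grad (\<lambda>x. f x * g x) x = f x *\<^sub>R grad g x + g x *\<^sub>R grad f x"
proof (rule grad_eqI)
  show "((\<lambda>x. f x * g x) has_derivative (\<bullet>) (f x *\<^sub>R grad g x + g x *\<^sub>R grad f x)) (at x)"
    by (rule has_derivative_eq_rhs[OF has_derivative_mult[OF has_derivative_grad[OF assms(1)] has_derivative_grad[OF assms(2)]]])
      (simp add: fun_eq_iff inner_add_left mult.commute)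
qed

lemma grad_compose:
  assumes "f differentiable (at x)" "(g has_real_derivative d) (at (f x))"
  shows "grad (\<lambda>x. g (f x)) x = d *\<^sub>R grad f x"
proof (rule grad_eqI)
  show "((\<lambda>x. g (f x)) has_derivative (\<bullet>) (d *\<^sub>R grad f x)) (at x)"
    by (rule has_derivative_eq_rhs[OF has_derivative_compose[OF has_derivative_grad[OF assms(1)]
          assms(2)[unfolded has_field_derivative_def]]]) (simp add: fun_eq_iff)
qed

lemma test_fun_integrable:
  assumes f: "f \<in> test_fun \<Omega>" and c: "continuous_on UNIV c"
  shows "integrable lebesgue (\<lambda>x. c x * f x :: real)"
proof -
  obtain K where K: "compact K" "\<forall>x. x \<notin> K \<longrightarrow> f x = 0" using test_fun_support[OF f] by blast
  have "integrable lborel (\<lambda>x. c x * f x)"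
    by (rule integrable_compact_support[OF _ K(1)])
      (use K(2) c test_fun_continuous[OF f] in \<open>auto intro!: continuous_intros\<close>)
  then show ?thesis
    using integrable_completion[of "\<lambda>x. c x * f x" lborel] borel_measurable_integrable by blast
qed

lemma test_fun_grad_integrable:
  assumes f: "f \<in> test_fun \<Omega>" and c: "continuous_on UNIV c"
  shows "integrable lebesgue (\<lambda>x. (grad f x \<bullet> i) * c x)"
proof -
  obtain K where K: "compact K" "\<forall>x. x \<notin> K \<longrightarrow> f x = 0" using test_fun_support[OF f] by blast
  have "integrable lborel (\<lambda>x. (grad f x \<bullet> i) * c x)"
    by (rule integrable_compact_support[OF _ K(1)])
      (use grad_eq_0_outside[OF K] c test_fun_grad_continuous[OF f] in \<open>auto intro!: continuous_intros\<close>)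
  then show ?thesis
    using integrable_completion[of "\<lambda>x. (grad f x \<bullet> i) * c x" lborel] borel_measurable_integrable by blast
qed

lemma integration_by_parts:
  assumes f: "f \<in> test_fun \<Omega>" and g: "g \<in> test_fun \<Omega>"
  shows "(\<integral>x. f x * (grad g x \<bullet> i) \<partial>lebesgue) = - (\<integral>x. (grad f x \<bullet> i) * g x \<partial>lebesgue)"
proof -
  note c = test_fun_continuous[OF f] test_fun_continuous[OF g]
  have eq: "grad (\<lambda>x. f x * g x) x \<bullet> i = f x * (grad g x \<bullet> i) + (grad f x \<bullet> i) * g x" for x
    using test_fun_differentiable[OF f] test_fun_differentiable[OF g]
    by (simp add: grad_mult inner_add_left)
  have i: "integrable lebesgue (\<lambda>x. f x * (grad g x \<bullet> i))" "integrable lebesgue (\<lambda>x. (grad f x \<bullet> i) * g x)"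
    using test_fun_grad_integrable[OF g c(1), of i] test_fun_grad_integrable[OF f c(2), of i]
    by (simp_all add: mult.commute)
  have fg: "(\<lambda>x. f x * g x) \<in> test_fun \<Omega>" by (rule test_fun_mult[OF f g])
  have gm: "(\<lambda>x. grad (\<lambda>x. f x * g x) x \<bullet> i) \<in> borel_measurable lborel"
    using borel_measurable_continuous_onI[OF test_fun_grad_continuous[OF fg]] by simp
  have "0 = (\<integral>x. grad (\<lambda>x. f x * g x) x \<bullet> i \<partial>lebesgue)"
    using integral_partial_derivative_eq_0[OF fg, of i] integral_completion[OF gm] by simp
  also have "\<dots> = (\<integral>x. f x * (grad g x \<bullet> i) \<partial>lebesgue) + (\<integral>x. (grad f x \<bullet> i) * g x \<partial>lebesgue)"
    unfolding eq by (rule Bochner_Integration.integral_add[OF i])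
  finally show ?thesis by simp
qed

lemma has_weak_gradient_test_fun:
  assumes f: "f \<in> test_fun \<Omega>"
  shows "has_weak_gradient \<Omega> f (grad f)"
  unfolding has_weak_gradient_def
proof (intro conjI allI ballI impI)
  fix K assume K: "compact K \<and> K \<subseteq> \<Omega>"
  have *: "integrable lborel (\<lambda>x. indicator K x *\<^sub>R h x)" if "continuous_on UNIV h" for h :: "'a \<Rightarrow> 'b::euclidean_space"
    using K that by (intro borel_integrable_compact) (auto intro: continuous_on_subset)
  show "set_integrable lebesgue K f"
    using integrable_completion[of "\<lambda>x. indicator K x *\<^sub>R f x" lborel] *[OF test_fun_continuous[OF f]]
      borel_measurable_integrable unfolding set_integrable_def by blast
  show "set_integrable lebesgue K (grad f)"
    using integrable_completion[of "\<lambda>x. indicator K x *\<^sub>R grad f x" lborel] *[OF test_fun_grad_continuous[OF f]]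
      borel_measurable_integrable unfolding set_integrable_def by blast
next
  fix g :: "'a \<Rightarrow> real" and i :: 'a
  assume g: "g \<in> test_fun \<Omega>" and i: "i \<in> Basis"
  have "(LINT x:\<Omega>|lebesgue. f x * frechet_derivative g (at x) i) = (\<integral>x. f x * (grad g x \<bullet> i) \<partial>lebesgue)"
    unfolding set_lebesgue_integral_def grad_inner_Basis[OF i]
    by (rule Bochner_Integration.integral_cong) (use fun_onD(2)[OF test_fun_fun_on[OF f]] in \<open>auto simp: indicator_def\<close>)
  also have "\<dots> = - (\<integral>x. (grad f x \<bullet> i) * g x \<partial>lebesgue)" by (rule integration_by_parts[OF f g])
  also have "(\<integral>x. (grad f x \<bullet> i) * g x \<partial>lebesgue) = (LINT x:\<Omega>|lebesgue. (grad f x \<bullet> i) * g x)"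
    unfolding set_lebesgue_integral_def
    by (rule Bochner_Integration.integral_cong) (use fun_onD(2)[OF test_fun_fun_on[OF g]] in \<open>auto simp: indicator_def\<close>)
  finally show "(LINT x:\<Omega>|lebesgue. f x * frechet_derivative g (at x) i) = - (LINT x:\<Omega>|lebesgue. (grad f x \<bullet> i) * g x)" .
qed

section \<open>Uniqueness of the weak gradient\<close>

lemma poly_bump_1_bounds: "0 \<le> poly_bump 1 t" "poly_bump 1 t \<le> 1" "t \<le> 0 \<Longrightarrow> poly_bump 1 t = 0"
  by (auto simp: poly_bump_def)

lemma poly_bump_1_tendsto:
  assumes "t > 0" shows "(\<lambda>m. poly_bump 1 (real m * t)) \<longlonglongrightarrow> 1"
proof (rule Lim_transform_eventually)
  have "(\<lambda>m. exp (- (1 / real m * (1 / t)))) \<longlonglongrightarrow> exp (- (0 * (1 / t)))"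
    by (intro tendsto_intros lim_1_over_n)
  then show "(\<lambda>m. exp (- (1 / real m * (1 / t)))) \<longlonglongrightarrow> 1" by simp
  show "\<forall>\<^sub>F m in sequentially. exp (- (1 / real m * (1 / t))) = poly_bump 1 (real m * t)"
    using eventually_gt_at_top[of "0::nat"]
    by (rule eventually_mono) (use assms in \<open>simp add: poly_bump_def\<close>)
qed

text \<open>
  Test functions that increase to the indicator of the open box between \<open>a\<close> and \<open>b\<close>.
\<close>

definition box_bump :: "'a::euclidean_space \<Rightarrow> 'a \<Rightarrow> nat \<Rightarrow> 'a \<Rightarrow> real" where
  "box_bump a b m x = (\<Prod>i\<in>Basis. poly_bump 1 (real m * (x \<bullet> i + - (a \<bullet> i))) * poly_bump 1 (real m * (b \<bullet> i - x \<bullet> i)))"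

lemma box_bump_outside:
  assumes "x \<notin> box a b" shows "box_bump a b m x = 0"
proof -
  obtain i where "i \<in> Basis" "\<not> (a \<bullet> i < x \<bullet> i \<and> x \<bullet> i < b \<bullet> i)" using assms by (auto simp: mem_box)
  then show ?thesis
    unfolding box_bump_def
    by (intro prod_zero bexI[of _ i])
      (auto simp: poly_bump_1_bounds mult_nonneg_nonpos not_less)
qed

lemma box_bump_bounds: "0 \<le> box_bump a b m x" "box_bump a b m x \<le> 1"
  unfolding box_bump_def
  by (auto intro!: prod_nonneg prod_le_1 mult_nonneg_nonneg mult_le_one simp: poly_bump_1_bounds)

lemma box_bump_tendsto: "(\<lambda>m. box_bump a b m x) \<longlonglongrightarrow> indicator (box a b) x"
proof (cases "x \<in> box a b")
  case True
  have "(\<lambda>m. box_bump a b m x) \<longlonglongrightarrow> (\<Prod>i\<in>(Basis::'a set). 1 * 1)"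
    unfolding box_bump_def
    by (intro tendsto_prod tendsto_mult poly_bump_1_tendsto) (use True in \<open>auto simp: mem_box\<close>)
  then show ?thesis using True by simp
next
  case False
  then show ?thesis by (simp add: box_bump_outside)
qed

lemma box_bump_test_fun:
  assumes "cbox a b \<subseteq> \<Omega>" shows "box_bump a b m \<in> test_fun \<Omega>"
proof (rule test_funI[OF _ compact_cbox assms])
  show "Ck_fun k (box_bump a b m)" for k
    unfolding box_bump_def[abs_def]
  proof (rule Ck_fun_prod)
    fix i :: 'a assume "i \<in> Basis"
    have 1: "Ck_fun k (\<lambda>x. poly_bump 1 (real m * (x \<bullet> i) + real m * (- (a \<bullet> i))))"
      by (rule Ck_fun_smooth_comp[OF smooth_affine_comp[OF smooth_poly_bump] Ck_fun_inner])
    have 2: "Ck_fun k (\<lambda>x. poly_bump 1 ((- real m) * (x \<bullet> i) + real m * (b \<bullet> i)))"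
      by (rule Ck_fun_smooth_comp[OF smooth_affine_comp[OF smooth_poly_bump] Ck_fun_inner])
    show "Ck_fun k (\<lambda>x. poly_bump 1 (real m * (x \<bullet> i + - (a \<bullet> i))) * poly_bump 1 (real m * (b \<bullet> i - x \<bullet> i)))"
      using Ck_fun_mult[OF 1 2] by (simp add: algebra_simps)
  qed simp
  show "box_bump a b m x = 0" if "x \<notin> cbox a b" for x
    using that box_subset_cbox[of a b] by (intro box_bump_outside) auto
qed

text \<open>
  The open boxes form an intersection-stable generator of the Borel sets, so a function whose integrals
  over all boxes vanish has vanishing integrals over all Borel sets.
\<close>

lemma AE_0_of_box_integrals:
  fixes g :: "'a::euclidean_space \<Rightarrow> real"
  assumes int: "set_integrable lebesgue (cbox a b) g"
    and zero: "\<And>c d. cbox c d \<subseteq> cbox a b \<Longrightarrow> (\<integral>x. indicator (box c d) x * g x \<partial>lebesgue) = 0"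
  shows "AE x in lebesgue. x \<in> box a b \<longrightarrow> g x = 0"
proof -
  let ?B = "box a b"
  have i0: "integrable lebesgue (\<lambda>x. indicator ?B x * g x)"
    using set_integrable_subset[OF int, of ?B] box_subset_cbox[of a b] by (simp add: set_integrable_def)
  \<comment> \<open>a Borel representative of \<open>g\<close> on the box\<close>
  obtain h where hm: "h \<in> borel_measurable lborel" and hAE: "AE x in lborel. indicator ?B x * g x = h x"
    using completion_ex_borel_measurable_real[OF borel_measurable_integrable[OF i0]] by blast
  have hm' [measurable]: "h \<in> borel_measurable borel" using hm by simp
  have AE: "AE x in lebesgue. h x = indicator ?B x * g x"
    using AE_completion[OF hAE] by (rule eventually_mono) simp
  have "integrable lebesgue h"
    by (rule integrable_cong_AE_imp[OF i0]) (use AE in \<open>auto intro: measurable_completion elim!: eventually_mono\<close>)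
  then have hi: "integrable lborel h" using integrable_completion[OF hm] by simp
  have key: "(\<integral>x. indicator (A \<inter> ?B) x * h x \<partial>lborel) = (\<integral>x. indicator (A \<inter> ?B) x * g x \<partial>lebesgue)"
    if "A \<in> sets borel" for A
  proof -
    have [measurable]: "A \<in> sets borel" by fact
    have m: "(\<lambda>x. indicator (A \<inter> ?B) x * h x) \<in> borel_measurable lborel" by simp
    have "(\<integral>x. indicator (A \<inter> ?B) x * h x \<partial>lborel) = (\<integral>x. indicator (A \<inter> ?B) x * h x \<partial>lebesgue)"
      by (rule integral_completion[OF m, symmetric])
    also have "\<dots> = (\<integral>x. indicator (A \<inter> ?B) x * (indicator ?B x * g x) \<partial>lebesgue)"
    proof (rule integral_cong_AE)
      show "(\<lambda>x. indicator (A \<inter> ?B) x * h x) \<in> borel_measurable lebesgue" by (rule measurable_completion[OF m])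
      have "(\<lambda>x. indicator (A \<inter> ?B) x :: real) \<in> borel_measurable lebesgue"
        by (rule measurable_completion) simp
      then show "(\<lambda>x. indicator (A \<inter> ?B) x * (indicator ?B x * g x)) \<in> borel_measurable lebesgue"
        by (rule borel_measurable_times[OF _ borel_measurable_integrable[OF i0]])
    qed (use AE in \<open>rule eventually_mono, simp\<close>)
    also have "\<dots> = (\<integral>x. indicator (A \<inter> ?B) x * g x \<partial>lebesgue)"
      by (rule Bochner_Integration.integral_cong) (auto simp: indicator_def)
    finally show ?thesis .
  qed
  have int_h: "integrable lborel (\<lambda>x. indicator A x * h x)" if "A \<in> sets borel" for A
    using integrable_mult_indicator[OF _ hi, of A] that by simp
  have zeroA: "(\<integral>x. indicator (A \<inter> ?B) x * h x \<partial>lborel) = 0" if "A \<in> sets borel" for A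
  proof -
    have "Int_stable (range (\<lambda>(a, b). box a b :: 'a set))"
      by (auto simp: Int_stable_def box_Int_box)
    moreover have "range (\<lambda>(a, b). box a b :: 'a set) \<subseteq> Pow UNIV" by auto
    moreover have "A \<in> sigma_sets UNIV (range (\<lambda>(a, b). box a b))"
      using that unfolding borel_eq_box by simp
    ultimately show ?thesis
    proof (induction rule: sigma_sets_induct_disjoint)
      case (basic A)
      then obtain c d where A: "A = box c d" by auto
      let ?c = "\<Sum>i\<in>Basis. max (c \<bullet> i) (a \<bullet> i) *\<^sub>R i" and ?d = "\<Sum>i\<in>Basis. min (d \<bullet> i) (b \<bullet> i) *\<^sub>R i"
      have eq: "A \<inter> ?B = box ?c ?d" unfolding A by (rule box_Int_box)
      have "cbox ?c ?d \<subseteq> cbox a b" by (auto simp: mem_box)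
      from zero[OF this] show ?case using key[of A] A eq by simp
    next
      case empty
      then show ?case by simp
    next
      case (compl A)
      then have Am: "A \<in> sets borel" by (simp add: borel_eq_box)
      have "(\<integral>x. indicator ((UNIV - A) \<inter> ?B) x * h x \<partial>lborel)
          = (\<integral>x. indicator ?B x * h x - indicator (A \<inter> ?B) x * h x \<partial>lborel)"
        by (rule Bochner_Integration.integral_cong) (auto simp: indicator_def)
      also have "\<dots> = (\<integral>x. indicator ?B x * h x \<partial>lborel) - (\<integral>x. indicator (A \<inter> ?B) x * h x \<partial>lborel)"
        by (intro Bochner_Integration.integral_diff int_h) (use Am in auto)
      also have "(\<integral>x. indicator ?B x * h x \<partial>lborel) = 0"
        using key[of UNIV] zero[of a b] by simp
      finally show ?case using compl by simp
    next
      case (union A)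
      then have Am: "A i \<in> sets borel" for i by (auto simp: borel_eq_box subset_eq)
      have "(\<integral>x\<in>(\<Union>i. A i \<inter> ?B). h x \<partial>lborel) = (\<Sum>i. (\<integral>x\<in>(A i \<inter> ?B). h x \<partial>lborel))"
      proof (rule lebesgue_integral_countable_add)
        show "set_integrable lborel (\<Union>i. A i \<inter> ?B) h"
          using int_h[of "\<Union>i. A i \<inter> ?B"] Am by (simp add: set_integrable_def sets.countable_UN)
      qed (use Am union(1) in \<open>auto simp: disjoint_family_on_def\<close>)
      then show ?case using union(3) by (simp add: set_lebesgue_integral_def)
    qed
  qed
  have "AE x in lborel. h x = 0"
  proof (rule density_unique_real[OF hi])
    fix A :: "'a set" assume "A \<in> sets lborel"
    then have A: "A \<in> sets borel" by simp
    have [measurable]: "A \<in> sets borel" by fact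
    have "set_lebesgue_integral lborel A h = (\<integral>x. indicator (A \<inter> ?B) x * h x \<partial>lborel)"
      unfolding set_lebesgue_integral_def
    proof (rule integral_cong_AE)
      show "AE x in lborel. indicat_real A x *\<^sub>R h x = indicat_real (A \<inter> ?B) x * h x"
        using hAE by (rule eventually_mono) (auto simp: indicator_def split: if_splits)
    qed measurable
    then show "set_lebesgue_integral lborel A h = set_lebesgue_integral lborel A (\<lambda>x. 0)"
      using zeroA[OF A] by (simp add: set_lebesgue_integral_def)
  qed simp
  from AE_completion[OF this] AE show ?thesis
    by eventually_elim (auto simp: indicator_def)
qed

lemma has_weak_gradient_diff:
  assumes "has_weak_gradient \<Omega> u G" "has_weak_gradient \<Omega> v H" and \<Omega>: "open \<Omega>"
  shows "has_weak_gradient \<Omega> (\<lambda>x. u x - v x) (\<lambda>x. G x - H x)"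
proof -
  have loc: "set_integrable lebesgue K u" "set_integrable lebesgue K v"
      "set_integrable lebesgue K G" "set_integrable lebesgue K H" if "compact K" "K \<subseteq> \<Omega>" for K
    using assms that unfolding has_weak_gradient_def by blast+
  have int: "set_integrable lebesgue \<Omega> (\<lambda>x. w x * c x)"
    if w: "\<And>K. compact K \<Longrightarrow> K \<subseteq> \<Omega> \<Longrightarrow> set_integrable lebesgue K w"
      and c: "continuous_on UNIV c" and K: "compact K" "K \<subseteq> \<Omega>" "\<forall>x. x \<notin> K \<longrightarrow> c x = 0"
    for w c :: "'a \<Rightarrow> real" and K
  proof -
    have "compact (c ` K)" using c K(1) by (intro compact_continuous_image) (auto intro: continuous_on_subset)
    then obtain L where L: "\<And>x. x \<in> K \<Longrightarrow> \<bar>c x\<bar> \<le> L"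
      using compact_imp_bounded[of "c ` K"] unfolding bounded_iff by auto
    have "integrable lebesgue (\<lambda>x. L * norm (indicator K x *\<^sub>R w x))"
      using w[OF K(1,2)] unfolding set_integrable_def by (intro integrable_mult_right integrable_norm)
    then have "integrable lebesgue (\<lambda>x. indicator \<Omega> x *\<^sub>R (w x * c x))"
    proof (rule Bochner_Integration.integrable_bound)
      have "(\<lambda>x. indicator \<Omega> x *\<^sub>R (w x * c x)) = (\<lambda>x. (indicator K x *\<^sub>R w x) * c x)"
        using K by (auto simp: indicator_def fun_eq_iff)
      moreover have "(\<lambda>x. (indicator K x *\<^sub>R w x) * c x) \<in> borel_measurable lebesgue"
        using w[OF K(1,2)] continuous_lebesgue_measurable[OF c] unfolding set_integrable_def
        by (intro borel_measurable_times[OF borel_measurable_integrable])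
      ultimately show "(\<lambda>x. indicator \<Omega> x *\<^sub>R (w x * c x)) \<in> borel_measurable lebesgue" by simp
      show "AE x in lebesgue. norm (indicator \<Omega> x *\<^sub>R (w x * c x)) \<le> norm (L * norm (indicator K x *\<^sub>R w x))"
      proof (rule AE_I2)
        fix x
        show "norm (indicator \<Omega> x *\<^sub>R (w x * c x)) \<le> norm (L * norm (indicator K x *\<^sub>R w x))"
        proof (cases "x \<in> K")
          case True
          then show ?thesis using L[OF True] K(2) mult_right_mono[of "\<bar>c x\<bar>" "\<bar>L\<bar>" "\<bar>w x\<bar>"]
            by (auto simp: abs_mult mult.commute)
        qed (use K(3) in simp)
      qed
    qed
    then show ?thesis by (simp add: set_integrable_def)
  qed
  show ?thesis
    unfolding has_weak_gradient_def
  proof (intro conjI allI ballI impI)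
    fix K assume K: "compact K \<and> K \<subseteq> \<Omega>"
    then show "set_integrable lebesgue K (\<lambda>x. u x - v x)" "set_integrable lebesgue K (\<lambda>x. G x - H x)"
      by (simp_all add: loc set_integral_diff)
  next
    fix f :: "'a \<Rightarrow> real" and i :: 'a
    assume f: "f \<in> test_fun \<Omega>" and i: "i \<in> Basis"
    obtain K where K: "compact K" "K \<subseteq> \<Omega>" "\<forall>x. x \<notin> K \<longrightarrow> f x = 0" using test_fun_support[OF f] by blast
    let ?d = "\<lambda>x. frechet_derivative f (at x) i"
    have d: "?d = (\<lambda>x. grad f x \<bullet> i)" using i by (simp add: grad_inner_Basis)
    have dc: "continuous_on UNIV ?d"
      unfolding d by (intro continuous_intros test_fun_grad_continuous[OF f])
    have d0: "\<forall>x. x \<notin> K \<longrightarrow> ?d x = 0" 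
      using grad_eq_0_outside[OF K(1,3)] by (simp add: grad_inner_Basis[OF i, symmetric])
    have Gi: "set_integrable lebesgue K (\<lambda>x. G x \<bullet> i)" "set_integrable lebesgue K (\<lambda>x. H x \<bullet> i)"
      if "compact K" "K \<subseteq> \<Omega>" for K
      using loc(3,4)[OF that] integrable_inner_left[of i lebesgue "\<lambda>x. indicator K x *\<^sub>R G x"]
        integrable_inner_left[of i lebesgue "\<lambda>x. indicator K x *\<^sub>R H x"] by (auto simp: set_integrable_def)
    note fc = test_fun_continuous[OF f]
    have "(LINT x:\<Omega>|lebesgue. (u x - v x) * ?d x) = (LINT x:\<Omega>|lebesgue. u x * ?d x) - (LINT x:\<Omega>|lebesgue. v x * ?d x)"
      using set_integral_diff(2)[OF int[OF loc(1) dc K(1,2) d0] int[OF loc(2) dc K(1,2) d0]]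
      by (simp add: left_diff_distrib)
    also have "\<dots> = - ((LINT x:\<Omega>|lebesgue. (G x \<bullet> i) * f x) - (LINT x:\<Omega>|lebesgue. (H x \<bullet> i) * f x))"
      using assms(1,2) f i unfolding has_weak_gradient_def by simp
    also have "(LINT x:\<Omega>|lebesgue. (G x \<bullet> i) * f x) - (LINT x:\<Omega>|lebesgue. (H x \<bullet> i) * f x)
        = (LINT x:\<Omega>|lebesgue. ((G x - H x) \<bullet> i) * f x)"
      using set_integral_diff(2)[OF int[OF Gi(1) fc K] int[OF Gi(2) fc K]]
      by (simp add: left_diff_distrib inner_diff_left)
    finally show "(LINT x:\<Omega>|lebesgue. (u x - v x) * ?d x) = - (LINT x:\<Omega>|lebesgue. ((G x - H x) \<bullet> i) * f x)" .
  qed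
qed

text \<open>
  The fundamental lemma of the calculus of variations, for the components of a weak gradient of \<open>0\<close>.
\<close>

lemma weak_gradient_zero_unique:
  fixes u :: "'a::euclidean_space \<Rightarrow> real"
  assumes \<Omega>: "open \<Omega>" and G: "has_weak_gradient \<Omega> (\<lambda>x. 0 :: real) G"
  shows "AE x in lebesgue. x \<in> \<Omega> \<longrightarrow> G x = 0"
proof -
  have cboxAE: "AE x in lebesgue. x \<in> cbox a b \<longrightarrow> G x = 0" if ab: "cbox a b \<subseteq> \<Omega>" for a b
  proof -
    have loc: "set_integrable lebesgue K G" if "compact K" "K \<subseteq> \<Omega>" for K
      using G that unfolding has_weak_gradient_def by blast
    have comp: "AE x in lebesgue. x \<in> box a b \<longrightarrow> G x \<bullet> i = 0" if i: "i \<in> Basis" for i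
    proof (rule AE_0_of_box_integrals)
      show "set_integrable lebesgue (cbox a b) (\<lambda>x. G x \<bullet> i)"
        using loc[OF compact_cbox ab] integrable_inner_left[of i lebesgue "\<lambda>x. indicator (cbox a b) x *\<^sub>R G x"]
        by (auto simp: set_integrable_def)
      fix c d assume cd: "cbox c d \<subseteq> cbox a b"
      have cd\<Omega>: "cbox c d \<subseteq> \<Omega>" using cd ab by blast
      have ig: "integrable lebesgue (\<lambda>x. indicator (cbox c d) x * (G x \<bullet> i))"
        using loc[OF compact_cbox cd\<Omega>] integrable_inner_left[of i lebesgue "\<lambda>x. indicator (cbox c d) x *\<^sub>R G x"]
        by (auto simp: set_integrable_def)
      have "(\<integral>x. box_bump c d m x * (indicator (cbox c d) x * (G x \<bullet> i)) \<partial>lebesgue) = 0" for m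
      proof -
        have "(\<integral>x. box_bump c d m x * (indicator (cbox c d) x * (G x \<bullet> i)) \<partial>lebesgue)
            = (LINT x:\<Omega>|lebesgue. (G x \<bullet> i) * box_bump c d m x)"
          unfolding set_lebesgue_integral_def
        proof (rule Bochner_Integration.integral_cong)
          fix x
          show "box_bump c d m x * (indicator (cbox c d) x * (G x \<bullet> i)) = indicator \<Omega> x *\<^sub>R ((G x \<bullet> i) * box_bump c d m x)"
          proof (cases "x \<in> box c d")
            case True
            then show ?thesis using cd\<Omega> box_subset_cbox[of c d] by (auto simp: indicator_def)
          next
            case False
            then show ?thesis by (simp add: box_bump_outside)
          qed
        qed simp
        also have "\<dots> = 0"
          using G box_bump_test_fun[OF cd\<Omega>, of m] i unfolding has_weak_gradient_def by (simp add: set_lebesgue_integral_def)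
        finally show ?thesis .
      qed
      moreover have "(\<lambda>m. \<integral>x. box_bump c d m x * (indicator (cbox c d) x * (G x \<bullet> i)) \<partial>lebesgue)
          \<longlonglongrightarrow> (\<integral>x. indicator (box c d) x * (indicator (cbox c d) x * (G x \<bullet> i)) \<partial>lebesgue)"
      proof (rule integral_dominated_convergence[where w="\<lambda>x. norm (indicator (cbox c d) x * (G x \<bullet> i))"])
        have b: "(\<lambda>x. indicator (box c d) x :: real) \<in> borel_measurable lebesgue"
          by (rule measurable_completion) simp
        show "(\<lambda>x. indicator (box c d) x * (indicator (cbox c d) x * (G x \<bullet> i))) \<in> borel_measurable lebesgue"
          by (rule borel_measurable_times[OF b borel_measurable_integrable[OF ig]])
        show "(\<lambda>x. box_bump c d m x * (indicator (cbox c d) x * (G x \<bullet> i))) \<in> borel_measurable lebesgue" for m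
          by (rule borel_measurable_times[OF fun_onD(1)[OF test_fun_fun_on[OF box_bump_test_fun[OF cd\<Omega>]]]
                borel_measurable_integrable[OF ig]])
        show "integrable lebesgue (\<lambda>x. norm (indicator (cbox c d) x * (G x \<bullet> i)))" using ig by (rule integrable_norm)
        show "AE x in lebesgue. (\<lambda>m. box_bump c d m x * (indicator (cbox c d) x * (G x \<bullet> i)))
            \<longlonglongrightarrow> indicator (box c d) x * (indicator (cbox c d) x * (G x \<bullet> i))"
          by (intro AE_I2 tendsto_mult box_bump_tendsto tendsto_const)
        show "AE x in lebesgue. norm (box_bump c d m x * (indicator (cbox c d) x * (G x \<bullet> i)))
            \<le> norm (indicator (cbox c d) x * (G x \<bullet> i))" for m
          using box_bump_bounds[of c d m] by (auto simp: abs_mult intro!: mult_left_le_one_le)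
      qed
      ultimately have "(\<integral>x. indicator (box c d) x * (indicator (cbox c d) x * (G x \<bullet> i)) \<partial>lebesgue) = 0"
        by (simp add: LIMSEQ_const_iff)
      moreover have "(\<lambda>x. indicator (box c d) x * (indicator (cbox c d) x * (G x \<bullet> i))) = (\<lambda>x. indicator (box c d) x * (G x \<bullet> i))"
        using box_subset_cbox[of c d] by (auto simp: indicator_def fun_eq_iff)
      ultimately show "(\<integral>x. indicator (box c d) x * (G x \<bullet> i) \<partial>lebesgue) = 0" by simp
    qed
    have "AE x in lebesgue. \<forall>i\<in>Basis. x \<in> box a b \<longrightarrow> G x \<bullet> i = 0"
      by (rule AE_finite_allI[OF finite_Basis comp])
    moreover have "AE x in lebesgue. x \<notin> cbox a b - box a b"
      using negligible_frontier_interval[of a b] by (intro AE_not_in) (simp add: negligible_iff_null_sets)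
    ultimately show ?thesis
    proof eventually_elim
      case (elim x)
      show ?case
      proof
        assume "x \<in> cbox a b"
        then have "\<forall>i\<in>Basis. G x \<bullet> i = 0" using elim by blast
        then show "G x = 0" by (simp add: euclidean_all_zero_iff)
      qed
    qed
  qed
  obtain D where D: "countable D" "D \<subseteq> Pow \<Omega>" "\<And>X. X \<in> D \<Longrightarrow> \<exists>a b. X = cbox a b" "\<Union>D = \<Omega>"
    using open_countable_Union_open_cbox[OF \<Omega>] by metis
  have "AE x in lebesgue. \<forall>X\<in>D. x \<in> X \<longrightarrow> G x = 0"
  proof (rule AE_ball_countable[THEN iffD2, OF D(1)], rule ballI)
    fix X assume "X \<in> D"
    then show "AE x in lebesgue. x \<in> X \<longrightarrow> G x = 0" using D(2,3) cboxAE by blast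
  qed
  then show ?thesis by (rule eventually_mono) (use D(4) in blast)
qed

lemma weak_gradient_unique:
  assumes \<Omega>: "open \<Omega>" and "has_weak_gradient \<Omega> u G" "has_weak_gradient \<Omega> u H"
  shows "AE x in lebesgue. x \<in> \<Omega> \<longrightarrow> G x = H x"
proof -
  have "has_weak_gradient \<Omega> (\<lambda>x. 0) (\<lambda>x. G x - H x)"
    using has_weak_gradient_diff[OF assms(2,3) \<Omega>] by simp
  from weak_gradient_zero_unique[OF \<Omega> this] show ?thesis by (rule eventually_mono) simp
qed

section \<open>The first-order space\<close>

text \<open>
  The squared \<open>L2\<close> norm of a vector field on \<open>\<Omega>\<close>.
\<close>

definition grad_sq :: "'a::euclidean_space set \<Rightarrow> ('a \<Rightarrow> 'a) \<Rightarrow> ennreal" where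
  "grad_sq \<Omega> G = (\<integral>\<^sup>+x\<in>\<Omega>. ennreal ((norm (G x))\<^sup>2) \<partial>lebesgue)"

lemma grad_sq_cong_AE:
  assumes "AE x in lebesgue. x \<in> \<Omega> \<longrightarrow> G x = H x"
  shows "grad_sq \<Omega> G = grad_sq \<Omega> H"
  unfolding grad_sq_def
proof (rule nn_integral_cong_AE)
  show "AE x in lebesgue. ennreal ((norm (G x))\<^sup>2) * indicator \<Omega> x = ennreal ((norm (H x))\<^sup>2) * indicator \<Omega> x"
    using assms by (rule eventually_mono) (auto simp: indicator_def)
qed

lemma grad_sq_mono:
  assumes "\<And>x. x \<in> \<Omega> \<Longrightarrow> norm (G x) \<le> norm (H x)"
  shows "grad_sq \<Omega> G \<le> grad_sq \<Omega> H"
  unfolding grad_sq_def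
  by (rule nn_integral_mono) (use assms in \<open>auto simp: indicator_def intro!: ennreal_leI power_mono\<close>)

lemma norm_square_measurable:
  fixes G :: "'a::euclidean_space \<Rightarrow> 'b::euclidean_space"
  assumes m: "(\<lambda>x. indicator \<Omega> x *\<^sub>R G x) \<in> borel_measurable lebesgue"
  shows "(\<lambda>x. ennreal ((norm (G x))\<^sup>2) * indicator \<Omega> x) \<in> borel_measurable lebesgue"
proof -
  have "(\<lambda>x. ennreal ((norm (indicator \<Omega> x *\<^sub>R G x))\<^sup>2)) \<in> borel_measurable lebesgue"
    by (intro measurable_compose[OF _ measurable_ennreal] borel_measurable_power measurable_compose[OF m borel_measurable_norm])
  moreover have "(\<lambda>x. ennreal ((norm (indicator \<Omega> x *\<^sub>R G x))\<^sup>2)) = (\<lambda>x. ennreal ((norm (G x))\<^sup>2) * indicator \<Omega> x)"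
    by (auto simp: indicator_def fun_eq_iff)
  ultimately show ?thesis by (simp only:)
qed

lemma indicator_diff_grad_measurable:
  assumes m: "(\<lambda>x. indicator \<Omega> x *\<^sub>R G x) \<in> borel_measurable lebesgue"
    and \<Omega>: "\<Omega> \<in> sets lebesgue" and f: "f \<in> test_fun \<Omega>'"
  shows "(\<lambda>x. indicator \<Omega> x *\<^sub>R (G x - grad f x)) \<in> borel_measurable lebesgue"
  unfolding scaleR_diff_right
  by (intro borel_measurable_diff m borel_measurable_scaleR borel_measurable_indicator \<Omega>
      continuous_lebesgue_measurable[OF test_fun_grad_continuous[OF f]])

lemma weak_gradient_measurable:
  assumes \<Omega>: "open \<Omega>" and G: "has_weak_gradient \<Omega> u G"
  shows "(\<lambda>x. indicator \<Omega> x *\<^sub>R G x) \<in> borel_measurable lebesgue"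
proof (rule open_Union_compact_subsets[OF \<Omega>])
  fix C
  assume C: "\<And>n. compact (C n)" "\<And>n. C n \<subseteq> \<Omega>" "\<And>n. C n \<subseteq> interior (C (Suc n))" "\<Union>(range C) = \<Omega>"
    "\<And>K. \<lbrakk>compact K; K \<subseteq> \<Omega>\<rbrakk> \<Longrightarrow> \<exists>N. \<forall>n\<ge>N. K \<subseteq> C n"
  show ?thesis
  proof (rule borel_measurable_LIMSEQ_metric)
    show "(\<lambda>x. indicator (C n) x *\<^sub>R G x) \<in> borel_measurable lebesgue" for n
      using G C(1,2)[of n] unfolding has_weak_gradient_def set_integrable_def
      by (intro borel_measurable_integrable) blast
    show "(\<lambda>n. indicator (C n) x *\<^sub>R G x) \<longlonglongrightarrow> indicator \<Omega> x *\<^sub>R G x" for x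
    proof (cases "x \<in> \<Omega>")
      case True
      obtain N where N: "\<And>n. n \<ge> N \<Longrightarrow> x \<in> C n" using C(5)[of "{x}"] True by auto
      show ?thesis
        by (rule tendsto_eventually) (use N True in \<open>auto simp: eventually_sequentially intro!: exI[of _ N]\<close>)
    next
      case False
      then have "x \<notin> C n" for n using C(2) by blast
      then show ?thesis using False by simp
    qed
  qed
qed

lemma weak_grad_AE_eq:
  assumes \<Omega>: "open \<Omega>" and G: "has_weak_gradient \<Omega> u G"
  shows "AE x in lebesgue. x \<in> \<Omega> \<longrightarrow> weak_grad \<Omega> u x = G x"
proof -
  have "has_weak_gradient \<Omega> u (weak_grad \<Omega> u)"
    unfolding weak_grad_def by (rule someI[where P="has_weak_gradient \<Omega> u", OF G])
  from weak_gradient_unique[OF \<Omega> this G] show ?thesis .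
qed

lemma grad_seminorm_eq:
  assumes \<Omega>: "open \<Omega>" and G: "has_weak_gradient \<Omega> u G"
  shows "grad_seminorm \<Omega> u = enn_sqrt (grad_sq \<Omega> G)"
proof -
  have "grad_seminorm \<Omega> u = enn_sqrt (grad_sq \<Omega> (weak_grad \<Omega> u))"
    using G unfolding grad_seminorm_def grad_sq_def by auto
  also have "grad_sq \<Omega> (weak_grad \<Omega> u) = grad_sq \<Omega> G"
    by (rule grad_sq_cong_AE[OF weak_grad_AE_eq[OF assms]])
  finally show ?thesis .
qed

text \<open>
  Membership in terms of an arbitrary weak gradient \<open>G\<close>.  The closure is taken in a norm that involves the
  chosen weak gradient of each difference \<open>u - f n\<close>; by uniqueness that is \<open>G - grad (f n)\<close>.
\<close>

lemma Y_space_iff: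
  assumes \<Omega>: "open \<Omega>"
  shows "u \<in> Y_space \<Omega> \<longleftrightarrow> u \<in> fun_on \<Omega> \<and> sq_integral u < \<infinity> \<and>
    (\<exists>G. has_weak_gradient \<Omega> u G \<and> grad_sq \<Omega> G < \<infinity> \<and>
      (\<exists>f. (\<forall>n. f n \<in> test_fun \<Omega>) \<and> (\<lambda>n. sq_integral (\<lambda>x. u x - f n x)) \<longlonglongrightarrow> 0 \<and>
       (\<lambda>n. grad_sq \<Omega> (\<lambda>x. G x - grad (f n) x)) \<longlonglongrightarrow> 0))" (is "_ \<longleftrightarrow> ?R")
proof (cases "u \<in> fun_on \<Omega> \<and> (\<exists>G. has_weak_gradient \<Omega> u G)")
  case True
  then have u: "u \<in> fun_on \<Omega>" by blast
  have eq1: "Y_norm \<Omega> u = enn_sqrt (sq_integral u) + enn_sqrt (grad_sq \<Omega> G)" if "has_weak_gradient \<Omega> u G" for G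
    using that u by (simp add: Y_norm_def L2_seminorm_eq grad_seminorm_eq[OF \<Omega>])
  have eq2: "Y_norm \<Omega> (\<lambda>x. u x - f x) =
      enn_sqrt (sq_integral (\<lambda>x. u x - f x)) + enn_sqrt (grad_sq \<Omega> (\<lambda>x. G x - grad f x))"
    if "has_weak_gradient \<Omega> u G" "f \<in> test_fun \<Omega>" for G f
    unfolding Y_norm_def
    by (simp only: L2_seminorm_eq[OF fun_on_diff[OF u test_fun_fun_on[OF that(2)]]]
        grad_seminorm_eq[OF \<Omega> has_weak_gradient_diff[OF that(1) has_weak_gradient_test_fun[OF that(2)] \<Omega>]])
  have conv: "(\<lambda>n. Y_norm \<Omega> (\<lambda>x. u x - f n x)) \<longlonglongrightarrow> 0 \<longleftrightarrow>
      (\<lambda>n. sq_integral (\<lambda>x. u x - f n x)) \<longlonglongrightarrow> 0 \<and> (\<lambda>n. grad_sq \<Omega> (\<lambda>x. G x - grad (f n) x)) \<longlonglongrightarrow> 0"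
    if "has_weak_gradient \<Omega> u G" "\<forall>n. f n \<in> test_fun \<Omega>" for G f
  proof -
    have "Y_norm \<Omega> (\<lambda>x. u x - f n x) =
      enn_sqrt (sq_integral (\<lambda>x. u x - f n x)) + enn_sqrt (grad_sq \<Omega> (\<lambda>x. G x - grad (f n) x))" for n
      using eq2[OF that(1)] that(2) by blast
    then show ?thesis by (simp add: ennreal_add_tendsto_0_iff enn_sqrt_tendsto_0_iff)
  qed
  have fin: "Y_norm \<Omega> u < \<infinity> \<longleftrightarrow> sq_integral u < \<infinity> \<and> grad_sq \<Omega> G < \<infinity>" if "has_weak_gradient \<Omega> u G" for G
    using enn_sqrt_less_top_iff by (simp add: eq1[OF that])
  show ?thesis
  proof
    assume "u \<in> Y_space \<Omega>"
    then obtain f where f: "Y_norm \<Omega> u < \<infinity>" "\<forall>n. f n \<in> test_fun \<Omega>" "(\<lambda>n. Y_norm \<Omega> (\<lambda>x. u x - f n x)) \<longlonglongrightarrow> 0"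
      unfolding Y_space_def test_closure_def by blast
    obtain G where G: "has_weak_gradient \<Omega> u G" using True by blast
    show "?R"
      using u G f(1,2) conv[OF G f(2)] f(3) fin[OF G] by blast
  next
    assume "?R"
    then obtain G f where *: "sq_integral u < \<infinity>" "has_weak_gradient \<Omega> u G" "grad_sq \<Omega> G < \<infinity>"
      "\<forall>n. f n \<in> test_fun \<Omega>" "(\<lambda>n. sq_integral (\<lambda>x. u x - f n x)) \<longlonglongrightarrow> 0"
      "(\<lambda>n. grad_sq \<Omega> (\<lambda>x. G x - grad (f n) x)) \<longlonglongrightarrow> 0" by blast
    show "u \<in> Y_space \<Omega>"
      unfolding Y_space_def test_closure_def using u * conv[OF *(2,4)] fin[OF *(2)] by blast
  qed
next
  case False
  have "Y_norm \<Omega> u = \<infinity>" if "\<nexists>G. has_weak_gradient \<Omega> u G"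
    using that by (simp add: Y_norm_def grad_seminorm_def)
  then have "u \<notin> Y_space \<Omega>" using False unfolding Y_space_def test_closure_def by auto
  then show ?thesis using False by blast
qed

lemma L2_mult_integrable:
  fixes f g :: "'b \<Rightarrow> real"
  assumes [measurable]: "f \<in> borel_measurable M" "g \<in> borel_measurable M"
    and "(\<integral>\<^sup>+x. ennreal ((f x)\<^sup>2) \<partial>M) < \<infinity>" "(\<integral>\<^sup>+x. ennreal ((g x)\<^sup>2) \<partial>M) < \<infinity>"
  shows "integrable M (\<lambda>x. f x * g x)"
proof (rule Bochner_Integration.integrable_bound)
  have "integrable M (\<lambda>x. (f x)\<^sup>2)" "integrable M (\<lambda>x. (g x)\<^sup>2)"
    using assms(3,4) by (auto intro!: integrableI_bounded)
  then show "integrable M (\<lambda>x. (f x)\<^sup>2 + (g x)\<^sup>2)" by simp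
  show "AE x in M. norm (f x * g x) \<le> norm ((f x)\<^sup>2 + (g x)\<^sup>2)"
  proof (rule AE_I2)
    fix x
    have "2 * \<bar>f x\<bar> * \<bar>g x\<bar> \<le> (f x)\<^sup>2 + (g x)\<^sup>2"
      using sum_squares_bound[of "\<bar>f x\<bar>" "\<bar>g x\<bar>"] by simp
    moreover have "0 \<le> \<bar>f x\<bar> * \<bar>g x\<bar>" by simp
    ultimately have "\<bar>f x\<bar> * \<bar>g x\<bar> \<le> (f x)\<^sup>2 + (g x)\<^sup>2" by linarith
    then show "norm (f x * g x) \<le> norm ((f x)\<^sup>2 + (g x)\<^sup>2)"
      by (simp add: abs_mult)
  qed
qed simp

lemma L2_set_integrable_compact:
  fixes f :: "'a::euclidean_space \<Rightarrow> 'b::euclidean_space"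
  assumes K: "compact K" and m: "(\<lambda>x. indicator K x *\<^sub>R f x) \<in> borel_measurable lebesgue"
    and fin: "(\<integral>\<^sup>+x\<in>K. ennreal ((norm (f x))\<^sup>2) \<partial>lebesgue) < \<infinity>"
  shows "set_integrable lebesgue K f"
  unfolding set_integrable_def
proof (rule integrableI_bounded[OF m])
  have Km: "K \<in> sets lebesgue" using K by (simp add: borel_compact)
  note nm = norm_square_measurable[OF m]
  have "(\<integral>\<^sup>+x. ennreal (norm (indicator K x *\<^sub>R f x)) \<partial>lebesgue)
      \<le> (\<integral>\<^sup>+x. indicator K x + ennreal ((norm (f x))\<^sup>2) * indicator K x \<partial>lebesgue)"
  proof (rule nn_integral_mono)
    fix x
    have "2 * norm (f x) \<le> 1 + (norm (f x))\<^sup>2"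
      using sum_squares_bound[of "norm (f x)" 1] by simp
    then have "norm (f x) \<le> 1 + (norm (f x))\<^sup>2" using norm_ge_zero[of "f x"] by linarith
    then have "ennreal (norm (f x)) \<le> ennreal 1 + ennreal ((norm (f x))\<^sup>2)"
      using ennreal_leI[of "norm (f x)" "1 + (norm (f x))\<^sup>2"] ennreal_plus[of 1 "(norm (f x))\<^sup>2"] by simp
    then show "ennreal (norm (indicator K x *\<^sub>R f x)) \<le> indicator K x + ennreal ((norm (f x))\<^sup>2) * indicator K x"
      by (auto simp: indicator_def)
  qed
  also have "\<dots> = emeasure lebesgue K + (\<integral>\<^sup>+x\<in>K. ennreal ((norm (f x))\<^sup>2) \<partial>lebesgue)"
    using Km nm by (subst nn_integral_add) auto
  also have "\<dots> < \<infinity>"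
    using fin emeasure_compact_finite[OF K] K by (simp add: borel_compact)
  finally show "(\<integral>\<^sup>+x. ennreal (norm (indicator K x *\<^sub>R f x)) \<partial>lebesgue) < \<infinity>" .
qed

lemma test_fun_L2:
  assumes f: "f \<in> test_fun \<Omega>"
  shows "(\<integral>\<^sup>+x. ennreal ((f x)\<^sup>2) \<partial>lebesgue) < \<infinity>" "(\<integral>\<^sup>+x. ennreal ((grad f x \<bullet> i)\<^sup>2) \<partial>lebesgue) < \<infinity>"
proof -
  have "integrable lebesgue (\<lambda>x. f x * f x)" by (rule test_fun_integrable[OF f test_fun_continuous[OF f]])
  then show "(\<integral>\<^sup>+x. ennreal ((f x)\<^sup>2) \<partial>lebesgue) < \<infinity>"
    by (simp add: power2_eq_square integrable_iff_bounded)
  have "continuous_on UNIV (\<lambda>x. grad f x \<bullet> i)" by (intro continuous_intros test_fun_grad_continuous[OF f])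
  from test_fun_grad_integrable[OF f this, of i]
  show "(\<integral>\<^sup>+x. ennreal ((grad f x \<bullet> i)\<^sup>2) \<partial>lebesgue) < \<infinity>"
    by (simp add: power2_eq_square integrable_iff_bounded)
qed

lemma grad_truncation:
  assumes "truncation g g'" "f \<in> test_fun \<Omega>"
  shows "grad (\<lambda>x. g (f x)) x = g' (f x) *\<^sub>R grad f x"
  by (rule grad_compose[OF test_fun_differentiable[OF assms(2)] truncationD(3)[OF assms(1)]])

text \<open>
  The difference of the gradients splits into \<open>g' (f n) * (G - grad (f n))\<close>, which tends to \<open>0\<close> since
  \<open>g'\<close> is bounded, and \<open>(g' u - g' (f n)) * G\<close>, to which dominated convergence applies.
\<close>

lemma truncation_grad_convergence:
  assumes \<Omega>: "open \<Omega>" and g: "truncation g g'" and u: "u \<in> fun_on \<Omega>"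
    and G: "(\<lambda>x. indicator \<Omega> x *\<^sub>R G x) \<in> borel_measurable lebesgue" "grad_sq \<Omega> G < \<infinity>"
    and f: "\<And>n. f n \<in> test_fun \<Omega>" "(\<lambda>n. grad_sq \<Omega> (\<lambda>x. G x - grad (f n) x)) \<longlonglongrightarrow> 0"
    and AE: "AE x in lebesgue. (\<lambda>n. f n x) \<longlonglongrightarrow> u x"
  shows "(\<lambda>n. grad_sq \<Omega> (\<lambda>x. g' (u x) *\<^sub>R G x - g' (f n x) *\<^sub>R grad (f n) x)) \<longlonglongrightarrow> 0"
proof -
  have \<Omega>m: "\<Omega> \<in> sets lebesgue" using \<Omega> by simp
  note [measurable] = truncation_measurable[OF g] fun_onD(1)[OF u] fun_onD(1)[OF test_fun_fun_on[OF f(1)]]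
  note nG = norm_square_measurable[OF G(1)]
  note nGf = norm_square_measurable[OF indicator_diff_grad_measurable[OF G(1) \<Omega>m f(1)]]
  let ?D = "\<lambda>n x. ennreal ((g' (u x) - g' (f n x))\<^sup>2) * (ennreal ((norm (G x))\<^sup>2) * indicator \<Omega> x)"
  have Dm: "?D n \<in> borel_measurable lebesgue" for n using nG by measurable
  have D: "(\<lambda>n. \<integral>\<^sup>+x. ?D n x \<partial>lebesgue) \<longlonglongrightarrow> (\<integral>\<^sup>+(x::'a). 0 \<partial>lebesgue)"
  proof (rule nn_integral_dominated_convergence[where w="\<lambda>x. ennreal ((norm (G x))\<^sup>2) * indicator \<Omega> x"])
    show "AE x in lebesgue. ?D n x \<le> ennreal ((norm (G x))\<^sup>2) * indicator \<Omega> x" for n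
    proof (rule AE_I2)
      fix x
      have "\<bar>g' (u x) - g' (f n x)\<bar> \<le> 1"
        using truncationD(4,5)[OF g, of "u x"] truncationD(4,5)[OF g, of "f n x"] by linarith
      then have "(g' (u x) - g' (f n x))\<^sup>2 \<le> 1" by (simp add: abs_square_le_1)
      then have "ennreal ((g' (u x) - g' (f n x))\<^sup>2) \<le> 1" by (simp add: ennreal_le_1)
      then show "?D n x \<le> ennreal ((norm (G x))\<^sup>2) * indicator \<Omega> x"
        using mult_right_mono[of _ 1 "ennreal ((norm (G x))\<^sup>2) * indicator \<Omega> x"] by simp
    qed
    show "(\<integral>\<^sup>+x. ennreal ((norm (G x))\<^sup>2) * indicator \<Omega> x \<partial>lebesgue) < \<infinity>" using G(2) by (simp add: grad_sq_def)
    show "AE x in lebesgue. (\<lambda>n. ?D n x) \<longlonglongrightarrow> 0"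
      using AE
    proof eventually_elim
      case (elim x)
      have "(\<lambda>n. ennreal ((g' (u x) - g' (f n x))\<^sup>2)) \<longlonglongrightarrow> ennreal ((g' (u x) - g' (u x))\<^sup>2)"
        by (intro tendsto_ennrealI tendsto_power tendsto_diff tendsto_const
            isCont_tendsto_compose[OF truncation_isCont_deriv[OF g]] elim)
      then have "(\<lambda>n. (ennreal ((norm (G x))\<^sup>2) * indicator \<Omega> x) * ennreal ((g' (u x) - g' (f n x))\<^sup>2))
          \<longlonglongrightarrow> (ennreal ((norm (G x))\<^sup>2) * indicator \<Omega> x) * ennreal ((g' (u x) - g' (u x))\<^sup>2)"
        by (rule ennreal_tendsto_cmult[rotated]) (simp add: indicator_def)
      then show ?case by (simp add: mult.commute)
    qed
  qed (use nG Dm in auto)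
  have "(\<lambda>n. 2 * grad_sq \<Omega> (\<lambda>x. G x - grad (f n) x) + 2 * (\<integral>\<^sup>+x. ?D n x \<partial>lebesgue)) \<longlonglongrightarrow> 2 * 0 + 2 * 0"
    using D by (intro tendsto_add ennreal_tendsto_cmult f(2)) auto
  then have lim: "(\<lambda>n. 2 * grad_sq \<Omega> (\<lambda>x. G x - grad (f n) x) + 2 * (\<integral>\<^sup>+x. ?D n x \<partial>lebesgue)) \<longlonglongrightarrow> 0" by simp
  have "grad_sq \<Omega> (\<lambda>x. g' (u x) *\<^sub>R G x - g' (f n x) *\<^sub>R grad (f n) x)
      \<le> 2 * grad_sq \<Omega> (\<lambda>x. G x - grad (f n) x) + 2 * (\<integral>\<^sup>+x. ?D n x \<partial>lebesgue)" for n
  proof -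
    have "grad_sq \<Omega> (\<lambda>x. g' (u x) *\<^sub>R G x - g' (f n x) *\<^sub>R grad (f n) x)
       \<le> (\<integral>\<^sup>+x. 2 * (ennreal ((norm (G x - grad (f n) x))\<^sup>2) * indicator \<Omega> x) + 2 * ?D n x \<partial>lebesgue)"
      unfolding grad_sq_def
    proof (rule nn_integral_mono)
      fix x
      let ?A = "norm (G x - grad (f n) x)" and ?B = "\<bar>g' (u x) - g' (f n x)\<bar> * norm (G x)"
      have "g' (u x) *\<^sub>R G x - g' (f n x) *\<^sub>R grad (f n) x =
          g' (f n x) *\<^sub>R (G x - grad (f n) x) + (g' (u x) - g' (f n x)) *\<^sub>R G x"
        by (simp add: algebra_simps)
      then have "norm (g' (u x) *\<^sub>R G x - g' (f n x) *\<^sub>R grad (f n) x) \<le> \<bar>g' (f n x)\<bar> * ?A + ?B"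
        using norm_triangle_ineq[of "g' (f n x) *\<^sub>R (G x - grad (f n) x)" "(g' (u x) - g' (f n x)) *\<^sub>R G x"] by simp
      also have "\<dots> \<le> ?A + ?B"
        using truncationD(4,5)[OF g, of "f n x"] by (simp add: mult_left_le_one_le)
      finally have "(norm (g' (u x) *\<^sub>R G x - g' (f n x) *\<^sub>R grad (f n) x))\<^sup>2 \<le> (?A + ?B)\<^sup>2"
        by (rule power_mono) simp
      also have "\<dots> \<le> 2 * ?A\<^sup>2 + 2 * ?B\<^sup>2"
        by (rule power2_add_le)
      also have "?B\<^sup>2 = (g' (u x) - g' (f n x))\<^sup>2 * (norm (G x))\<^sup>2" by (simp add: power_mult_distrib)
      finally have "ennreal ((norm (g' (u x) *\<^sub>R G x - g' (f n x) *\<^sub>R grad (f n) x))\<^sup>2) \<le>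
          ennreal (2 * ?A\<^sup>2 + 2 * ((g' (u x) - g' (f n x))\<^sup>2 * (norm (G x))\<^sup>2))" by (rule ennreal_leI)
      also have "\<dots> = 2 * ennreal (?A\<^sup>2) + 2 * (ennreal ((g' (u x) - g' (f n x))\<^sup>2) * ennreal ((norm (G x))\<^sup>2))"
        by (subst ennreal_plus) (simp_all add: ennreal_mult)
      finally show "ennreal ((norm (g' (u x) *\<^sub>R G x - g' (f n x) *\<^sub>R grad (f n) x))\<^sup>2) * indicator \<Omega> x
          \<le> 2 * (ennreal (?A\<^sup>2) * indicator \<Omega> x) + 2 * ?D n x"
        by (cases "x \<in> \<Omega>") simp_all
    qed
    also have "\<dots> = 2 * grad_sq \<Omega> (\<lambda>x. G x - grad (f n) x) + 2 * (\<integral>\<^sup>+x. ?D n x \<partial>lebesgue)"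
      unfolding grad_sq_def using nGf[of n] Dm[of n] by (subst nn_integral_add) (auto simp: nn_integral_cmult)
    finally show ?thesis .
  qed
  then show ?thesis by (rule ennreal_tendsto_0_le[OF lim])
qed

section \<open>Truncation in the first-order space\<close>

text \<open>
  The chain rule for weak gradients, as the limit of the classical chain rule for \<open>g (f n)\<close>.
\<close>

lemma truncation_Y_space_gradient:
  assumes \<Omega>: "open \<Omega>" and g: "truncation g g'" and u: "u \<in> fun_on \<Omega>" "sq_integral u < \<infinity>"
    and G: "has_weak_gradient \<Omega> u G" "grad_sq \<Omega> G < \<infinity>"
    and f: "\<And>n. f n \<in> test_fun \<Omega>" "(\<lambda>n. sq_integral (\<lambda>x. u x - f n x)) \<longlonglongrightarrow> 0"
      "(\<lambda>n. grad_sq \<Omega> (\<lambda>x. G x - grad (f n) x)) \<longlonglongrightarrow> 0"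
    and AE: "AE x in lebesgue. (\<lambda>n. f n x) \<longlonglongrightarrow> u x"
  shows "has_weak_gradient \<Omega> (\<lambda>x. g (u x)) (\<lambda>x. g' (u x) *\<^sub>R G x)"
    and "grad_sq \<Omega> (\<lambda>x. g' (u x) *\<^sub>R G x) < \<infinity>"
    and "(\<lambda>n. sq_integral (\<lambda>x. g (u x) - g (f n x))) \<longlonglongrightarrow> 0"
    and "(\<lambda>n. grad_sq \<Omega> (\<lambda>x. g' (u x) *\<^sub>R G x - grad (\<lambda>x. g (f n x)) x)) \<longlonglongrightarrow> 0"
proof -
  have \<Omega>m [measurable]: "\<Omega> \<in> sets lebesgue" using \<Omega> by simp
  note [measurable] = truncation_measurable[OF g] fun_onD(1)[OF u(1)] fun_onD(1)[OF test_fun_fun_on[OF f(1)]]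
  have Gm: "(\<lambda>x. indicator \<Omega> x *\<^sub>R G x) \<in> borel_measurable lebesgue"
    by (rule weak_gradient_measurable[OF \<Omega> G(1)])
  have gu: "(\<lambda>x. g (u x)) \<in> fun_on \<Omega>" by (rule truncation_fun_on[OF g u(1)])
  have h: "(\<lambda>x. g (f n x)) \<in> test_fun \<Omega>" for n
    by (rule test_fun_smooth_comp[OF f(1) truncationD(1,2)[OF g]])
  have hgrad: "grad (\<lambda>x. g (f n x)) x = g' (f n x) *\<^sub>R grad (f n) x" for n x
    by (rule grad_truncation[OF g f(1)])
  have gm: "g' (u x) *\<^sub>R (indicator \<Omega> x *\<^sub>R G x) = indicator \<Omega> x *\<^sub>R (g' (u x) *\<^sub>R G x)" for x by simp
  have gum: "(\<lambda>x. g' (u x)) \<in> borel_measurable lebesgue" by measurable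
  have gGm: "(\<lambda>x. indicator \<Omega> x *\<^sub>R (g' (u x) *\<^sub>R G x)) \<in> borel_measurable lebesgue"
    unfolding gm[symmetric] by (rule borel_measurable_scaleR[OF gum Gm])
  have sq: "sq_integral (\<lambda>x. g (u x) - g (f n x)) \<le> sq_integral (\<lambda>x. u x - f n x)" for n
    by (intro sq_integral_mono truncation_lipschitz[OF g])
  show 3: "(\<lambda>n. sq_integral (\<lambda>x. g (u x) - g (f n x))) \<longlonglongrightarrow> 0"
    by (rule ennreal_tendsto_0_le[OF f(2) sq])
  show 4: "(\<lambda>n. grad_sq \<Omega> (\<lambda>x. g' (u x) *\<^sub>R G x - grad (\<lambda>x. g (f n x)) x)) \<longlonglongrightarrow> 0"
    unfolding hgrad by (rule truncation_grad_convergence[OF \<Omega> g u(1) Gm G(2) f(1,3) AE])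
  have "grad_sq \<Omega> (\<lambda>x. g' (u x) *\<^sub>R G x) \<le> grad_sq \<Omega> G"
    by (rule grad_sq_mono) (use truncationD(4,5)[OF g] in \<open>simp add: mult_left_le_one_le\<close>)
  then show 2: "grad_sq \<Omega> (\<lambda>x. g' (u x) *\<^sub>R G x) < \<infinity>" using G(2) by (rule le_less_trans)
  have sqg: "sq_integral (\<lambda>x. g (u x)) < \<infinity>"
    by (rule le_less_trans[OF sq_integral_mono[OF truncation_abs_le[OF g]] u(2)])
  show "has_weak_gradient \<Omega> (\<lambda>x. g (u x)) (\<lambda>x. g' (u x) *\<^sub>R G x)"
    unfolding has_weak_gradient_def
  proof (intro conjI allI ballI impI)
    fix K assume K: "compact K \<and> K \<subseteq> \<Omega>"
    then have Km: "(\<lambda>x. indicator K x :: real) \<in> borel_measurable lebesgue" by (intro borel_measurable_indicator) (simp add: borel_compact)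
    show "set_integrable lebesgue K (\<lambda>x. g (u x))"
    proof (rule L2_set_integrable_compact)
      show "(\<lambda>x. indicator K x *\<^sub>R g (u x)) \<in> borel_measurable lebesgue"
        by (intro borel_measurable_scaleR Km fun_onD(1)[OF gu])
      have "(\<integral>\<^sup>+x\<in>K. ennreal ((norm (g (u x)))\<^sup>2) \<partial>lebesgue) \<le> sq_integral (\<lambda>x. g (u x))"
        unfolding sq_integral_def by (rule nn_integral_mono) (simp add: indicator_def)
      then show "(\<integral>\<^sup>+x\<in>K. ennreal ((norm (g (u x)))\<^sup>2) \<partial>lebesgue) < \<infinity>" using sqg by (rule le_less_trans)
    qed (use K in blast)
    show "set_integrable lebesgue K (\<lambda>x. g' (u x) *\<^sub>R G x)"
    proof (rule L2_set_integrable_compact)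
      have "(\<lambda>x. indicator K x *\<^sub>R (indicator \<Omega> x *\<^sub>R (g' (u x) *\<^sub>R G x))) \<in> borel_measurable lebesgue"
        by (rule borel_measurable_scaleR[OF Km gGm])
      moreover have "(\<lambda>x. indicator K x *\<^sub>R (indicator \<Omega> x *\<^sub>R (g' (u x) *\<^sub>R G x))) = (\<lambda>x. indicator K x *\<^sub>R (g' (u x) *\<^sub>R G x))"
        using K by (auto simp: indicator_def fun_eq_iff)
      ultimately show "(\<lambda>x. indicator K x *\<^sub>R (g' (u x) *\<^sub>R G x)) \<in> borel_measurable lebesgue" by (simp only:)
      have "(\<integral>\<^sup>+x\<in>K. ennreal ((norm (g' (u x) *\<^sub>R G x))\<^sup>2) \<partial>lebesgue) \<le> grad_sq \<Omega> (\<lambda>x. g' (u x) *\<^sub>R G x)"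
        unfolding grad_sq_def by (rule nn_integral_mono) (use K in \<open>auto simp: indicator_def\<close>)
      then show "(\<integral>\<^sup>+x\<in>K. ennreal ((norm (g' (u x) *\<^sub>R G x))\<^sup>2) \<partial>lebesgue) < \<infinity>" using 2 by (rule le_less_trans)
    qed (use K in blast)
  next
    fix z :: "'a \<Rightarrow> real" and i :: 'a
    assume z: "z \<in> test_fun \<Omega>" and i: "i \<in> Basis"
    have zm: "z \<in> borel_measurable lebesgue" by (rule fun_onD(1)[OF test_fun_fun_on[OF z]])
    have dzm: "(\<lambda>x. grad z x \<bullet> i) \<in> borel_measurable lebesgue"
      by (intro continuous_lebesgue_measurable continuous_intros test_fun_grad_continuous[OF z])
    have dhm: "(\<lambda>x. grad (\<lambda>x. g (f n x)) x \<bullet> i) \<in> borel_measurable lebesgue" for n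
      by (intro continuous_lebesgue_measurable continuous_intros test_fun_grad_continuous[OF h])
    let ?H = "\<lambda>x. (indicator \<Omega> x *\<^sub>R (g' (u x) *\<^sub>R G x)) \<bullet> i"
    have Hm: "?H \<in> borel_measurable lebesgue" using gGm by (rule borel_measurable_inner) simp
    have comp: "(v \<bullet> i)\<^sup>2 \<le> (norm v)\<^sup>2" for v :: 'a
      using power_mono[OF Basis_le_norm[OF i, of v], of 2] by simp
    have H2: "(\<integral>\<^sup>+x. ennreal ((?H x)\<^sup>2) \<partial>lebesgue) < \<infinity>"
    proof -
      have "(\<integral>\<^sup>+x. ennreal ((?H x)\<^sup>2) \<partial>lebesgue) \<le> grad_sq \<Omega> (\<lambda>x. g' (u x) *\<^sub>R G x)"
        unfolding grad_sq_def
      proof (rule nn_integral_mono)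
        fix x
        show "ennreal ((?H x)\<^sup>2) \<le> ennreal ((norm (g' (u x) *\<^sub>R G x))\<^sup>2) * indicator \<Omega> x"
          using comp[of "g' (u x) *\<^sub>R G x"] by (cases "x \<in> \<Omega>") (simp_all add: ennreal_leI)
      qed
      then show ?thesis using 2 by (rule le_less_trans)
    qed
    have lim1: "(\<lambda>n. \<integral>x. g (f n x) * (grad z x \<bullet> i) \<partial>lebesgue) \<longlonglongrightarrow> (\<integral>x. g (u x) * (grad z x \<bullet> i) \<partial>lebesgue)"
    proof (rule L2_tendsto_integral_mult[OF _ _ dzm _ test_fun_L2(2)[OF z]])
      show "(\<lambda>n. \<integral>\<^sup>+ x. ennreal ((g (f n x) - g (u x))\<^sup>2) \<partial>lebesgue) \<longlonglongrightarrow> 0"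
        using 3 by (simp add: sq_integral_def power2_commute)
      show "integrable lebesgue (\<lambda>x. g (f n x) * (grad z x \<bullet> i))" for n
        using test_fun_grad_integrable[OF z test_fun_continuous[OF h], of i n] by (simp add: mult.commute)
      show "integrable lebesgue (\<lambda>x. g (u x) * (grad z x \<bullet> i))"
        using sqg by (intro L2_mult_integrable fun_onD(1)[OF gu] dzm test_fun_L2(2)[OF z]) (simp add: sq_integral_def)
    qed (use fun_onD(1)[OF gu] fun_onD(1)[OF test_fun_fun_on[OF h]] in auto)
    have lim2: "(\<lambda>n. \<integral>x. (grad (\<lambda>x. g (f n x)) x \<bullet> i) * z x \<partial>lebesgue) \<longlonglongrightarrow> (\<integral>x. ?H x * z x \<partial>lebesgue)"
    proof (rule L2_tendsto_integral_mult[OF dhm Hm zm _ test_fun_L2(1)[OF z]])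
      show "(\<lambda>n. \<integral>\<^sup>+ x. ennreal ((grad (\<lambda>x. g (f n x)) x \<bullet> i - ?H x)\<^sup>2) \<partial>lebesgue) \<longlonglongrightarrow> 0"
      proof (rule ennreal_tendsto_0_le[OF 4])
        fix n
        show "(\<integral>\<^sup>+ x. ennreal ((grad (\<lambda>x. g (f n x)) x \<bullet> i - ?H x)\<^sup>2) \<partial>lebesgue)
           \<le> grad_sq \<Omega> (\<lambda>x. g' (u x) *\<^sub>R G x - grad (\<lambda>x. g (f n x)) x)"
        proof -
          obtain K where K: "compact K" "K \<subseteq> \<Omega>" "\<forall>x. x \<notin> K \<longrightarrow> g (f n x) = 0"
            using test_fun_support[OF h[of n]] by blast
          show ?thesis
            unfolding grad_sq_def
          proof (rule nn_integral_mono)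
            fix x
            show "ennreal ((grad (\<lambda>x. g (f n x)) x \<bullet> i - ?H x)\<^sup>2)
              \<le> ennreal ((norm (g' (u x) *\<^sub>R G x - grad (\<lambda>x. g (f n x)) x))\<^sup>2) * indicator \<Omega> x"
            proof (cases "x \<in> \<Omega>")
              case True
              then show ?thesis using comp[of "g' (u x) *\<^sub>R G x - grad (\<lambda>x. g (f n x)) x"]
                by (simp add: inner_diff_left power2_commute ennreal_leI)
            next
              case False
              then have "grad (\<lambda>x. g (f n x)) x = 0" using grad_eq_0_outside[OF K(1,3)] K(2) by blast
              then show ?thesis using False by simp
            qed
          qed
        qed
      qed
      show "integrable lebesgue (\<lambda>x. (grad (\<lambda>x. g (f n x)) x \<bullet> i) * z x)" for n
        by (rule test_fun_grad_integrable[OF h test_fun_continuous[OF z]])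
      show "integrable lebesgue (\<lambda>x. ?H x * z x)"
        by (rule L2_mult_integrable[OF Hm zm H2 test_fun_L2(1)[OF z]])
    qed
    have parts: "(\<integral>x. g (f n x) * (grad z x \<bullet> i) \<partial>lebesgue) = - (\<integral>x. (grad (\<lambda>x. g (f n x)) x \<bullet> i) * z x \<partial>lebesgue)" for n
      by (rule integration_by_parts[OF h z])
    have eq: "(\<integral>x. g (u x) * (grad z x \<bullet> i) \<partial>lebesgue) = - (\<integral>x. ?H x * z x \<partial>lebesgue)"
      using LIMSEQ_unique[OF lim1] tendsto_minus[OF lim2] unfolding parts by blast
    have "(LINT x:\<Omega>|lebesgue. g (u x) * frechet_derivative z (at x) i) = (\<integral>x. g (u x) * (grad z x \<bullet> i) \<partial>lebesgue)"
      unfolding set_lebesgue_integral_def grad_inner_Basis[OF i]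
      by (rule Bochner_Integration.integral_cong) (use fun_onD(2)[OF gu] in \<open>auto simp: indicator_def\<close>)
    also note eq
    also have "(\<integral>x. ?H x * z x \<partial>lebesgue) = (LINT x:\<Omega>|lebesgue. ((g' (u x) *\<^sub>R G x) \<bullet> i) * z x)"
      unfolding set_lebesgue_integral_def
      by (rule Bochner_Integration.integral_cong) (auto simp: indicator_def)
    finally show "(LINT x:\<Omega>|lebesgue. g (u x) * frechet_derivative z (at x) i)
        = - (LINT x:\<Omega>|lebesgue. ((g' (u x) *\<^sub>R G x) \<bullet> i) * z x)" .
  qed
qed

theorem truncation_Y_space:
  assumes \<Omega>: "open \<Omega>" and g: "truncation g g'" and u: "u \<in> Y_space \<Omega>"
  shows "(\<lambda>x. g (u x)) \<in> Y_space \<Omega>"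
    and "AE x in lebesgue. x \<in> \<Omega> \<longrightarrow> weak_grad \<Omega> (\<lambda>x. g (u x)) x = g' (u x) *\<^sub>R weak_grad \<Omega> u x"
proof -
  obtain G f where u': "u \<in> fun_on \<Omega>" "sq_integral u < \<infinity>" and
    G: "has_weak_gradient \<Omega> u G" "grad_sq \<Omega> G < \<infinity>"
    and f: "\<And>n. f n \<in> test_fun \<Omega>" "(\<lambda>n. sq_integral (\<lambda>x. u x - f n x)) \<longlonglongrightarrow> 0"
      "(\<lambda>n. grad_sq \<Omega> (\<lambda>x. G x - grad (f n) x)) \<longlonglongrightarrow> 0"
    using u unfolding Y_space_iff[OF \<Omega>] by blast
  obtain r where r: "strict_mono r" "AE x in lebesgue. (\<lambda>n. f (r n) x) \<longlonglongrightarrow> u x"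
    using L2_approx_AE_subseq[OF u' test_fun_fun_on[OF f(1)] f(2)] by blast
  have f2: "(\<lambda>n. sq_integral (\<lambda>x. u x - f (r n) x)) \<longlonglongrightarrow> 0"
    using LIMSEQ_subseq_LIMSEQ[OF f(2) r(1)] by (simp add: o_def)
  have f3: "(\<lambda>n. grad_sq \<Omega> (\<lambda>x. G x - grad (f (r n)) x)) \<longlonglongrightarrow> 0"
    using LIMSEQ_subseq_LIMSEQ[OF f(3) r(1)] by (simp add: o_def)
  note * = truncation_Y_space_gradient[OF \<Omega> g u' G f(1) f2 f3 r(2)]
  have h: "(\<lambda>x. g (f (r n) x)) \<in> test_fun \<Omega>" for n
    by (rule test_fun_smooth_comp[OF f(1) truncationD(1,2)[OF g]])
  have sqg: "sq_integral (\<lambda>x. g (u x)) < \<infinity>"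
    by (rule le_less_trans[OF sq_integral_mono[OF truncation_abs_le[OF g]] u'(2)])
  show "(\<lambda>x. g (u x)) \<in> Y_space \<Omega>"
    unfolding Y_space_iff[OF \<Omega>]
  proof (intro conjI exI)
    show "\<forall>n. (\<lambda>n x. g (f (r n) x)) n \<in> test_fun \<Omega>" using h by blast
  qed (use * truncation_fun_on[OF g u'(1)] sqg in auto)
  show "AE x in lebesgue. x \<in> \<Omega> \<longrightarrow> weak_grad \<Omega> (\<lambda>x. g (u x)) x = g' (u x) *\<^sub>R weak_grad \<Omega> u x"
    using weak_grad_AE_eq[OF \<Omega> *(1)] weak_grad_AE_eq[OF \<Omega> G(1)]
    by eventually_elim simp
qed

section \<open>Embedding the first-order space into the fractional one\<close>

text \<open>
  A power of \<open>norm h\<close> is compared with a series of multiples of indicators of dyadic balls.  This lemma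
  integrates such a series when it becomes geometric.
\<close>

lemma nn_integral_ball_series_finite:
  fixes A R :: "nat \<Rightarrow> real"
  assumes A: "\<And>j. A j \<ge> 0" and R: "\<And>j. R j \<ge> 0" and q: "0 \<le> q" "q < 1"
    and eq: "\<And>j. A j * R j ^ DIM('a::euclidean_space) = K * q ^ j"
  shows "(\<integral>\<^sup>+h. (\<Sum>j. ennreal (A j) * indicator (ball (0::'a) (R j)) h) \<partial>lborel) < \<infinity>"
proof -
  let ?c = "unit_ball_vol (real DIM('a))"
  have [measurable]: "ball (0::'a) (R j) \<in> sets borel" for j by simp
  have "(\<integral>\<^sup>+h. (\<Sum>j. ennreal (A j) * indicator (ball (0::'a) (R j)) h) \<partial>lborel) =
      (\<Sum>j. \<integral>\<^sup>+h. ennreal (A j) * indicator (ball (0::'a) (R j)) h \<partial>lborel)"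
    by (rule nn_integral_suminf) measurable
  also have "\<dots> = (\<Sum>j. ennreal (?c * K * q ^ j))"
  proof (rule suminf_cong)
    fix j
    have "(\<integral>\<^sup>+h. ennreal (A j) * indicator (ball (0::'a) (R j)) h \<partial>lborel) = ennreal (A j) * ennreal (?c * R j ^ DIM('a))"
      using emeasure_ball[OF R, of "0::'a" j] by (simp add: nn_integral_cmult_indicator)
    also have "\<dots> = ennreal (?c * (A j * R j ^ DIM('a)))"
      using A[of j] R[of j] by (simp add: ennreal_mult[symmetric] mult_ac)
    finally show "(\<integral>\<^sup>+h. ennreal (A j) * indicator (ball (0::'a) (R j)) h \<partial>lborel) = ennreal (?c * K * q ^ j)"
      by (simp only: eq mult.assoc)
  qed
  also have "\<dots> = ennreal (\<Sum>j. ?c * K * q ^ j)"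
  proof (rule suminf_ennreal2)
    show "0 \<le> ?c * K * q ^ j" for j
      using eq[of j] A[of j] R[of j] by (simp add: mult.assoc eq[symmetric])
    show "summable (\<lambda>j. ?c * K * q ^ j)" using q by (intro summable_mult summable_geometric) simp
  qed
  also have "\<dots> < \<infinity>" by simp
  finally show ?thesis .
qed

lemma frac_kernel_le:
  assumes "0 < r" "r \<le> norm h" "0 < s"
  shows "frac_kernel s (h :: 'a::euclidean_space) \<le> 1 / r powr (real DIM('a) + 2 * s)"
  unfolding frac_kernel_def
proof (rule divide_left_mono)
  show "r powr (real DIM('a) + 2 * s) \<le> norm h powr (real DIM('a) + 2 * s)"
    using assms by (intro powr_mono2) auto
  have "0 < norm h" using assms by linarith
  then show "0 < norm h powr (real DIM('a) + 2 * s) * r powr (real DIM('a) + 2 * s)" using assms(1) by simp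
qed simp

lemma dyadic_interval:
  fixes t :: real
  assumes "t > 0" shows "\<exists>k::int. 2 powr k \<le> t \<and> t < 2 powr (k + 1)"
  using floor_log_eq_powr_iff[of t 2 "\<lfloor>log 2 t\<rfloor>"] assms by auto

text \<open>
  The series with index 1 controls the singularity at \<open>0\<close> (here \<open>s < 1\<close> is needed), the series with
  index 2 controls infinity (here \<open>s > 0\<close> is needed).
\<close>

lemma frac_kernel_integral_finite:
  fixes s :: real
  assumes s: "0 < s" "s < 1"
  shows "(\<integral>\<^sup>+h. ennreal (min ((norm h)\<^sup>2) 1 * frac_kernel s (h::'a::euclidean_space)) \<partial>lborel) < \<infinity>"
proof -
  define N where "N = real DIM('a)"
  define A1 R1 A2 R2 where
    "A1 j = 2 powr (- 2 * real j) * 2 powr ((real j + 1) * (N + 2 * s))" and "R1 j = 2 powr (- real j)" and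
    "A2 j = 2 powr (- real j * (N + 2 * s))" and "R2 j = 2 powr (real j + 1)" for j :: nat
  let ?S1 = "\<lambda>h. \<Sum>j. ennreal (A1 j) * indicator (ball (0::'a) (R1 j)) h"
  let ?S2 = "\<lambda>h. \<Sum>j. ennreal (A2 j) * indicator (ball (0::'a) (R2 j)) h"
  have pw: "(2 powr x) ^ DIM('a) = 2 powr (N * x)" "(2 powr x) ^ j = 2 powr (real j * x)" for x :: real and j :: nat
    by (simp_all add: N_def powr_realpow[symmetric] powr_powr mult.commute)
  have fin1: "(\<integral>\<^sup>+h. ?S1 h \<partial>lborel) < \<infinity>"
  proof (rule nn_integral_ball_series_finite)
    show "A1 j * R1 j ^ DIM('a) = 2 powr (N + 2 * s) * (2 powr (2 * s - 2)) ^ j" for j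
      unfolding A1_def R1_def pw powr_add[symmetric] by (simp add: algebra_simps N_def)
    have "2 powr (2 * s - 2) < 2 powr (0::real)" using s by (intro powr_less_mono) auto
    then show "2 powr (2 * s - 2) < (1::real)" by simp
  qed (auto simp: A1_def R1_def)
  have fin2: "(\<integral>\<^sup>+h. ?S2 h \<partial>lborel) < \<infinity>"
  proof (rule nn_integral_ball_series_finite)
    show "A2 j * R2 j ^ DIM('a) = 2 powr N * (2 powr (- 2 * s)) ^ j" for j
      unfolding A2_def R2_def pw powr_add[symmetric] by (simp add: algebra_simps N_def)
    have "2 powr (- 2 * s) < 2 powr (0::real)" using s by (intro powr_less_mono) auto
    then show "2 powr (- 2 * s) < (1::real)" by simp
  qed (auto simp: A2_def R2_def)
  have single: "ennreal (A j) \<le> (\<Sum>j. ennreal (A j) * indicator (ball (0::'a) (R j)) h)" if "norm h < R j"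
    for A R :: "nat \<Rightarrow> real" and h :: 'a and j
    using sum_le_suminf[OF summableI, of "{j}" "\<lambda>j. ennreal (A j) * indicator (ball (0::'a) (R j)) h"] that by simp
  have "ennreal (min ((norm h)\<^sup>2) 1 * frac_kernel s h) \<le> ?S1 h + ?S2 h" for h :: 'a
  proof (cases "h = 0")
    case True
    then show ?thesis by simp
  next
    case False
    then obtain k :: int where k: "2 powr k \<le> norm h" "norm h < 2 powr (k + 1)"
      using dyadic_interval[of "norm h"] by auto
    have ker: "frac_kernel s h \<le> 1 / (2 powr k) powr (N + 2 * s)"
      using frac_kernel_le[OF _ k(1) s(1)] by (simp add: N_def)
    show ?thesis
    proof (cases "k \<ge> 0")
      case True
      define j where "j = nat k"
      have kj: "real_of_int k = real j" using True by (simp add: j_def)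
      have "min ((norm h)\<^sup>2) 1 * frac_kernel s h \<le> 1 * frac_kernel s h" by (intro mult_right_mono) auto
      also have "\<dots> \<le> A2 j" using ker by (simp add: kj A2_def powr_powr powr_minus divide_inverse)
      finally have "ennreal (min ((norm h)\<^sup>2) 1 * frac_kernel s h) \<le> ennreal (A2 j)" by (rule ennreal_leI)
      also have "\<dots> \<le> ?S2 h" using k(2) by (intro single) (simp add: kj R2_def)
      finally show ?thesis by (simp add: add_increasing)
    next
      case False
      define j where "j = nat (- k - 1)"
      have kj: "real_of_int k = - real j - 1" using False by (simp add: j_def)
      have hR: "norm h < R1 j" using k(2) by (simp add: kj R1_def)
      have "min ((norm h)\<^sup>2) 1 \<le> (R1 j)\<^sup>2"
        using hR power_mono[of "norm h" "R1 j" 2] by simp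
      also have "(R1 j)\<^sup>2 = 2 powr (- 2 * real j)"
        by (simp add: R1_def power2_eq_square flip: powr_add)
      finally have "min ((norm h)\<^sup>2) 1 * frac_kernel s h \<le> 2 powr (- 2 * real j) * (1 / (2 powr k) powr (N + 2 * s))"
        using ker by (intro mult_mono) auto
      also have "1 / (2 powr k) powr (N + 2 * s) = 2 powr (- (k * (N + 2 * s)))"
        by (simp add: powr_powr powr_minus divide_inverse)
      also have "- (k * (N + 2 * s)) = (real j + 1) * (N + 2 * s)" by (simp add: kj algebra_simps)
      finally have "ennreal (min ((norm h)\<^sup>2) 1 * frac_kernel s h) \<le> ennreal (A1 j)" unfolding A1_def by (rule ennreal_leI)
      also have "\<dots> \<le> ?S1 h" by (rule single[where A=A1 and R=R1, OF hR])
      finally show ?thesis by (simp add: add_increasing2)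
    qed
  qed
  then have "(\<integral>\<^sup>+h. ennreal (min ((norm h)\<^sup>2) 1 * frac_kernel s (h::'a)) \<partial>lborel) \<le> (\<integral>\<^sup>+h. ?S1 h + ?S2 h \<partial>lborel)"
    by (intro nn_integral_mono)
  also have "\<dots> = (\<integral>\<^sup>+h. ?S1 h \<partial>lborel) + (\<integral>\<^sup>+h. ?S2 h \<partial>lborel)"
  proof -
    have [measurable]: "ball (0::'a) (R1 j) \<in> sets borel" "ball (0::'a) (R2 j) \<in> sets borel" for j by simp_all
    show ?thesis by (rule nn_integral_add) measurable
  qed
  also have "\<dots> < \<infinity>" using fin1 fin2 by simp
  finally show ?thesis .
qed

text \<open>
  The squared \<open>L2\<close> norm of the increment of \<open>f\<close> under the shift by \<open>h\<close>.
\<close>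

definition shift_sq :: "('a::euclidean_space \<Rightarrow> real) \<Rightarrow> 'a \<Rightarrow> ennreal" where
  "shift_sq f h = (\<integral>\<^sup>+x. ennreal ((f (h + x) - f x)\<^sup>2) \<partial>lborel)"

lemma gagliardo_eq_shift:
  assumes f [measurable]: "f \<in> borel_measurable borel"
  shows "gagliardo s f = (\<integral>\<^sup>+h. ennreal (frac_kernel s h) * shift_sq f h \<partial>lborel)"
proof -
  have "gagliardo s f = (\<integral>\<^sup>+x. (\<integral>\<^sup>+h. ennreal ((f x - f (x + h))\<^sup>2 * frac_kernel s (x - (x + h))) \<partial>lborel) \<partial>lborel)"
    unfolding gagliardo_eq_lborel[OF f]
    by (intro nn_integral_cong nn_integral_translate[symmetric]) measurable
  also have "\<dots> = (\<integral>\<^sup>+x. (\<integral>\<^sup>+h. ennreal (frac_kernel s h) * ennreal ((f (h + x) - f x)\<^sup>2) \<partial>lborel) \<partial>lborel)"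
    by (intro nn_integral_cong) (simp add: frac_kernel_def power2_commute add.commute flip: ennreal_mult)
  also have "\<dots> = (\<integral>\<^sup>+h. (\<integral>\<^sup>+x. ennreal (frac_kernel s h) * ennreal ((f (h + x) - f x)\<^sup>2) \<partial>lborel) \<partial>lborel)"
    by (rule lborel_pair.Fubini'[symmetric]) measurable
  also have "\<dots> = (\<integral>\<^sup>+h. ennreal (frac_kernel s h) * shift_sq f h \<partial>lborel)"
    unfolding shift_sq_def by (intro nn_integral_cong nn_integral_cmult) measurable
  finally show ?thesis .
qed

lemma shift_sq_le_sq:
  assumes [measurable]: "f \<in> borel_measurable borel"
  shows "shift_sq f h \<le> 4 * (\<integral>\<^sup>+x. ennreal ((f x)\<^sup>2) \<partial>lborel)"
proof -
  have "shift_sq f h \<le> (\<integral>\<^sup>+x. 2 * ennreal ((f (h + x))\<^sup>2) + 2 * ennreal ((f x)\<^sup>2) \<partial>lborel)"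
    unfolding shift_sq_def
  proof (rule nn_integral_mono)
    fix x
    have "(f (h + x) - f x)\<^sup>2 \<le> 2 * (f (h + x))\<^sup>2 + 2 * (f x)\<^sup>2"
      using power2_add_le[of "f (h + x)" "- f x"] by simp
    then have "ennreal ((f (h + x) - f x)\<^sup>2) \<le> ennreal (2 * (f (h + x))\<^sup>2 + 2 * (f x)\<^sup>2)" by (rule ennreal_leI)
    then show "ennreal ((f (h + x) - f x)\<^sup>2) \<le> 2 * ennreal ((f (h + x))\<^sup>2) + 2 * ennreal ((f x)\<^sup>2)"
      by (simp add: ennreal_mult ennreal_plus)
  qed
  also have "\<dots> = 2 * (\<integral>\<^sup>+x. ennreal ((f (h + x))\<^sup>2) \<partial>lborel) + 2 * (\<integral>\<^sup>+x. ennreal ((f x)\<^sup>2) \<partial>lborel)"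
    by (simp add: nn_integral_add nn_integral_cmult)
  also have "(\<integral>\<^sup>+x. ennreal ((f (h + x))\<^sup>2) \<partial>lborel) = (\<integral>\<^sup>+x. ennreal ((f x)\<^sup>2) \<partial>lborel)"
    by (rule nn_integral_translate) measurable
  finally show ?thesis by (simp add: distrib_right[symmetric])
qed

lemma segment_increment_le:
  assumes f: "f \<in> test_fun \<Omega>"
  shows "ennreal ((f (h + x) - f x)\<^sup>2) \<le> (\<integral>\<^sup>+t. ennreal ((norm h)\<^sup>2 * (norm (grad f (t *\<^sub>R h + x)))\<^sup>2) * indicator {0..1} t \<partial>lborel)"
proof -
  let ?d = "\<lambda>t. grad f (t *\<^sub>R h + x) \<bullet> h"
  have dc: "continuous_on UNIV ?d"
    by (intro continuous_intros continuous_on_compose2[OF test_fun_grad_continuous[OF f]]) auto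
  have dm [measurable]: "?d \<in> borel_measurable borel" by (rule borel_measurable_continuous_onI[OF dc])
  have der: "((\<lambda>t. f (t *\<^sub>R h + x)) has_real_derivative ?d t) (at t)" for t
  proof -
    have l: "((\<lambda>t. t *\<^sub>R h + x) has_derivative (\<lambda>r. r *\<^sub>R h)) (at t)"
      by (auto intro!: derivative_eq_intros)
    have "((\<lambda>t. f (t *\<^sub>R h + x)) has_derivative (\<lambda>r. grad f (t *\<^sub>R h + x) \<bullet> (r *\<^sub>R h))) (at t)"
      using has_derivative_compose[OF l has_derivative_grad[OF test_fun_differentiable[OF f]]] .
    then show ?thesis
      unfolding has_field_derivative_def by (rule has_derivative_eq_rhs) (simp add: fun_eq_iff)
  qed
  have "(\<integral>t. ?d t * indicator {0..1} t \<partial>lborel) = f (1 *\<^sub>R h + x) - f (0 *\<^sub>R h + x)"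
    using dc by (intro integral_FTC_Icc_real der) (auto simp: continuous_on_eq_continuous_at)
  then have eq: "f (h + x) - f x = (\<integral>t. ?d t * indicator {0..1} t \<partial>lborel)" by simp
  have int: "integrable lborel (\<lambda>t. ?d t * indicator {0..1} t)"
    using borel_integrable_atLeastAtMost[of 0 1 ?d] dc by (auto simp: continuous_on_eq_continuous_at)
  have "ennreal \<bar>f (h + x) - f x\<bar> \<le> (\<integral>\<^sup>+t. norm (?d t * indicator {0..1} t) \<partial>lborel)"
    unfolding eq real_norm_def[symmetric] by (rule integral_norm_bound_ennreal[OF int])
  also have "\<dots> = (\<integral>\<^sup>+t. (ennreal \<bar>?d t\<bar> * indicator {0..1} t) * indicator {0..1} t \<partial>lborel)"
    by (rule nn_integral_cong) (auto simp: indicator_def)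
  finally have "(ennreal \<bar>f (h + x) - f x\<bar>)\<^sup>2 \<le> (\<integral>\<^sup>+t. (ennreal \<bar>?d t\<bar> * indicator {0..1} t) * indicator {0..1} t \<partial>lborel)\<^sup>2"
    by (rule power_mono) simp
  also have "\<dots> \<le> (\<integral>\<^sup>+t. (ennreal \<bar>?d t\<bar> * indicator {0..1} t)\<^sup>2 \<partial>lborel) * (\<integral>\<^sup>+t. (indicator {0..1::real} t)\<^sup>2 \<partial>lborel)"
    by (rule Cauchy_Schwarz_nn_integral) measurable
  also have "(\<integral>\<^sup>+t. (indicator {0..1::real} t)\<^sup>2 \<partial>lborel) = (\<integral>\<^sup>+t. (indicator {0..1::real} t) \<partial>lborel)"
    by (rule nn_integral_cong) (auto simp: indicator_def)
  also have "\<dots> = 1" by simp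
  also have "(\<integral>\<^sup>+t. (ennreal \<bar>?d t\<bar> * indicator {0..1} t)\<^sup>2 \<partial>lborel) * 1
      \<le> (\<integral>\<^sup>+t. ennreal ((norm h)\<^sup>2 * (norm (grad f (t *\<^sub>R h + x)))\<^sup>2) * indicator {0..1} t \<partial>lborel)"
    unfolding mult_1_right
  proof (rule nn_integral_mono)
    fix t :: real
    have "\<bar>?d t\<bar>\<^sup>2 \<le> (norm (grad f (t *\<^sub>R h + x)) * norm h)\<^sup>2"
      by (rule power_mono[OF Cauchy_Schwarz_ineq2]) simp
    then show "(ennreal \<bar>?d t\<bar> * indicator {0..1} t)\<^sup>2 \<le> ennreal ((norm h)\<^sup>2 * (norm (grad f (t *\<^sub>R h + x)))\<^sup>2) * indicator {0..1} t"
      by (cases "t \<in> {0..1}") (simp_all add: ennreal_power ennreal_leI power_mult_distrib mult.commute)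
  qed
  finally show ?thesis by (simp add: ennreal_power)
qed

lemma shift_sq_le_grad:
  assumes f: "f \<in> test_fun \<Omega>"
  shows "shift_sq f h \<le> ennreal ((norm h)\<^sup>2) * (\<integral>\<^sup>+x. ennreal ((norm (grad f x))\<^sup>2) \<partial>lborel)"
proof -
  have [measurable]: "grad f \<in> borel_measurable borel"
    by (rule borel_measurable_continuous_onI[OF test_fun_grad_continuous[OF f]])
  have "shift_sq f h \<le> (\<integral>\<^sup>+x. (\<integral>\<^sup>+t. ennreal ((norm h)\<^sup>2 * (norm (grad f (t *\<^sub>R h + x)))\<^sup>2) * indicator {0..1::real} t \<partial>lborel) \<partial>lborel)"
    unfolding shift_sq_def by (intro nn_integral_mono segment_increment_le[OF f])
  also have "\<dots> = (\<integral>\<^sup>+t. (\<integral>\<^sup>+x. ennreal ((norm h)\<^sup>2 * (norm (grad f (t *\<^sub>R h + x)))\<^sup>2) * indicator {0..1::real} t \<partial>lborel) \<partial>lborel)"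
    by (rule lborel_pair.Fubini'[symmetric]) measurable
  also have "\<dots> = (\<integral>\<^sup>+t. (ennreal ((norm h)\<^sup>2) * (\<integral>\<^sup>+x. ennreal ((norm (grad f x))\<^sup>2) \<partial>lborel)) * indicator {0..1::real} t \<partial>lborel)"
  proof (rule nn_integral_cong)
    fix t :: real
    have "(\<integral>\<^sup>+x. ennreal ((norm h)\<^sup>2 * (norm (grad f (t *\<^sub>R h + x)))\<^sup>2) * indicator {0..1::real} t \<partial>lborel)
       = (\<integral>\<^sup>+x. (ennreal ((norm h)\<^sup>2) * ennreal ((norm (grad f (t *\<^sub>R h + x)))\<^sup>2)) * indicator {0..1::real} t \<partial>lborel)"
      by (simp add: ennreal_mult)
    also have "\<dots> = (ennreal ((norm h)\<^sup>2) * (\<integral>\<^sup>+x. ennreal ((norm (grad f (t *\<^sub>R h + x)))\<^sup>2) \<partial>lborel)) * indicator {0..1::real} t"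
      by (simp add: nn_integral_cmult nn_integral_multc)
    also have "(\<integral>\<^sup>+x. ennreal ((norm (grad f (t *\<^sub>R h + x)))\<^sup>2) \<partial>lborel) = (\<integral>\<^sup>+x. ennreal ((norm (grad f x))\<^sup>2) \<partial>lborel)"
      by (rule nn_integral_translate) measurable
    finally show "(\<integral>\<^sup>+x. ennreal ((norm h)\<^sup>2 * (norm (grad f (t *\<^sub>R h + x)))\<^sup>2) * indicator {0..1::real} t \<partial>lborel)
      = (ennreal ((norm h)\<^sup>2) * (\<integral>\<^sup>+x. ennreal ((norm (grad f x))\<^sup>2) \<partial>lborel)) * indicator {0..1::real} t" .
  qed
  also have "\<dots> = ennreal ((norm h)\<^sup>2) * (\<integral>\<^sup>+x. ennreal ((norm (grad f x))\<^sup>2) \<partial>lborel)"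
    by (simp add: nn_integral_cmult_indicator)
  finally show ?thesis .
qed


text \<open>
  The Poincare inequality: if the shift \<open>h\<close> is longer than the diameter of the ball, then \<open>f\<close> and its
  shift have disjoint supports, and \<open>shift_sq f h\<close> dominates the squared norm of \<open>f\<close>.
\<close>

lemma test_fun_poincare:
  assumes f: "f \<in> test_fun \<Omega>" and R: "\<Omega> \<subseteq> ball 0 R"
  shows "(\<integral>\<^sup>+x. ennreal ((f x)\<^sup>2) \<partial>lborel) \<le> ennreal (4 * R\<^sup>2) * (\<integral>\<^sup>+x. ennreal ((norm (grad f x))\<^sup>2) \<partial>lborel)"
proof -
  have [measurable]: "f \<in> borel_measurable borel"
    by (rule borel_measurable_continuous_onI[OF test_fun_continuous[OF f]])
  obtain h :: 'a where h: "norm h = 2 * \<bar>R\<bar>" using vector_choose_size[of "2 * \<bar>R\<bar>"] by auto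
  have "(\<integral>\<^sup>+x. ennreal ((f x)\<^sup>2) \<partial>lborel) \<le> shift_sq f h"
    unfolding shift_sq_def
  proof (rule nn_integral_mono)
    fix x
    have "f x = 0 \<or> f (h + x) = 0"
    proof (rule ccontr)
      assume *: "\<not> ?thesis"
      then have "x \<in> \<Omega>" "h + x \<in> \<Omega>" using fun_onD(2)[OF test_fun_fun_on[OF f]] by blast+
      then have "norm x < R" "norm (h + x) < R" using R by auto
      then show False using h norm_triangle_ineq4[of "h + x" x] by simp
    qed
    then show "ennreal ((f x)\<^sup>2) \<le> ennreal ((f (h + x) - f x)\<^sup>2)" by auto
  qed
  also have "\<dots> \<le> ennreal ((norm h)\<^sup>2) * (\<integral>\<^sup>+x. ennreal ((norm (grad f x))\<^sup>2) \<partial>lborel)"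
    by (rule shift_sq_le_grad[OF f])
  finally show ?thesis by (simp add: h power_mult_distrib)
qed

lemma gagliardo_le_grad:
  fixes \<Omega> :: "'a::euclidean_space set"
  assumes s: "0 < s" "s < 1" and \<Omega>: "bounded \<Omega>"
  shows "\<exists>C>0. \<forall>f\<in>test_fun \<Omega>. gagliardo s f \<le> ennreal C * grad_sq \<Omega> (grad f)"
proof -
  obtain R where R: "\<Omega> \<subseteq> ball 0 R" using \<Omega> bounded_subset_ballD[of \<Omega> 0] by blast
  let ?k = "\<lambda>h::'a. ennreal (min ((norm h)\<^sup>2) 1 * frac_kernel s h)"
  obtain k where k: "(\<integral>\<^sup>+h. ?k h \<partial>lborel) = ennreal k" "k \<ge> 0"
    using frac_kernel_integral_finite[OF s, where 'a='a] by (cases "\<integral>\<^sup>+h. ?k h \<partial>lborel") auto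
  define L where "L = max 1 (16 * R\<^sup>2)"
  have L: "L \<ge> 1" "L \<ge> 16 * R\<^sup>2" by (auto simp: L_def)
  have "gagliardo s f \<le> ennreal (L * k + 1) * grad_sq \<Omega> (grad f)" if f: "f \<in> test_fun \<Omega>" for f
  proof -
    have fm [measurable]: "f \<in> borel_measurable borel"
      by (rule borel_measurable_continuous_onI[OF test_fun_continuous[OF f]])
    let ?D = "\<integral>\<^sup>+x. ennreal ((norm (grad f x))\<^sup>2) \<partial>lborel"
    obtain K where K: "compact K" "K \<subseteq> \<Omega>" "\<forall>x. x \<notin> K \<longrightarrow> f x = 0" using test_fun_support[OF f] by blast
    have "grad_sq \<Omega> (grad f) = (\<integral>\<^sup>+x. ennreal ((norm (grad f x))\<^sup>2) \<partial>lebesgue)"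
      unfolding grad_sq_def
    proof (rule nn_integral_cong)
      fix x
      show "ennreal ((norm (grad f x))\<^sup>2) * indicator \<Omega> x = ennreal ((norm (grad f x))\<^sup>2)"
        using grad_eq_0_outside[OF K(1,3), of x] K(2) by (cases "x \<in> \<Omega>") auto
    qed
    then have D: "grad_sq \<Omega> (grad f) = ?D" by (simp add: nn_integral_completion)
    have shift: "shift_sq f h \<le> ennreal (L * min ((norm h)\<^sup>2) 1) * ?D" for h
    proof (cases "(norm h)\<^sup>2 \<le> 1")
      case True
      have "shift_sq f h \<le> ennreal ((norm h)\<^sup>2) * ?D" by (rule shift_sq_le_grad[OF f])
      also have "\<dots> \<le> ennreal (L * min ((norm h)\<^sup>2) 1) * ?D"
        using True mult_right_mono[OF L(1), of "(norm h)\<^sup>2"] by (intro mult_right_mono ennreal_leI) auto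
      finally show ?thesis .
    next
      case False
      have "shift_sq f h \<le> 4 * (\<integral>\<^sup>+x. ennreal ((f x)\<^sup>2) \<partial>lborel)" by (rule shift_sq_le_sq[OF fm])
      also have "\<dots> \<le> 4 * (ennreal (4 * R\<^sup>2) * ?D)" by (intro mult_left_mono test_fun_poincare[OF f R]) simp
      also have "\<dots> = ennreal (16 * R\<^sup>2) * ?D"
        using ennreal_mult[of 4 "4 * R\<^sup>2"] by (simp add: mult.assoc[symmetric])
      also have "\<dots> \<le> ennreal (L * min ((norm h)\<^sup>2) 1) * ?D"
        using False L(2) by (intro mult_right_mono ennreal_leI) auto
      finally show ?thesis .
    qed
    have "gagliardo s f = (\<integral>\<^sup>+h. ennreal (frac_kernel s h) * shift_sq f h \<partial>lborel)"
      by (rule gagliardo_eq_shift[OF fm])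
    also have "\<dots> \<le> (\<integral>\<^sup>+h. (ennreal L * ?k h) * ?D \<partial>lborel)"
    proof (rule nn_integral_mono)
      fix h :: 'a
      have "ennreal (frac_kernel s h) * shift_sq f h \<le> ennreal (frac_kernel s h) * (ennreal (L * min ((norm h)\<^sup>2) 1) * ?D)"
        by (intro mult_left_mono shift) simp
      also have "\<dots> = (ennreal (frac_kernel s h) * ennreal (L * min ((norm h)\<^sup>2) 1)) * ?D" by (simp add: mult.assoc)
      also have "ennreal (frac_kernel s h) * ennreal (L * min ((norm h)\<^sup>2) 1) = ennreal L * ?k h"
        using L(1) by (simp add: ennreal_mult[symmetric] mult_ac)
      finally show "ennreal (frac_kernel s h) * shift_sq f h \<le> (ennreal L * ?k h) * ?D" .
    qed
    also have "\<dots> = (\<integral>\<^sup>+h. ennreal L * ?k h \<partial>lborel) * ?D" by (rule nn_integral_multc) measurable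
    also have "(\<integral>\<^sup>+h. ennreal L * ?k h \<partial>lborel) = ennreal L * ennreal k"
      unfolding k(1)[symmetric] by (rule nn_integral_cmult) measurable
    also have "\<dots> = ennreal (L * k)" using L k by (simp add: ennreal_mult)
    also have "ennreal (L * k) * ?D \<le> ennreal (L * k + 1) * ?D" by (intro mult_right_mono ennreal_leI) auto
    finally show ?thesis by (simp add: D)
  qed
  moreover have "L * k + 1 > 0" using L k by (simp add: add_nonneg_pos)
  ultimately show ?thesis by blast
qed

text \<open>
  The exponent is the critical exponent of the fractional space.  It is below the critical exponent
  of the first-order space, so the embedding of that space into the fractional one suffices.
\<close>

theorem Y_space_sobolev:
  fixes \<Omega> :: "'a::euclidean_space set" and s :: real
  defines "p \<equiv> frac_crit_exp DIM('a) s"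
  assumes s: "0 < s" "s < 1" "2 * s < real DIM('a)" and \<Omega>: "open \<Omega>" "bounded \<Omega>"
  shows "\<exists>C>0. \<forall>v e. v \<in> Y_space \<Omega> \<longrightarrow> 0 \<le> e \<longrightarrow> grad_sq \<Omega> (weak_grad \<Omega> v) \<le> ennreal e \<longrightarrow>
     (\<integral>\<^sup>+x. ennreal (\<bar>v x\<bar> powr p) \<partial>lebesgue) \<le> ennreal ((C * e) powr (p / 2))"
proof -
  obtain C1 where C1: "C1 > 0" "\<forall>(\<Omega> :: 'a set) v e. bounded \<Omega> \<longrightarrow> v \<in> fun_on \<Omega> \<longrightarrow> 0 \<le> e \<longrightarrow> gagliardo s v \<le> ennreal e \<longrightarrow>
     (\<integral>\<^sup>+x. ennreal (\<bar>v x\<bar> powr p) \<partial>lebesgue) \<le> ennreal ((C1 * e) powr (p / 2))"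
    using frac_sobolev[OF s(1,3)] unfolding p_def by blast
  obtain C2 where C2: "C2 > 0" "\<forall>f\<in>test_fun \<Omega>. gagliardo s f \<le> ennreal C2 * grad_sq \<Omega> (grad f)"
    using gagliardo_le_grad[OF s(1,2) \<Omega>(2)] by blast
  have p: "p > 2" using frac_crit_exp_facts(1)[OF s(1,3)] by (simp add: p_def)
  have "(\<integral>\<^sup>+x. ennreal (\<bar>v x\<bar> powr p) \<partial>lebesgue) \<le> ennreal ((2 * C1 * C2 * e) powr (p / 2))"
    if v: "v \<in> Y_space \<Omega>" and e: "0 \<le> e" "grad_sq \<Omega> (weak_grad \<Omega> v) \<le> ennreal e" for v e
  proof -
    obtain G f where v': "v \<in> fun_on \<Omega>" "sq_integral v < \<infinity>" and
      G: "has_weak_gradient \<Omega> v G" "grad_sq \<Omega> G < \<infinity>"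
      and f: "\<And>n. f n \<in> test_fun \<Omega>" "(\<lambda>n. sq_integral (\<lambda>x. v x - f n x)) \<longlonglongrightarrow> 0"
        "(\<lambda>n. grad_sq \<Omega> (\<lambda>x. G x - grad (f n) x)) \<longlonglongrightarrow> 0"
      using v unfolding Y_space_iff[OF \<Omega>(1)] by blast
    have Ge: "grad_sq \<Omega> G \<le> ennreal e"
      using e(2) grad_sq_cong_AE[OF weak_grad_AE_eq[OF \<Omega>(1) G(1)]] by simp
    obtain r where r: "strict_mono r" "AE x in lebesgue. (\<lambda>n. f (r n) x) \<longlonglongrightarrow> v x"
      using L2_approx_AE_subseq[OF v' test_fun_fun_on[OF f(1)] f(2)] by blast
    let ?d = "\<lambda>n. grad_sq \<Omega> (\<lambda>x. G x - grad (f (r n)) x)"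
    have d0: "?d \<longlonglongrightarrow> 0" using LIMSEQ_subseq_LIMSEQ[OF f(3) r(1)] by (simp add: o_def)
    have "eventually (\<lambda>n. ?d n < 1) sequentially" using order_tendstoD(2)[OF d0, of 1] by simp
    then obtain M where M: "\<And>n. n \<ge> M \<Longrightarrow> ?d n < 1" unfolding eventually_sequentially by blast
    define \<delta> where "\<delta> n = enn2real (?d (n + M))" for n
    have \<delta>: "ennreal (\<delta> n) = ?d (n + M)" for n
      using less_trans[OF M[of "n + M"], of top] by (simp add: \<delta>_def)
    have \<delta>0: "\<delta> \<longlonglongrightarrow> 0"
      unfolding \<delta>_def by (rule tendsto_ennreal_0_real[OF LIMSEQ_ignore_initial_segment[OF d0]])
    have \<Omega>m: "\<Omega> \<in> sets lebesgue" using \<Omega>(1) by simp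
    have bound: "(\<integral>\<^sup>+x. ennreal (\<bar>f (r (n + M)) x\<bar> powr p) \<partial>lebesgue)
        \<le> ennreal ((C1 * (C2 * (2 * e + 2 * \<delta> n))) powr (p / 2))" for n
    proof -
      let ?f = "f (r (n + M))"
      have Gm: "(\<lambda>x. indicator \<Omega> x *\<^sub>R G x) \<in> borel_measurable lebesgue"
        by (rule weak_gradient_measurable[OF \<Omega>(1) G(1)])
      note m1 = norm_square_measurable[OF Gm]
      note m2 = norm_square_measurable[OF indicator_diff_grad_measurable[OF Gm \<Omega>m f(1)], of "r (n + M)"]
      have "grad_sq \<Omega> (grad ?f) \<le> (\<integral>\<^sup>+x. 2 * (ennreal ((norm (G x))\<^sup>2) * indicator \<Omega> x)
          + 2 * (ennreal ((norm (G x - grad ?f x))\<^sup>2) * indicator \<Omega> x) \<partial>lebesgue)"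
        unfolding grad_sq_def
      proof (rule nn_integral_mono)
        fix x
        have "norm (grad ?f x) \<le> norm (G x) + norm (G x - grad ?f x)"
          using norm_triangle_ineq4[of "G x" "G x - grad ?f x"] by simp
        then have "(norm (grad ?f x))\<^sup>2 \<le> (norm (G x) + norm (G x - grad ?f x))\<^sup>2" by (rule power_mono) simp
        also have "\<dots> \<le> 2 * (norm (G x))\<^sup>2 + 2 * (norm (G x - grad ?f x))\<^sup>2"
          by (rule power2_add_le)
        finally have "ennreal ((norm (grad ?f x))\<^sup>2) \<le> ennreal (2 * (norm (G x))\<^sup>2 + 2 * (norm (G x - grad ?f x))\<^sup>2)"
          by (rule ennreal_leI)
        also have "\<dots> = 2 * ennreal ((norm (G x))\<^sup>2) + 2 * ennreal ((norm (G x - grad ?f x))\<^sup>2)"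
          by (subst ennreal_plus) (simp_all add: ennreal_mult)
        finally show "ennreal ((norm (grad ?f x))\<^sup>2) * indicator \<Omega> x \<le> 2 * (ennreal ((norm (G x))\<^sup>2) * indicator \<Omega> x)
          + 2 * (ennreal ((norm (G x - grad ?f x))\<^sup>2) * indicator \<Omega> x)"
          by (cases "x \<in> \<Omega>") simp_all
      qed
      also have "\<dots> = 2 * grad_sq \<Omega> G + 2 * ?d (n + M)"
        unfolding grad_sq_def using m1 m2 by (subst nn_integral_add) (auto simp: nn_integral_cmult)
      also have "\<dots> \<le> 2 * ennreal e + 2 * ennreal (\<delta> n)"
        unfolding \<delta> by (intro add_mono mult_left_mono Ge) auto
      also have "\<dots> = ennreal (2 * e + 2 * \<delta> n)"
        using e(1) by (simp add: ennreal_mult \<delta>_def)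
      finally have g: "grad_sq \<Omega> (grad ?f) \<le> ennreal (2 * e + 2 * \<delta> n)" .
      have "gagliardo s ?f \<le> ennreal C2 * grad_sq \<Omega> (grad ?f)" using C2(2) f(1) by blast
      also have "\<dots> \<le> ennreal C2 * ennreal (2 * e + 2 * \<delta> n)" by (intro mult_left_mono g) simp
      also have "\<dots> = ennreal (C2 * (2 * e + 2 * \<delta> n))" using C2(1) e(1) by (simp add: ennreal_mult \<delta>_def)
      finally have "gagliardo s ?f \<le> ennreal (C2 * (2 * e + 2 * \<delta> n))" .
      moreover have "0 \<le> C2 * (2 * e + 2 * \<delta> n)" using C2(1) e(1) by (simp add: \<delta>_def)
      ultimately show ?thesis using C1(2) \<Omega>(2) test_fun_fun_on[OF f(1)] by blast
    qed
    show ?thesis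
    proof (rule nn_integral_le_limit[OF _ _ bound])
      have "f n \<in> borel_measurable lebesgue" for n by (rule fun_onD(1)[OF test_fun_fun_on[OF f(1)]])
      then show "(\<lambda>x. ennreal (\<bar>f (r (n + M)) x\<bar> powr p)) \<in> borel_measurable lebesgue" for n by measurable
      show "AE x in lebesgue. (\<lambda>n. ennreal (\<bar>f (r (n + M)) x\<bar> powr p)) \<longlonglongrightarrow> ennreal (\<bar>v x\<bar> powr p)"
        using r(2)
      proof eventually_elim
        case (elim x)
        have *: "(\<lambda>n. \<bar>f (r (n + M)) x\<bar>) \<longlonglongrightarrow> \<bar>v x\<bar>"
          by (intro tendsto_rabs LIMSEQ_ignore_initial_segment[OF elim])
        show ?case
          using p by (intro tendsto_ennrealI tendsto_powr2[OF * tendsto_const]) auto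
      qed
      have "(\<lambda>n. (C1 * (C2 * (2 * e + 2 * \<delta> n))) powr (p / 2)) \<longlonglongrightarrow> (C1 * (C2 * (2 * e + 2 * 0))) powr (p / 2)"
      proof (rule tendsto_powr2)
        show "\<forall>\<^sub>F n in sequentially. 0 \<le> C1 * (C2 * (2 * e + 2 * \<delta> n))"
          using C1(1) C2(1) e(1) by (simp add: \<delta>_def)
        show "(\<lambda>n. C1 * (C2 * (2 * e + 2 * \<delta> n))) \<longlonglongrightarrow> C1 * (C2 * (2 * e + 2 * 0))"
          by (intro tendsto_intros \<delta>0)
      qed (use p in auto)
      then show "(\<lambda>n. ennreal ((C1 * (C2 * (2 * e + 2 * \<delta> n))) powr (p / 2))) \<longlonglongrightarrow> ennreal ((2 * C1 * C2 * e) powr (p / 2))"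
        by (intro tendsto_ennrealI) (simp add: mult_ac)
    qed
  qed
  moreover have "2 * C1 * C2 > 0" using C1(1) C2(1) by simp
  ultimately show ?thesis by blast
qed

section \<open>De Giorgi iteration\<close>

text \<open>
  Fast geometric convergence: a superlinear recursion with geometrically growing factor forces
  geometric decay, provided that the initial term is at most \<open>a\<close>.
\<close>

lemma de_giorgi_sequence:
  fixes A :: "nat \<Rightarrow> ennreal" and C b q a \<theta> :: real
  assumes C: "C > 0" and b: "b > 0" and q: "q > 1" and a: "a > 0"
    and \<theta>: "\<theta> = b powr (- q / (q - 1))" and small: "C powr q * a powr (q - 1) \<le> \<theta>"
    and A0: "A 0 \<le> ennreal a"
    and step: "\<And>j B. 0 \<le> B \<Longrightarrow> A j \<le> ennreal B \<Longrightarrow> A (Suc j) \<le> ennreal ((C * b ^ j * B) powr q)"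
  shows "A j \<le> ennreal (a * \<theta> ^ j)"
proof (induction j)
  case 0
  then show ?case using A0 by simp
next
  case (Suc j)
  have \<theta>0: "\<theta> > 0" using b by (simp add: \<theta>)
  have "(b * \<theta>) powr q = b powr (q + (- q / (q - 1)) * q)"
    using powr_add[of b q "- (q * q / (q - 1))"] by (simp add: powr_mult \<theta> powr_powr)
  also have "q + (- q / (q - 1)) * q = - q / (q - 1)" using q by (simp add: field_simps)
  finally have b\<theta>: "(b * \<theta>) powr q = \<theta>" by (simp add: \<theta>)
  have "(C * b ^ j * (a * \<theta> ^ j)) powr q = (C * a * (b * \<theta>) ^ j) powr q"
    by (simp add: power_mult_distrib mult_ac)
  also have "\<dots> = C powr q * a powr q * ((b * \<theta>) ^ j) powr q" by (simp add: powr_mult)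
  also have "((b * \<theta>) ^ j) powr q = ((b * \<theta>) powr q) ^ j"
    using b \<theta>0 by (simp add: powr_realpow[symmetric] powr_powr mult.commute)
  also have "\<dots> = \<theta> ^ j" by (simp add: b\<theta>)
  also have "a powr q = a powr (q - 1) * a"
    using a powr_add[of a "q - 1" 1] by simp
  also have "C powr q * (a powr (q - 1) * a) * \<theta> ^ j = (C powr q * a powr (q - 1)) * (a * \<theta> ^ j)" by simp
  also have "\<dots> \<le> \<theta> * (a * \<theta> ^ j)" using a \<theta>0 by (intro mult_right_mono small) simp
  finally have "(C * b ^ j * (a * \<theta> ^ j)) powr q \<le> a * \<theta> ^ Suc j" by (simp add: mult_ac)
  moreover have "A (Suc j) \<le> ennreal ((C * b ^ j * (a * \<theta> ^ j)) powr q)"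
    using a \<theta>0 by (intro step Suc.IH) simp
  ultimately show ?case by (meson ennreal_leI order_trans)
qed

text \<open>
  Boundedness from level estimates.  The right-hand side of the level estimate has the growth of
  the left-hand side, \<open>w powr p\<close>, so no constant becomes small by itself.  Instead the iteration is
  started at a level \<open>m\<close> where the \<open>p\<close>-th power integral of the excess is as small as \<open>de_giorgi_sequence\<close>
  demands; it then runs through levels between \<open>m\<close> and \<open>2 * m\<close>.
\<close>

theorem de_giorgi_bounded:
  fixes w :: "'b \<Rightarrow> real" and p K :: real
  assumes p: "p > 2" and K: "K > 0"
    and w [measurable]: "w \<in> borel_measurable M"
    and fin: "(\<integral>\<^sup>+x. ennreal ((max 0 (w x)) powr p) \<partial>M) < \<infinity>"
    and level: "\<And>h k B. 1 \<le> h \<Longrightarrow> h < k \<Longrightarrow> 0 \<le> B \<Longrightarrow>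
      (\<integral>\<^sup>+x. ennreal ((max 0 (w x)) powr (p - 1) * max 0 (w x - h)) \<partial>M) \<le> ennreal B \<Longrightarrow>
      (\<integral>\<^sup>+x. ennreal ((max 0 (w x - k)) powr p) \<partial>M) \<le> ennreal ((K * B) powr (p / 2))"
  shows "\<exists>L. AE x in M. w x \<le> L"
proof -
  define P where "P k = (\<integral>\<^sup>+x. ennreal ((max 0 (w x - k)) powr p) \<partial>M)" for k
  define b where "b = 2 powr (p - 1)"
  define q where "q = p / 2"
  define C where "C = K * b ^ 4"
  define \<theta> where "\<theta> = b powr (- q / (q - 1))"
  have b: "b > 1" using p powr_less_mono[of 0 "p - 1" 2] by (simp add: b_def)
  have q: "q > 1" using p by (simp add: q_def)
  have C: "C > 0" using K b by (simp add: C_def)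
  have \<theta>0: "\<theta> > 0" using b by (simp add: \<theta>_def)
  have \<theta>1: "\<theta> < 1" using b q by (simp add: \<theta>_def powr_less_one)
  \<comment> \<open>the largest initial value that \<open>de_giorgi_sequence\<close> allows\<close>
  define a where "a = (\<theta> / C powr q) powr (1 / (q - 1))"
  have a: "a > 0" using \<theta>0 C by (simp add: a_def)
  have small: "C powr q * a powr (q - 1) \<le> \<theta>"
    using \<theta>0 C q by (simp add: a_def powr_powr)
  have "(\<lambda>n. P (real n)) \<longlonglongrightarrow> (\<integral>\<^sup>+x. 0 \<partial>M)"
    unfolding P_def
  proof (rule nn_integral_dominated_convergence[where w="\<lambda>x. ennreal ((max 0 (w x)) powr p)"])
    show "AE x in M. ennreal (max 0 (w x - real n) powr p) \<le> ennreal (max 0 (w x) powr p)" for n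
      using p by (intro AE_I2 ennreal_leI powr_mono2) auto
    show "AE x in M. (\<lambda>n. ennreal (max 0 (w x - real n) powr p)) \<longlonglongrightarrow> 0"
    proof (rule AE_I2)
      fix x
      obtain k :: nat where k: "w x \<le> real k" using real_arch_simple by blast
      have "ennreal (max 0 (w x - real n) powr p) = 0" if "n \<ge> k" for n
        using k that by (simp add: max_def)
      then show "(\<lambda>n. ennreal (max 0 (w x - real n) powr p)) \<longlonglongrightarrow> 0"
        by (intro tendsto_eventually) (auto simp: eventually_sequentially)
    qed
  qed (use fin in auto)
  then have "eventually (\<lambda>n. P (real n) < ennreal a) sequentially"
    using a by (intro order_tendstoD(2)) auto
  then obtain N where N: "\<And>n. n \<ge> N \<Longrightarrow> P (real n) < ennreal a"
    unfolding eventually_sequentially by blast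
  define m where "m = real (max 1 N)"
  have m: "m \<ge> 1" "P m \<le> ennreal a" using N[of "max 1 N"] by (auto simp: m_def)
  define k where "k j = m * (2 - (1 / 2) ^ j)" for j :: nat
  have kdiff: "k (Suc j) - k j = m * (1 / 2) ^ Suc j" for j by (simp add: k_def algebra_simps)
  have k1: "k j \<ge> m" for j
    using m(1) power_le_one[of "1/2::real" j] mult_left_mono[of 1 "2 - (1/2)^j" m] by (simp add: k_def)
  have k2: "k j \<le> 2 * m" for j using m(1) by (simp add: k_def algebra_simps)
  have decay: "P (k j) \<le> ennreal (a * \<theta> ^ j)" for j
  proof (rule de_giorgi_sequence[OF C _ q a \<theta>_def small])
    show "b > 0" using b by simp
    show "P (k 0) \<le> ennreal a" using m(2) by (simp add: k_def)
    fix j B assume B: "0 \<le> B" "P (k j) \<le> ennreal B"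
    \<comment> \<open>The level estimate loses the strip between \<open>h\<close> and \<open>k (Suc j)\<close>; the strip between \<open>k j\<close> and \<open>h\<close> bounds \<open>w\<close> by a multiple of \<open>w - k j\<close>.\<close>
    define h where "h = (k j + k (Suc j)) / 2"
    have hk: "h - k j = m * (1 / 2) ^ (j + 2)" using kdiff[of j] by (simp add: h_def field_simps)
    have pos: "m * (1 / 2) ^ (j + 2) > 0" using m(1) by simp
    have "k (Suc j) > k j" using kdiff[of j] m(1) by (smt (verit) zero_less_power zero_less_divide_1_iff mult_pos_pos)
    then have h: "1 \<le> h" "h < k (Suc j)" "k j < h" using k1[of j] m(1) by (auto simp: h_def)
    have pw: "(max 0 (w x)) powr (p - 1) * max 0 (w x - h) \<le> b ^ (j + 4) * (max 0 (w x - k j)) powr p" for x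
    proof (cases "w x > h")
      case False
      then show ?thesis using b by simp
    next
      case True
      define y where "y = w x - k j"
      have y: "y > 0" "y \<ge> m * (1 / 2) ^ (j + 2)" using True h(3) hk by (auto simp: y_def)
      have "m \<le> 2 ^ (j + 2) * y" using y(2) by (simp add: field_simps power_divide)
      moreover have "y \<le> 2 ^ (j + 2) * y" 
        using y(1) mult_right_mono[OF one_le_power[of "2::real" "j + 2"], of y] by simp
      moreover have "w x \<le> y + 2 * m" using k2[of j] by (simp add: y_def)
      moreover have "4 * (2 ^ (j + 2) * y) = 2 ^ (j + 4) * y" by (simp add: power_add)
      moreover have "0 \<le> 2 ^ (j + 2) * y" using y(1) by simp
      ultimately have "w x \<le> 2 ^ (j + 4) * y" by linarith
      then have "(w x) powr (p - 1) \<le> (2 ^ (j + 4) * y) powr (p - 1)"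
        using True h p by (intro powr_mono2) auto
      also have "\<dots> = b ^ (j + 4) * y powr (p - 1)"
        by (simp add: b_def powr_mult powr_powr powr_realpow[symmetric] mult.commute flip: powr_realpow)
      finally have "(w x) powr (p - 1) * (w x - h) \<le> (b ^ (j + 4) * y powr (p - 1)) * y"
        using True h b by (intro mult_mono) (auto simp: y_def)
      also have "\<dots> = b ^ (j + 4) * y powr p" using y(1) powr_add[of y "p - 1" 1] by simp
      finally show ?thesis using True h y(1) by (simp add: y_def max_def)
    qed
    have "(\<integral>\<^sup>+x. ennreal ((max 0 (w x)) powr (p - 1) * max 0 (w x - h)) \<partial>M)
        \<le> (\<integral>\<^sup>+x. ennreal (b ^ (j + 4)) * ennreal ((max 0 (w x - k j)) powr p) \<partial>M)"
      using pw b by (intro nn_integral_mono) (simp add: ennreal_leI flip: ennreal_mult)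
    also have "\<dots> = ennreal (b ^ (j + 4)) * P (k j)"
      unfolding P_def by (rule nn_integral_cmult) measurable
    also have "\<dots> \<le> ennreal (b ^ (j + 4)) * ennreal B" by (intro mult_left_mono B(2)) simp
    also have "\<dots> = ennreal (b ^ (j + 4) * B)" using B(1) b by (simp add: ennreal_mult)
    finally have "P (k (Suc j)) \<le> ennreal ((K * (b ^ (j + 4) * B)) powr (p / 2))"
      unfolding P_def using B(1) b by (intro level[OF h(1,2)]) simp_all
    also have "K * (b ^ (j + 4) * B) = C * b ^ j * B" by (simp add: C_def power_add mult_ac)
    finally show "P (k (Suc j)) \<le> ennreal ((C * b ^ j * B) powr q)" by (simp add: q_def)
  qed
  have mono: "P (2 * m) \<le> P (k j)" for j
    unfolding P_def using p k2[of j] by (intro nn_integral_mono ennreal_leI powr_mono2) auto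
  have "(\<lambda>j. ennreal (a * \<theta> ^ j)) \<longlonglongrightarrow> ennreal (a * 0)"
    using \<theta>0 \<theta>1 by (intro tendsto_ennrealI tendsto_mult tendsto_const LIMSEQ_power_zero) auto
  then have "P (2 * m) \<le> ennreal (a * 0)"
    by (rule Lim_bounded2[where N=0]) (use mono decay order_trans in blast)
  then have "P (2 * m) = 0" by simp
  then have "AE x in M. ennreal ((max 0 (w x - 2 * m)) powr p) = 0"
    unfolding P_def by (subst (asm) nn_integral_0_iff_AE) auto
  then have "AE x in M. w x \<le> 2 * m"
  proof (rule eventually_mono)
    fix x assume "ennreal ((max 0 (w x - 2 * m)) powr p) = 0"
    then have "max 0 (w x - 2 * m) powr p = 0" by (simp add: ennreal_eq_0_iff)
    then show "w x \<le> 2 * m" by (simp add: max_def split: if_splits)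
  qed
  then show ?thesis by blast
qed

section \<open>Smooth truncations of a weak solution\<close>

text \<open>
  A smooth substitute for the part of \<open>t\<close> above \<open>h\<close> (for \<open>\<sigma> = 1\<close>) or below \<open>- h\<close> (for \<open>\<sigma> = - 1\<close>).  Up to the
  sign, it lies between the excess over \<open>k\<close> and the excess over \<open>h\<close>.
\<close>

definition ramp :: "real \<Rightarrow> real \<Rightarrow> real \<Rightarrow> real \<Rightarrow> real" where
  "ramp \<sigma> h k t = \<sigma> * (k - h) * smooth_ramp ((\<sigma> / (k - h)) * t + - h / (k - h))"

definition ramp_deriv :: "real \<Rightarrow> real \<Rightarrow> real \<Rightarrow> real \<Rightarrow> real" where
  "ramp_deriv \<sigma> h k t = smooth_ramp_deriv ((\<sigma> / (k - h)) * t + - h / (k - h))"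

lemma ramp_truncation:
  assumes "\<sigma> = 1 \<or> \<sigma> = -1" "0 \<le> h" "h < k"
  shows "truncation (ramp \<sigma> h k) (ramp_deriv \<sigma> h k)"
  unfolding truncation_def
proof (intro conjI allI)
  show "smooth (ramp \<sigma> h k)"
    unfolding ramp_def[abs_def] by (intro smooth_cmult smooth_affine_comp smooth_smooth_ramp)
  have "smooth_ramp (- h / (k - h)) = 0" using assms by (intro smooth_ramp_bounds(4)) (simp add: divide_nonpos_pos)
  then show "ramp \<sigma> h k 0 = 0" by (simp add: ramp_def)
  fix t
  have kh: "k - h \<noteq> 0" using assms(3) by simp
  have "\<sigma> * (k - h) * (smooth_ramp_deriv ((\<sigma> / (k - h)) * t + - h / (k - h)) * (\<sigma> / (k - h))) = ramp_deriv \<sigma> h k t"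
    using assms(1) kh by (auto simp: ramp_deriv_def)
  moreover have "(ramp \<sigma> h k has_real_derivative
     \<sigma> * (k - h) * (smooth_ramp_deriv ((\<sigma> / (k - h)) * t + - h / (k - h)) * (\<sigma> / (k - h)))) (at t)"
    unfolding ramp_def[abs_def]
    using kh by (intro DERIV_cmult DERIV_chain2[OF DERIV_smooth_ramp]) (auto intro!: derivative_eq_intros)
  ultimately show "(ramp \<sigma> h k has_real_derivative ramp_deriv \<sigma> h k t) (at t)" by simp
  show "0 \<le> ramp_deriv \<sigma> h k t" "ramp_deriv \<sigma> h k t \<le> 1"
    by (simp_all add: ramp_deriv_def smooth_ramp_deriv_bounds)
qed

lemma ramp_bounds:
  assumes \<sigma>: "\<sigma> = 1 \<or> \<sigma> = -1" and h: "h < k"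
  shows "max 0 (\<sigma> * t - k) \<le> \<sigma> * ramp \<sigma> h k t" "\<sigma> * ramp \<sigma> h k t \<le> max 0 (\<sigma> * t - h)"
proof -
  define y where "y = (\<sigma> / (k - h)) * t + - h / (k - h)"
  have "y = (\<sigma> * t - h) / (k - h)" by (simp add: y_def diff_divide_distrib)
  then have y: "(k - h) * y = \<sigma> * t - h" using h by simp
  have "\<sigma> * \<sigma> = 1" using \<sigma> by auto
  then have eq: "\<sigma> * ramp \<sigma> h k t = (k - h) * smooth_ramp y"
    by (simp add: ramp_def y_def mult.assoc[symmetric])
  have "(k - h) * (y - 1) \<le> (k - h) * smooth_ramp y" "0 \<le> (k - h) * smooth_ramp y"
    using h smooth_ramp_bounds(1,3)[of y] by (auto intro: mult_left_mono)
  then show "max 0 (\<sigma> * t - k) \<le> \<sigma> * ramp \<sigma> h k t"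
    unfolding eq using y by (simp add: algebra_simps)
  have "(k - h) * smooth_ramp y \<le> (k - h) * max 0 y"
    using h smooth_ramp_bounds(2)[of y] by (intro mult_left_mono) auto
  also have "\<dots> = max 0 (\<sigma> * t - h)" using h by (simp add: max_mult_distrib_left y)
  finally show "\<sigma> * ramp \<sigma> h k t \<le> max 0 (\<sigma> * t - h)" unfolding eq .
qed

lemma truncation_Z_space:
  assumes \<Omega>: "open \<Omega>" and g: "truncation g g'" and u: "u \<in> Z_space \<Omega> s a b" and ab: "a \<ge> 0" "b \<ge> 0"
  shows "(\<lambda>x. g (u x)) \<in> Z_space \<Omega> s a b"
proof -
  let ?v = "\<lambda>x. g (u x)"
  have fo: "?v \<in> fun_on \<Omega>" using truncation_fun_on[OF g, of u \<Omega>] u by (simp add: Z_space_def)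
  have X: "?v \<in> X_space \<Omega> s" if "a > 0" using truncation_X_space[OF g, of u \<Omega> s] u that by (simp add: Z_space_def)
  have Y: "?v \<in> Y_space \<Omega>" if "b > 0" using truncation_Y_space(1)[OF \<Omega> g, of u] u that by (simp add: Z_space_def)
  have "ennreal a * (frac_seminorm \<Omega> s ?v)\<^sup>2 < \<infinity>"
  proof (cases "a > 0")
    case True
    then show ?thesis
      using X[OF True] by (simp add: frac_seminorm_eq[OF fo] enn_sqrt_power2 X_space_iff ennreal_mult_less_top)
  qed (use ab in simp)
  moreover have "ennreal b * (grad_seminorm \<Omega> ?v)\<^sup>2 < \<infinity>"
  proof (cases "b > 0")
    case True
    then obtain G where "has_weak_gradient \<Omega> ?v G" "grad_sq \<Omega> G < \<infinity>"
      using Y[OF True] unfolding Y_space_iff[OF \<Omega>] by blast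
    then show ?thesis by (simp add: grad_seminorm_eq[OF \<Omega>] enn_sqrt_power2 ennreal_mult_less_top)
  qed (use ab in simp)
  ultimately show ?thesis using fo X Y by (simp add: Z_space_def Z_energy_def)
qed

lemma nn_integral_le_integral:
  fixes f g :: "'b \<Rightarrow> real"
  assumes [measurable]: "f \<in> borel_measurable M" "g \<in> borel_measurable M"
    and fg: "AE x in M. 0 \<le> g x \<and> g x \<le> f x" and fin: "(\<integral>\<^sup>+x. ennreal (f x) \<partial>M) < \<infinity>"
  shows "(\<integral>\<^sup>+x. ennreal (g x) \<partial>M) \<le> ennreal (\<integral>x. f x \<partial>M)" "0 \<le> (\<integral>x. f x \<partial>M)"
proof -
  have f0: "AE x in M. 0 \<le> f x" using fg by (rule eventually_mono) auto
  have int: "integrable M f" by (rule integrableI_nonneg[OF _ f0 fin]) measurable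
  have "(\<integral>\<^sup>+x. ennreal (g x) \<partial>M) \<le> (\<integral>\<^sup>+x. ennreal (f x) \<partial>M)"
  proof (rule nn_integral_mono_AE)
    show "AE x in M. ennreal (g x) \<le> ennreal (f x)" using fg by (rule eventually_mono) (simp add: ennreal_leI)
  qed
  also have "\<dots> = ennreal (\<integral>x. f x \<partial>M)" by (rule nn_integral_eq_integral[OF int f0])
  finally show "(\<integral>\<^sup>+x. ennreal (g x) \<partial>M) \<le> ennreal (\<integral>x. f x \<partial>M)" .
  show "0 \<le> (\<integral>x. f x \<partial>M)" by (rule integral_nonneg_AE[OF f0])
qed

lemma integral_le_of_nn_integral:
  fixes f :: "'b \<Rightarrow> real"
  assumes int: "integrable M f" and le: "(\<integral>\<^sup>+x. ennreal (f x) \<partial>M) \<le> ennreal B" and B: "B \<ge> 0"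
  shows "(\<integral>x. f x \<partial>M) \<le> B"
proof -
  have i: "integrable M (\<lambda>x. max 0 (f x))" using int by simp
  have "(\<integral>x. f x \<partial>M) \<le> (\<integral>x. max 0 (f x) \<partial>M)" by (rule integral_mono[OF int i]) simp
  also have "\<dots> \<le> B"
  proof -
    have "ennreal (\<integral>x. max 0 (f x) \<partial>M) = (\<integral>\<^sup>+x. ennreal (max 0 (f x)) \<partial>M)"
      by (rule nn_integral_eq_integral[OF i, symmetric]) simp
    also have "\<dots> = (\<integral>\<^sup>+x. ennreal (f x) \<partial>M)"
      by (rule nn_integral_cong) (simp add: max_def ennreal_neg)
    also note le
    finally show ?thesis using B by (subst (asm) ennreal_le_iff) auto
  qed
  finally show ?thesis .
qed

text \<open>
  Tested with \<open>g u\<close>, the bilinear form dominates the energy of \<open>g u\<close>, since \<open>g\<close> has slopes in \<open>[0, 1]\<close>.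
\<close>

lemma truncation_frac_form:
  assumes g: "truncation g g'" and u: "u \<in> X_space \<Omega> s"
  defines "I \<equiv> LINT z:Q_set \<Omega>|lebesgue. (u (fst z) - u (snd z)) * (g (u (fst z)) - g (u (snd z))) /
               norm (fst z - snd z) powr (real DIM('a::euclidean_space) + 2 * s)"
  shows "gagliardo s (\<lambda>x::'a. g (u x)) \<le> ennreal I" "0 \<le> I"
proof -
  have u': "u \<in> fun_on \<Omega>" "gagliardo s u < \<infinity>" using u by (auto simp: X_space_iff)
  note [measurable] = truncation_measurable[OF g] fun_onD(1)[OF u'(1)]
  let ?f = "\<lambda>z. (u (fst z) - u (snd z)) * (g (u (fst z)) - g (u (snd z))) * frac_kernel s (fst z - snd z)"
  have I: "I = (\<integral>z. ?f z \<partial>lebesgue)"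
    unfolding I_def set_lebesgue_integral_def
    by (rule Bochner_Integration.integral_cong)
      (use fun_onD(2)[OF u'(1)] in \<open>auto simp: indicator_def Q_set_def frac_kernel_def\<close>)
  have "(\<integral>\<^sup>+z. ennreal (?f z) \<partial>lebesgue) \<le> gagliardo s u"
    unfolding gagliardo_def
    by (intro nn_integral_mono ennreal_leI mult_right_mono truncation_increment_square(2)[OF g]) simp
  then have fin: "(\<integral>\<^sup>+z. ennreal (?f z) \<partial>lebesgue) < \<infinity>" using u'(2) by (rule le_less_trans)
  have AE: "AE z in lebesgue. 0 \<le> (g (u (fst z)) - g (u (snd z)))\<^sup>2 * frac_kernel s (fst z - snd z) \<and>
      (g (u (fst z)) - g (u (snd z)))\<^sup>2 * frac_kernel s (fst z - snd z) \<le> ?f z"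
    by (intro AE_I2 conjI mult_right_mono truncation_increment_square(1)[OF g]) auto
  show "gagliardo s (\<lambda>x::'a. g (u x)) \<le> ennreal I" "0 \<le> I"
    unfolding gagliardo_def I by (rule nn_integral_le_integral[OF _ _ AE fin], measurable)+
qed

lemma truncation_grad_form:
  fixes u :: "'a::euclidean_space \<Rightarrow> real"
  assumes \<Omega>: "open \<Omega>" and g: "truncation g g'" and u: "u \<in> Y_space \<Omega>"
  defines "I \<equiv> LINT x:\<Omega>|lebesgue. weak_grad \<Omega> u x \<bullet> weak_grad \<Omega> (\<lambda>x. g (u x)) x"
  shows "grad_sq \<Omega> (weak_grad \<Omega> (\<lambda>x. g (u x))) \<le> ennreal I" "0 \<le> I"
proof -
  obtain G where u': "u \<in> fun_on \<Omega>" and G: "has_weak_gradient \<Omega> u G" "grad_sq \<Omega> G < \<infinity>"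
    using u unfolding Y_space_iff[OF \<Omega>] by blast
  note [measurable] = truncation_measurable[OF g] fun_onD(1)[OF u']
  have \<Omega>m: "\<Omega> \<in> sets lebesgue" using \<Omega> by simp
  have Gm: "(\<lambda>x. indicator \<Omega> x *\<^sub>R G x) \<in> borel_measurable lebesgue"
    by (rule weak_gradient_measurable[OF \<Omega> G(1)])
  have nm: "(\<lambda>x. (norm (indicator \<Omega> x *\<^sub>R G x))\<^sup>2) \<in> borel_measurable lebesgue"
    by (intro borel_measurable_power measurable_compose[OF Gm borel_measurable_norm])
  have gm: "(\<lambda>x. g' (u x)) \<in> borel_measurable lebesgue" by measurable
  let ?n = "\<lambda>x. (norm (indicator \<Omega> x *\<^sub>R G x))\<^sup>2"
  have AE1: "AE x in lebesgue. x \<in> \<Omega> \<longrightarrow> weak_grad \<Omega> u x = G x" by (rule weak_grad_AE_eq[OF \<Omega> G(1)])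
  note AE2 = truncation_Y_space(2)[OF \<Omega> g u]
  have n2: "v \<bullet> v = (norm v)\<^sup>2" for v :: 'a by (rule power2_norm_eq_inner[symmetric])
  have AEI: "AE x in lebesgue. g' (u x) * ?n x = indicator \<Omega> x *\<^sub>R (weak_grad \<Omega> u x \<bullet> weak_grad \<Omega> (\<lambda>x. g (u x)) x)"
    using AE1 AE2 by eventually_elim (auto simp: indicator_def n2)
  have fm: "(\<lambda>x. g' (u x) * ?n x) \<in> borel_measurable lebesgue" by (rule borel_measurable_times[OF gm nm])
  have wgm: "(\<lambda>x. indicator \<Omega> x *\<^sub>R weak_grad \<Omega> v x) \<in> borel_measurable lebesgue" if v: "v \<in> Y_space \<Omega>" for v
  proof -
    obtain H where H: "has_weak_gradient \<Omega> v H" using v unfolding Y_space_iff[OF \<Omega>] by blast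
    have "has_weak_gradient \<Omega> v (weak_grad \<Omega> v)"
      unfolding weak_grad_def by (rule someI[where P="has_weak_gradient \<Omega> v", OF H])
    then show ?thesis by (rule weak_gradient_measurable[OF \<Omega>])
  qed
  have "(\<lambda>x. indicator \<Omega> x *\<^sub>R (weak_grad \<Omega> u x \<bullet> weak_grad \<Omega> (\<lambda>x. g (u x)) x))
      = (\<lambda>x. (indicator \<Omega> x *\<^sub>R weak_grad \<Omega> u x) \<bullet> (indicator \<Omega> x *\<^sub>R weak_grad \<Omega> (\<lambda>x. g (u x)) x))"
    by (auto simp: indicator_def fun_eq_iff)
  then have wm: "(\<lambda>x. indicator \<Omega> x *\<^sub>R (weak_grad \<Omega> u x \<bullet> weak_grad \<Omega> (\<lambda>x. g (u x)) x)) \<in> borel_measurable lebesgue"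
    using borel_measurable_inner[OF wgm[OF u] wgm[OF truncation_Y_space(1)[OF \<Omega> g u]]] by (simp only:)
  have I: "I = (\<integral>x. g' (u x) * ?n x \<partial>lebesgue)"
    unfolding I_def set_lebesgue_integral_def
    by (rule integral_cong_AE[symmetric, OF fm wm AEI])
  have fin: "(\<integral>\<^sup>+x. ennreal (g' (u x) * ?n x) \<partial>lebesgue) < \<infinity>"
  proof -
    have "(\<integral>\<^sup>+x. ennreal (g' (u x) * ?n x) \<partial>lebesgue) \<le> grad_sq \<Omega> G"
      unfolding grad_sq_def
    proof (rule nn_integral_mono)
      fix x
      have "g' (u x) * (norm (G x))\<^sup>2 \<le> (norm (G x))\<^sup>2"
        using truncationD(4,5)[OF g, of "u x"] by (simp add: mult_left_le_one_le)
      then show "ennreal (g' (u x) * ?n x) \<le> ennreal ((norm (G x))\<^sup>2) * indicator \<Omega> x"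
        by (cases "x \<in> \<Omega>") (simp_all add: ennreal_leI)
    qed
    then show ?thesis using G(2) by (rule le_less_trans)
  qed
  have AE: "AE x in lebesgue. 0 \<le> g' (u x) * (g' (u x) * ?n x) \<and> g' (u x) * (g' (u x) * ?n x) \<le> g' (u x) * ?n x"
    using truncationD(4,5)[OF g] by (intro AE_I2 conjI mult_left_le_one_le mult_nonneg_nonneg) auto
  have gg: "(\<lambda>x. g' (u x) * (g' (u x) * ?n x)) \<in> borel_measurable lebesgue" by (rule borel_measurable_times[OF gm fm])
  have "grad_sq \<Omega> (weak_grad \<Omega> (\<lambda>x. g (u x))) = (\<integral>\<^sup>+x. ennreal (g' (u x) * (g' (u x) * ?n x)) \<partial>lebesgue)"
    unfolding grad_sq_def
  proof (rule nn_integral_cong_AE)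
    show "AE x in lebesgue. ennreal ((norm (weak_grad \<Omega> (\<lambda>x. g (u x)) x))\<^sup>2) * indicator \<Omega> x = ennreal (g' (u x) * (g' (u x) * ?n x))"
      using AE1 AE2
    proof eventually_elim
      case (elim x)
      then show ?case by (cases "x \<in> \<Omega>") (simp_all add: power_mult_distrib power2_eq_square mult_ac)
    qed
  qed
  then show "grad_sq \<Omega> (weak_grad \<Omega> (\<lambda>x. g (u x))) \<le> ennreal I" "0 \<le> I"
    unfolding I using nn_integral_le_integral[OF fm gg AE fin] by simp_all
qed

section \<open>Boundedness of weak solutions\<close>

lemma L_inftyI:
  assumes \<Omega>: "open \<Omega>" and u: "u \<in> borel_measurable lebesgue"
    and AE: "AE x in lebesgue. x \<in> \<Omega> \<longrightarrow> \<bar>u x\<bar> \<le> c"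
  shows "u \<in> L_infty \<Omega>"
proof -
  have \<Omega>m: "\<Omega> \<in> sets lebesgue" using \<Omega> by simp
  have "esssup (lebesgue_on \<Omega>) (\<lambda>x. ereal \<bar>u x\<bar>) \<le> ereal c"
  proof (rule esssup_I)
    show "(\<lambda>x. ereal \<bar>u x\<bar>) \<in> borel_measurable (lebesgue_on \<Omega>)"
      by (rule measurable_restrict_space1) (use u in measurable)
    show "AE x in lebesgue_on \<Omega>. ereal \<bar>u x\<bar> \<le> ereal c"
      using AE \<Omega>m by (simp add: AE_restrict_space_iff)
  qed
  also have "\<dots> < \<infinity>" by simp
  finally show ?thesis by (simp add: L_infty_def)
qed

text \<open>
  Without a differential operator every measurable function that vanishes outside \<open>\<Omega>\<close> is admissible.
  Testing with the right-hand side \<open>H\<close> itself shows that \<open>H = 0\<close> almost everywhere, and this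
  determines \<open>\<bar>u\<bar>\<close> at all points where \<open>u\<close> is not \<open>0\<close>.
\<close>

lemma weak_solution_trivial_operator_bounded:
  fixes \<Omega> :: "'a::euclidean_space set"
  assumes \<Omega>: "open \<Omega>" and lam: "lam > 0" and \<gamma>: "0 < \<gamma>" and p: "frac_crit_exp DIM('a) s > 2"
    and sol: "weak_solution \<Omega> s 0 0 lam \<mu> \<gamma> \<xi> u"
  shows "u \<in> L_infty \<Omega>"
proof -
  define p where "p = frac_crit_exp DIM('a) s"
  define c where "c = \<mu> * \<xi> (Z_norm \<Omega> s 0 0 u)"
  define H where "H x = lam * \<bar>u x\<bar> powr (- \<gamma> - 1) * u x + c * \<bar>u x\<bar> powr (p - 2) * u x" for x
  have Z: "Z_space \<Omega> s 0 0 = fun_on \<Omega>" by (auto simp: Z_space_def Z_energy_def)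
  have u: "u \<in> fun_on \<Omega>" using sol Z by (simp add: weak_solution_def)
  note [measurable] = fun_onD(1)[OF u]
  have Hm [measurable]: "H \<in> borel_measurable lebesgue" unfolding H_def[abs_def] by measurable
  have H0: "H x = 0" if "x \<notin> \<Omega>" for x using fun_onD(2)[OF u that] by (simp add: H_def)
  have H: "H \<in> Z_space \<Omega> s 0 0" unfolding Z using Hm H0 by (auto simp: fun_on_def)
  have i: "set_integrable lebesgue \<Omega> (\<lambda>x. lam * \<bar>u x\<bar> powr (- \<gamma> - 1) * u x * H x)"
    "set_integrable lebesgue \<Omega> (\<lambda>x. c * \<bar>u x\<bar> powr (p - 2) * u x * H x)"
    and eq: "0 = (LINT x:\<Omega>|lebesgue. lam * \<bar>u x\<bar> powr (- \<gamma> - 1) * u x * H x)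
        + (LINT x:\<Omega>|lebesgue. c * \<bar>u x\<bar> powr (p - 2) * u x * H x)"
    using sol H unfolding weak_solution_def c_def p_def by auto
  have HH: "lam * \<bar>u x\<bar> powr (- \<gamma> - 1) * u x * H x + c * \<bar>u x\<bar> powr (p - 2) * u x * H x = (H x)\<^sup>2" for x
    by (simp add: H_def power2_eq_square algebra_simps)
  have ind: "indicator \<Omega> x *\<^sub>R (H x)\<^sup>2 = (H x)\<^sup>2" for x using H0[of x] by (cases "x \<in> \<Omega>") auto
  have int: "integrable lebesgue (\<lambda>x. (H x)\<^sup>2)"
    using set_integral_add(1)[OF i] unfolding HH set_integrable_def ind .
  have "0 = (\<integral>x. (H x)\<^sup>2 \<partial>lebesgue)"
    using eq set_integral_add(2)[OF i] unfolding HH set_lebesgue_integral_def ind by simp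
  then have "AE x in lebesgue. (H x)\<^sup>2 = 0"
    using integral_nonneg_eq_0_iff_AE[OF int] by simp
  then have AE: "AE x in lebesgue. \<bar>u x\<bar> \<le> (lam / \<bar>c\<bar>) powr (1 / (p + \<gamma> - 1))"
  proof (rule eventually_mono)
    fix x assume "(H x)\<^sup>2 = 0"
    then have H: "H x = 0" by simp
    show "\<bar>u x\<bar> \<le> (lam / \<bar>c\<bar>) powr (1 / (p + \<gamma> - 1))"
    proof (cases "u x = 0")
      case False
      then have t: "\<bar>u x\<bar> > 0" by simp
      have e: "p + \<gamma> - 1 > 0" using p \<gamma> by (simp add: p_def)
      have "(lam * \<bar>u x\<bar> powr (- \<gamma> - 1) + c * \<bar>u x\<bar> powr (p - 2)) * u x = 0"
        using H by (simp add: H_def algebra_simps)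
      then have "lam * \<bar>u x\<bar> powr (- \<gamma> - 1) + c * \<bar>u x\<bar> powr (p - 2) = 0" using False by simp
      moreover have "\<bar>u x\<bar> powr (p - 2) = \<bar>u x\<bar> powr (- \<gamma> - 1) * \<bar>u x\<bar> powr (p + \<gamma> - 1)"
        by (simp flip: powr_add)
      ultimately have "\<bar>u x\<bar> powr (- \<gamma> - 1) * (lam + c * \<bar>u x\<bar> powr (p + \<gamma> - 1)) = 0"
        by (simp add: algebra_simps)
      then have *: "lam + c * \<bar>u x\<bar> powr (p + \<gamma> - 1) = 0" using False by simp
      have c: "c < 0"
      proof (rule ccontr)
        assume "\<not> c < 0"
        then have "0 \<le> c * \<bar>u x\<bar> powr (p + \<gamma> - 1)" by simp
        then show False using * lam by linarith
      qed
      have "\<bar>u x\<bar> powr (p + \<gamma> - 1) = lam / \<bar>c\<bar>" using * c by (simp add: field_simps)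
      then have "(lam / \<bar>c\<bar>) powr (1 / (p + \<gamma> - 1)) = \<bar>u x\<bar>" using e t by (simp add: powr_powr flip: \<open>\<bar>u x\<bar> powr (p + \<gamma> - 1) = lam / \<bar>c\<bar>\<close>)
      then show ?thesis by simp
    qed simp
  qed
  show ?thesis
    by (rule L_inftyI[OF \<Omega> fun_onD(1)[OF u], where c="(lam / \<bar>c\<bar>) powr (1 / (p + \<gamma> - 1))"])
      (use AE in \<open>rule eventually_mono, simp\<close>)
qed

lemma Z_energy_eq:
  assumes \<Omega>: "open \<Omega>" and ab: "a \<ge> 0" "b \<ge> 0" and v: "v \<in> Z_space \<Omega> s a b"
  shows "Z_energy \<Omega> s a b v = ennreal a * gagliardo s v + ennreal b * grad_sq \<Omega> (weak_grad \<Omega> v)"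
proof -
  have "v \<in> fun_on \<Omega>" using v by (simp add: Z_space_def)
  moreover have "ennreal b * (grad_seminorm \<Omega> v)\<^sup>2 = ennreal b * grad_sq \<Omega> (weak_grad \<Omega> v)"
  proof (cases "b > 0")
    case True
    then have "v \<in> Y_space \<Omega>" using v by (simp add: Z_space_def)
    then obtain G where G: "has_weak_gradient \<Omega> v G" unfolding Y_space_iff[OF \<Omega>] by blast
    then show ?thesis
      by (simp add: grad_seminorm_eq[OF \<Omega> G] enn_sqrt_power2 grad_sq_cong_AE[OF weak_grad_AE_eq[OF \<Omega> G]])
  qed (use ab in simp)
  ultimately show ?thesis by (simp add: Z_energy_def frac_seminorm_eq enn_sqrt_power2)
qed

lemma ennreal_le_divideI:
  assumes "0 < a" "0 \<le> e" "ennreal a * t \<le> ennreal e"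
  shows "t \<le> ennreal (e / a)"
proof (cases t)
  case (real r)
  then have "a * r \<le> e" using assms by (simp add: ennreal_mult[symmetric])
  then show ?thesis using real assms(1) by (simp add: ennreal_leI pos_le_divide_eq mult.commute)
next
  case top
  then show ?thesis using assms by (simp add: ennreal_mult_top top_unique)
qed

text \<open>
  If \<open>a > 0\<close> the fractional part of the energy is used, otherwise the gradient part.
\<close>

theorem Z_space_sobolev:
  fixes \<Omega> :: "'a::euclidean_space set" and s :: real
  defines "p \<equiv> frac_crit_exp DIM('a) s"
  assumes \<Omega>: "open \<Omega>" "bounded \<Omega>" and ab: "a \<ge> 0" "b \<ge> 0" "a > 0 \<or> b > 0"
    and s: "0 < s" "s < 1" "2 * s < real DIM('a)"
  shows "\<exists>C>0. \<forall>v e. v \<in> Z_space \<Omega> s a b \<longrightarrow> 0 \<le> e \<longrightarrow> Z_energy \<Omega> s a b v \<le> ennreal e \<longrightarrow>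
     (\<integral>\<^sup>+x. ennreal (\<bar>v x\<bar> powr p) \<partial>lebesgue) \<le> ennreal ((C * e) powr (p / 2))"
proof (cases "a > 0")
  case True
  obtain C where C: "C > 0" "\<And>v e. v \<in> fun_on \<Omega> \<Longrightarrow> 0 \<le> e \<Longrightarrow> gagliardo s v \<le> ennreal e \<Longrightarrow>
     (\<integral>\<^sup>+x. ennreal (\<bar>v x\<bar> powr p) \<partial>lebesgue) \<le> ennreal ((C * e) powr (p / 2))"
    using frac_sobolev[OF s(1,3)] \<Omega>(2) unfolding p_def by blast
  have "(\<integral>\<^sup>+x. ennreal (\<bar>v x\<bar> powr p) \<partial>lebesgue) \<le> ennreal ((C / a * e) powr (p / 2))"
    if v: "v \<in> Z_space \<Omega> s a b" "0 \<le> e" "Z_energy \<Omega> s a b v \<le> ennreal e" for v e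
  proof -
    have "ennreal a * gagliardo s v \<le> Z_energy \<Omega> s a b v"
      unfolding Z_energy_eq[OF \<Omega>(1) ab(1,2) v(1)] by (simp add: add_increasing2)
    then have "gagliardo s v \<le> ennreal (e / a)"
      by (intro ennreal_le_divideI[OF True v(2)] order_trans[OF _ v(3)])
    then show ?thesis using C(2)[of v "e / a"] v True by (simp add: Z_space_def)
  qed
  moreover have "C / a > 0" using C(1) True by simp
  ultimately show ?thesis by blast
next
  case False
  then have b: "b > 0" using ab by auto
  obtain C where C: "C > 0" "\<And>v e. v \<in> Y_space \<Omega> \<Longrightarrow> 0 \<le> e \<Longrightarrow> grad_sq \<Omega> (weak_grad \<Omega> v) \<le> ennreal e \<Longrightarrow>
     (\<integral>\<^sup>+x. ennreal (\<bar>v x\<bar> powr p) \<partial>lebesgue) \<le> ennreal ((C * e) powr (p / 2))"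
    using Y_space_sobolev[OF s \<Omega>] unfolding p_def by blast
  have "(\<integral>\<^sup>+x. ennreal (\<bar>v x\<bar> powr p) \<partial>lebesgue) \<le> ennreal ((C / b * e) powr (p / 2))"
    if v: "v \<in> Z_space \<Omega> s a b" "0 \<le> e" "Z_energy \<Omega> s a b v \<le> ennreal e" for v e
  proof -
    have "ennreal b * grad_sq \<Omega> (weak_grad \<Omega> v) \<le> Z_energy \<Omega> s a b v"
      unfolding Z_energy_eq[OF \<Omega>(1) ab(1,2) v(1)] by (simp add: add_increasing)
    then have "grad_sq \<Omega> (weak_grad \<Omega> v) \<le> ennreal (e / b)"
      by (intro ennreal_le_divideI[OF b v(2)] order_trans[OF _ v(3)])
    then show ?thesis using C(2)[of v "e / b"] v b by (simp add: Z_space_def)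
  qed
  moreover have "C / b > 0" using C(1) b by simp
  ultimately show ?thesis by blast
qed

text \<open>
  The solution tested with its own truncation.  The truncation vanishes where \<open>\<sigma> * u \<le> h\<close>, and \<open>h \<ge> 1\<close>;
  so on its support the singular term is at most \<open>lam\<close>, and both terms are bounded by
  a multiple of \<open>\<bar>u\<bar> powr (p - 1)\<close>.
\<close>

lemma weak_solution_tested_with_ramp:
  fixes \<Omega> :: "'a::euclidean_space set"
  assumes \<Omega>: "open \<Omega>" and ab: "a \<ge> 0" "b \<ge> 0" and lam: "lam > 0" and \<gamma>: "0 < \<gamma>"
    and p: "frac_crit_exp DIM('a) s > 2"
    and sol: "weak_solution \<Omega> s a b lam \<mu> \<gamma> \<xi> u"
    and \<sigma>: "\<sigma> = 1 \<or> \<sigma> = -1" and h: "1 \<le> h" "h < k"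
    and B: "0 \<le> B" "(\<integral>\<^sup>+x. ennreal ((max 0 (\<sigma> * u x)) powr (frac_crit_exp DIM('a) s - 1) * max 0 (\<sigma> * u x - h)) \<partial>lebesgue) \<le> ennreal B"
  defines "\<phi> \<equiv> \<lambda>x. ramp \<sigma> h k (u x)" and "\<Lambda> \<equiv> lam + \<bar>\<mu> * \<xi> (Z_norm \<Omega> s a b u)\<bar>"
  shows "Z_energy \<Omega> s a b \<phi> \<le> ennreal (\<Lambda> * B)"
proof -
  define p where "p = frac_crit_exp DIM('a) s"
  have p2: "p > 2" using p by (simp add: p_def)
  define c where "c = \<mu> * \<xi> (Z_norm \<Omega> s a b u)"
  have \<Lambda>: "\<Lambda> = lam + \<bar>c\<bar>" "\<Lambda> > 0" using lam by (auto simp: \<Lambda>_def c_def)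
  have uZ: "u \<in> Z_space \<Omega> s a b" using sol by (simp add: weak_solution_def)
  then have u: "u \<in> fun_on \<Omega>" by (simp add: Z_space_def)
  have g: "truncation (ramp \<sigma> h k) (ramp_deriv \<sigma> h k)" using h by (intro ramp_truncation[OF \<sigma>]) auto
  have \<phi>: "\<phi> \<in> Z_space \<Omega> s a b" unfolding \<phi>_def by (rule truncation_Z_space[OF \<Omega> g uZ ab])
  define IQ where "IQ = (LINT z:Q_set \<Omega>|lebesgue. (u (fst z) - u (snd z)) * (\<phi> (fst z) - \<phi> (snd z)) /
               norm (fst z - snd z) powr (real DIM('a) + 2 * s))"
  define IG where "IG = (LINT x:\<Omega>|lebesgue. weak_grad \<Omega> u x \<bullet> weak_grad \<Omega> \<phi> x)"
  have i: "set_integrable lebesgue \<Omega> (\<lambda>x. lam * \<bar>u x\<bar> powr (- \<gamma> - 1) * u x * \<phi> x)"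
    "set_integrable lebesgue \<Omega> (\<lambda>x. c * \<bar>u x\<bar> powr (p - 2) * u x * \<phi> x)"
    and eq: "a * IQ + b * IG = (LINT x:\<Omega>|lebesgue. lam * \<bar>u x\<bar> powr (- \<gamma> - 1) * u x * \<phi> x)
        + (LINT x:\<Omega>|lebesgue. c * \<bar>u x\<bar> powr (p - 2) * u x * \<phi> x)"
    using sol \<phi> unfolding weak_solution_def c_def p_def IQ_def IG_def by auto
  note [measurable] = fun_onD(1)[OF u]
  let ?F = "\<lambda>x. lam * \<bar>u x\<bar> powr (- \<gamma> - 1) * u x * \<phi> x + c * \<bar>u x\<bar> powr (p - 2) * u x * \<phi> x"
  have F: "indicator \<Omega> x *\<^sub>R ?F x \<le> \<Lambda> * ((max 0 (\<sigma> * u x)) powr (p - 1) * max 0 (\<sigma> * u x - h))" for x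
  proof (cases "\<sigma> * u x > h")
    case False
    have "max 0 (\<sigma> * u x - k) \<le> \<sigma> * \<phi> x" "\<sigma> * \<phi> x \<le> max 0 (\<sigma> * u x - h)"
      unfolding \<phi>_def by (rule ramp_bounds[OF \<sigma> h(2)])+
    then have "\<sigma> * \<phi> x = 0" using False by linarith
    then have "\<phi> x = 0" using \<sigma> by auto
    then show ?thesis using \<Lambda>(2) by simp
  next
    case True
    define w where "w = \<sigma> * u x"
    have w: "w > h" "w > 1" using True h by (auto simp: w_def)
    have absu: "\<bar>u x\<bar> = w" using \<sigma> w(2) by (auto simp: w_def)
    have "x \<in> \<Omega>" using fun_onD(2)[OF u, of x] absu w(2) by (cases "x \<in> \<Omega>") auto
    have y: "0 \<le> \<sigma> * \<phi> x" "\<sigma> * \<phi> x \<le> w - h"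
      using ramp_bounds[OF \<sigma> h(2), of "u x"] w(1) unfolding \<phi>_def w_def by (auto simp: max_def split: if_splits)
    have u\<phi>: "u x * \<phi> x = w * (\<sigma> * \<phi> x)" using \<sigma> by (auto simp: w_def)
    have 1: "w powr (- \<gamma> - 1) * w = w powr (- \<gamma>)" using w(2) powr_add[of w "- \<gamma> - 1" 1] by simp
    have 2: "w powr (p - 2) * w = w powr (p - 1)" using w(2) powr_add[of w "p - 2" 1] by simp
    have 3: "w powr (- \<gamma>) \<le> w powr (p - 1)" using w(2) p2 \<gamma> by (intro powr_mono) auto
    have "?F x = lam * w powr (- \<gamma> - 1) * (u x * \<phi> x) + c * w powr (p - 2) * (u x * \<phi> x)"
      unfolding absu by (simp only: mult.assoc)
    also have "\<dots> = lam * (w powr (- \<gamma> - 1) * w) * (\<sigma> * \<phi> x) + c * (w powr (p - 2) * w) * (\<sigma> * \<phi> x)"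
      unfolding u\<phi> by (simp only: mult.assoc)
    also have "\<dots> = (lam * w powr (- \<gamma>) + c * w powr (p - 1)) * (\<sigma> * \<phi> x)"
      unfolding 1 2 by (simp add: algebra_simps)
    also have "\<dots> \<le> (\<Lambda> * w powr (p - 1)) * (w - h)"
    proof (rule mult_mono[OF _ y(2) _ y(1)])
      have "lam * w powr (- \<gamma>) \<le> lam * w powr (p - 1)" "c * w powr (p - 1) \<le> \<bar>c\<bar> * w powr (p - 1)"
        using 3 lam by (auto intro: mult_left_mono mult_right_mono)
      then show "lam * w powr (- \<gamma>) + c * w powr (p - 1) \<le> \<Lambda> * w powr (p - 1)"
        by (simp add: \<Lambda>(1) distrib_right)
      show "0 \<le> \<Lambda> * w powr (p - 1)" using \<Lambda>(2) by simp
    qed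
    finally show ?thesis using \<open>x \<in> \<Omega>\<close> w by (simp add: w_def[symmetric] mult.assoc)
  qed
  have "a * IQ + b * IG = (\<integral>x. indicator \<Omega> x *\<^sub>R ?F x \<partial>lebesgue)"
    using eq set_integral_add(2)[OF i] by (simp add: set_lebesgue_integral_def)
  also have "\<dots> \<le> \<Lambda> * B"
  proof (rule integral_le_of_nn_integral)
    show "integrable lebesgue (\<lambda>x. indicator \<Omega> x *\<^sub>R ?F x)"
      using set_integral_add(1)[OF i] by (simp add: set_integrable_def)
    have "(\<integral>\<^sup>+x. ennreal (indicator \<Omega> x *\<^sub>R ?F x) \<partial>lebesgue) \<le>
        (\<integral>\<^sup>+x. ennreal \<Lambda> * ennreal ((max 0 (\<sigma> * u x)) powr (p - 1) * max 0 (\<sigma> * u x - h)) \<partial>lebesgue)"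
    proof (rule nn_integral_mono)
      fix x
      show "ennreal (indicator \<Omega> x *\<^sub>R ?F x) \<le> ennreal \<Lambda> * ennreal ((max 0 (\<sigma> * u x)) powr (p - 1) * max 0 (\<sigma> * u x - h))"
        using ennreal_leI[OF F[of x]] \<Lambda>(2) by (simp only: ennreal_mult' less_imp_le)
    qed
    also have "\<dots> = ennreal \<Lambda> * (\<integral>\<^sup>+x. ennreal ((max 0 (\<sigma> * u x)) powr (p - 1) * max 0 (\<sigma> * u x - h)) \<partial>lebesgue)"
      by (rule nn_integral_cmult) measurable
    also have "\<dots> \<le> ennreal \<Lambda> * ennreal B" using B(2) by (intro mult_left_mono) (simp_all add: p_def)
    also have "\<dots> = ennreal (\<Lambda> * B)" using \<Lambda>(2) B(1) by (simp add: ennreal_mult)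
    finally show "(\<integral>\<^sup>+x. ennreal (indicator \<Omega> x *\<^sub>R ?F x) \<partial>lebesgue) \<le> ennreal (\<Lambda> * B)" .
    show "0 \<le> \<Lambda> * B" using \<Lambda>(2) B(1) by simp
  qed
  finally have main: "a * IQ + b * IG \<le> \<Lambda> * B" .
  have Q: "gagliardo s \<phi> \<le> ennreal IQ \<and> 0 \<le> IQ" if "a > 0"
    using truncation_frac_form[OF g, of u \<Omega> s] uZ that unfolding IQ_def \<phi>_def by (auto simp: Z_space_def)
  have G: "grad_sq \<Omega> (weak_grad \<Omega> \<phi>) \<le> ennreal IG \<and> 0 \<le> IG" if "b > 0"
    using truncation_grad_form[OF \<Omega> g, of u] uZ that unfolding IG_def \<phi>_def by (auto simp: Z_space_def)
  have Q': "ennreal a * gagliardo s \<phi> \<le> ennreal (a * IQ)" "0 \<le> a * IQ"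
    using Q ab(1) by (cases "a > 0"; simp add: ennreal_mult mult_left_mono)+
  have G': "ennreal b * grad_sq \<Omega> (weak_grad \<Omega> \<phi>) \<le> ennreal (b * IG)" "0 \<le> b * IG"
    using G ab(2) by (cases "b > 0"; simp add: ennreal_mult mult_left_mono)+
  have "Z_energy \<Omega> s a b \<phi> = ennreal a * gagliardo s \<phi> + ennreal b * grad_sq \<Omega> (weak_grad \<Omega> \<phi>)"
    by (rule Z_energy_eq[OF \<Omega> ab \<phi>])
  also have "\<dots> \<le> ennreal (a * IQ) + ennreal (b * IG)" by (rule add_mono[OF Q'(1) G'(1)])
  also have "\<dots> = ennreal (a * IQ + b * IG)" using Q'(2) G'(2) by simp
  also have "\<dots> \<le> ennreal (\<Lambda> * B)" by (rule ennreal_leI[OF main])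
  finally show ?thesis .
qed

theorem theorem4p2:
  fixes \<Omega> :: "'a::euclidean_space set"
    and a b s lam \<mu> \<gamma> l :: real
    and \<xi> :: "real \<Rightarrow> real"
    and u :: "'a \<Rightarrow> real"
  assumes "DIM('a) \<ge> 2"
    and "bounded_domain \<Omega>"
    and "a \<ge> 0" and "b \<ge> 0"
    and "0 < s" and "s < 1"
    and "2 < frac_crit_exp DIM('a) s"
    and "ereal (frac_crit_exp DIM('a) s) < crit_exp DIM('a)"
    and "lam > 0"
    and "0 < \<gamma>" and "\<gamma> < 1"
    and "l > 0" and "cutoff l \<xi>"
    and "weak_solution \<Omega> s a b lam \<mu> \<gamma> \<xi> u"
  shows "u \<in> L_infty \<Omega>"
proof -
  have \<Omega>: "open \<Omega>" "bounded \<Omega>" using assms(2) by (auto simp: bounded_domain_def)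
  show ?thesis
  proof (cases "a > 0 \<or> b > 0")
    case False
    then have "a = 0" "b = 0" using assms(3,4) by auto
    then show ?thesis
      using weak_solution_trivial_operator_bounded[OF \<Omega>(1) assms(9,10,7)] assms(14) by simp
  next
    case True
    define p where "p = frac_crit_exp DIM('a) s"
    have p2: "p > 2" using assms(7) by (simp add: p_def)
    have s: "2 * s < real DIM('a)"
    proof (rule ccontr)
      assume "\<not> ?thesis"
      then have "p \<le> 0" unfolding p_def frac_crit_exp_def by (intro divide_nonneg_nonpos) auto
      then show False using p2 by simp
    qed
    have uZ: "u \<in> Z_space \<Omega> s a b" using assms(14) by (simp add: weak_solution_def)
    then have u: "u \<in> fun_on \<Omega>" "Z_energy \<Omega> s a b u < \<infinity>" by (simp_all add: Z_space_def)
    note [measurable] = fun_onD(1)[OF u(1)]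
    obtain C where C: "C > 0" "\<And>v e. v \<in> Z_space \<Omega> s a b \<Longrightarrow> 0 \<le> e \<Longrightarrow> Z_energy \<Omega> s a b v \<le> ennreal e \<Longrightarrow>
      (\<integral>\<^sup>+x. ennreal (\<bar>v x\<bar> powr p) \<partial>lebesgue) \<le> ennreal ((C * e) powr (p / 2))"
      using Z_space_sobolev[OF \<Omega> assms(3,4) True assms(5,6) s] unfolding p_def by blast
    have "(\<integral>\<^sup>+x. ennreal (\<bar>u x\<bar> powr p) \<partial>lebesgue) \<le> ennreal ((C * enn2real (Z_energy \<Omega> s a b u)) powr (p / 2))"
      using uZ u(2) by (intro C(2)) auto
    then have Lp: "(\<integral>\<^sup>+x. ennreal (\<bar>u x\<bar> powr p) \<partial>lebesgue) < \<infinity>" by (rule le_less_trans) simp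
    define \<Lambda> where "\<Lambda> = lam + \<bar>\<mu> * \<xi> (Z_norm \<Omega> s a b u)\<bar>"
    have \<Lambda>: "\<Lambda> > 0" using assms(9) by (simp add: \<Lambda>_def)
    have bounded: "\<exists>L. AE x in lebesgue. \<sigma> * u x \<le> L" if \<sigma>: "\<sigma> = 1 \<or> \<sigma> = -1" for \<sigma>
    proof (rule de_giorgi_bounded[OF p2, of "C * \<Lambda>"])
      show "C * \<Lambda> > 0" using C(1) \<Lambda> by simp
      show "(\<lambda>x. \<sigma> * u x) \<in> borel_measurable lebesgue" by measurable
      have "(\<integral>\<^sup>+x. ennreal ((max 0 (\<sigma> * u x)) powr p) \<partial>lebesgue) \<le> (\<integral>\<^sup>+x. ennreal (\<bar>u x\<bar> powr p) \<partial>lebesgue)"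
        using p2 \<sigma> by (intro nn_integral_mono ennreal_leI powr_mono2) auto
      then show "(\<integral>\<^sup>+x. ennreal ((max 0 (\<sigma> * u x)) powr p) \<partial>lebesgue) < \<infinity>" using Lp by (rule le_less_trans)
      fix h k B :: real
      assume *: "1 \<le> h" "h < k" "0 \<le> B"
        "(\<integral>\<^sup>+x. ennreal ((max 0 (\<sigma> * u x)) powr (p - 1) * max 0 (\<sigma> * u x - h)) \<partial>lebesgue) \<le> ennreal B"
      have "(\<integral>\<^sup>+x. ennreal ((max 0 (\<sigma> * u x - k)) powr p) \<partial>lebesgue) \<le> (\<integral>\<^sup>+x. ennreal (\<bar>ramp \<sigma> h k (u x)\<bar> powr p) \<partial>lebesgue)"
      proof (intro nn_integral_mono ennreal_leI powr_mono2)
        fix x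
        have "max 0 (\<sigma> * u x - k) \<le> \<sigma> * ramp \<sigma> h k (u x)" by (rule ramp_bounds(1)[OF \<sigma> *(2)])
        also have "\<dots> \<le> \<bar>ramp \<sigma> h k (u x)\<bar>" using \<sigma> by auto
        finally show "max 0 (\<sigma> * u x - k) \<le> \<bar>ramp \<sigma> h k (u x)\<bar>" .
      qed (use p2 in auto)
      also have "\<dots> \<le> ennreal ((C * (\<Lambda> * B)) powr (p / 2))"
      proof (rule C(2))
        show "(\<lambda>x. ramp \<sigma> h k (u x)) \<in> Z_space \<Omega> s a b"
          using *(1,2) by (intro truncation_Z_space[OF \<Omega>(1) ramp_truncation[OF \<sigma>] uZ assms(3,4)]) auto
        show "0 \<le> \<Lambda> * B" using \<Lambda> *(3) by simp
        show "Z_energy \<Omega> s a b (\<lambda>x. ramp \<sigma> h k (u x)) \<le> ennreal (\<Lambda> * B)"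
          unfolding \<Lambda>_def
          by (rule weak_solution_tested_with_ramp[OF \<Omega>(1) assms(3,4,9,10,7,14) \<sigma> *(1-3) *(4)[unfolded p_def]])
      qed
      finally show "(\<integral>\<^sup>+x. ennreal ((max 0 (\<sigma> * u x - k)) powr p) \<partial>lebesgue) \<le> ennreal ((C * \<Lambda> * B) powr (p / 2))"
        by (simp add: mult.assoc)
    qed
    obtain L1 L2 where L: "AE x in lebesgue. 1 * u x \<le> L1" "AE x in lebesgue. (-1) * u x \<le> L2"
      using bounded[of 1] bounded[of "-1"] by blast
    have "AE x in lebesgue. x \<in> \<Omega> \<longrightarrow> \<bar>u x\<bar> \<le> max L1 L2"
      using L by eventually_elim auto
    then show ?thesis by (rule L_inftyI[OF \<Omega>(1) fun_onD(1)[OF u(1)]])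
  qed
qed

end
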